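(* Let $n\in\mathbb N$ and let $C\in\mathcal C^n$ be a multiplication rule. The odd center $OZ(OH^n_C)$ is an associative ring, and it does not depend on $C$: for any $C,C'\in\mathcal C^n$ the graded rings $OZ(OH^n_C)$ and $OZ(OH^n_{C'})$ are isomorphic. Furthermore, there is an isomorphism of graded rings $$OZ(OH^n_C)\simeq OH(\mathfrak B_{n,n}).$$
   Context: **Diagrams.** $B^n$ is the set of crossingless matchings of the $2n$ points $\{1,\dots,2n\}$ on a line: partitions of the points into $n$ pairs (arcs) which can be drawn as $n$ pairwise disjoint half-circles on one side of the line (arcs may be nested). $W$ denotes reflection in the line. For $a,b\in B^n$, $W(b)a$ is the collection of disjoint circles in the plane obtained by gluing the reflection of $b$ to $a$ along the $2n$ points; its circles correspond to the connected components of the graph on $\{1,\dots,2n\}$ whose edges are the arcs of $a$ and of $b$. $|W(b)a|$ is the number of circles. **The group $OH^n$.** For a collection of circles $S$, $V(S)$ is the free abelian group on the circles of $S$. Put $b(OH^n)a:=\bigwedge^*V(W(b)a)$ (exterior algebra over $\mathbb Z$), graded so that a wedge of $k$ circles has degree $2k+n-|W(b)a|$. Let ${}_b1_a$ be the unit of this exterior algebra and $1_a:={}_a1_a$. Set $OH^n:=\bigoplus_{a,b\in B^n}b(OH^n)a$. **Multiplication rules.** A multiplication rule $C$ consists, for each triple $(c,b,a)\in (B^n)^3$, of (i) a total order on the points $\{1,\dots,2n\}$ such that whenever $i,j$ are joined by an arc of $b$ and $k$ lies strictly between $i$ and $j$ (in the usual order), then $i$ or $j$ precedes $k$ in the order of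 the rule; and (ii) an orientation $i\to j$ or $j\to i$ of each arc $\{i,j\}$ of $b$. $\mathcal C^n$ is the set of all multiplication rules. **Multiplication.** $OH^n_C$ is $OH^n$ with the following multiplication. If $c\neq b$ the product of an element of $d(OH^n)c$ with an element of $b(OH^n)a$ is $0$. For $x\in c(OH^n)b$, $y\in b(OH^n)a$, place $W(c)b$ above $W(b)a$; this gives a collection of circles $D_0$ and the element $x\wedge y\in\bigwedge^*V(D_0)$ (using $V(D_0)=V(W(c)b)\oplus V(W(b)a)$). Go through the points in the order given by $C$ for $(c,b,a)$; each time an arc $\{i,j\}$ of $b$ is met for the first time, do a surgery: delete the copy of this arc in $W(c)b$ and its mirror copy in $W(b)a$, and join the upper point $i$ to the lower point $i$ and the upper point $j$ to the lower point $j$ by vertical segments. Each surgery either merges two circles into one or splits one circle into two. To a merge $S_1\to S_2$ of $a_1,a_2$ into $b_1$ associate the map $\bigwedge^*V(S_1)\to\bigwedge^*V(S_2)$ induced by $a_1,a_2\mapsto b_1$ and the identity on the other circles. To a split $S_1\to S_2$ of a circle $e$ into the circle $e_i$ through point $i$ and the circle $e_j$ through point $j$, with orientation $i\to j$ of the arc, associate the map $x\mapsto (e_i-e_j)\wedge x'$, where $x'$ is obtained from $x$ by replacing $e$ by $e_i$ (equivalently by $e_j$). After all $n$ surgeries one obtains $W(c)a$, and $xy\in c(OH^n)a$ is the image of $x\wedge y$ under the composite of these maps. $OH^n_C$ is a graded unital, in general non-associative, ring with unit $\sum_a 1_a$. **Odd center.** For a homogeneous $x\in b(OH^n_C)a$,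 $p(x)$ is its exterior degree (the number of wedge factors). $OZ(OH^n_C):=\{z\in OH^n_C : zx=(-1)^{p(x)p(z)}xz\ \text{for all } x\in OH^n_C\}$, where the condition is understood as the vanishing of the bilinear extension of $[z,x]=zx-(-1)^{p(z)p(x)}xz$ from homogeneous elements. **Odd Springer cohomology.** $OPol_{2n}:=\mathbb Z\langle x_1,\dots,x_{2n}\rangle/\langle x_ix_j+x_jx_i : i\ne j\rangle$ with $\deg x_i=2$. For an ordered subset $I\subset\{1,\dots,2n\}$ and $i\in I$ let $I(i)$ be the position of $i$ in $I$ (increasing order) and $x_i^I:=(-1)^{I(i)-1}x_i$; put $\epsilon^I_r:=\sum_{i_1<\dots<i_r,\ i_j\in I}x^I_{i_1}\cdots x^I_{i_r}$. Let $OI_n$ be the left ideal of $OPol_{2n}$ generated by all $\epsilon^I_r$ with $k\in\{1,\dots,n\}$, $|I|=n+k$, $r\in\{n-k+1,\dots,n+k\}$. This ideal is two-sided, and $OH(\mathfrak B_{n,n}):=OPol_{2n}/OI_n$, a graded ring (the "odd cohomology of the $(n,n)$ Springer variety"). *)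

theory Defs
  imports "HOL-Algebra.QuotRing" "HOL-Library.Disjoint_Sets"
begin

section \<open>Graded rings\<close>

text \<open>A \<open>\<int>\<close>-graded (associative, unital) ring: \<open>G d\<close> is the component of degree \<open>d\<close>.\<close>

definition graded_ring :: "('r, 'm) ring_scheme \<Rightarrow> (int \<Rightarrow> 'r set) \<Rightarrow> bool" where
  "graded_ring R G \<longleftrightarrow>
     ring R \<and>
     (\<forall>d. additive_subgroup (G d) R) \<and>
     \<one>\<^bsub>R\<^esub> \<in> G 0 \<and>
     (\<forall>d e. \<forall>x \<in> G d. \<forall>y \<in> G e. x \<otimes>\<^bsub>R\<^esub> y \<in> G (d + e)) \<and>
     (\<forall>x \<in> carrier R. \<exists>!y. (\<forall>d. y d \<in> G d) \<and> finite {d. y d \<noteq> \<zero>\<^bsub>R\<^esub>} \<and>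
        x = (\<Oplus>\<^bsub>R\<^esub>d\<in>{d. y d \<noteq> \<zero>\<^bsub>R\<^esub>}. y d))"

definition graded_isomorphic ::
    "('r, 'm) ring_scheme \<Rightarrow> (int \<Rightarrow> 'r set) \<Rightarrow> ('s, 'k) ring_scheme \<Rightarrow> (int \<Rightarrow> 's set) \<Rightarrow> bool" where
  "graded_isomorphic R G S H \<longleftrightarrow>
     graded_ring R G \<and> graded_ring S H \<and> (\<exists>h \<in> ring_iso R S. \<forall>d. h ` G d = H d)"


section \<open>Exterior algebra of a free abelian group\<close>

text \<open>
  The exterior algebra of the free abelian group on a finite, linearly ordered set \<open>S\<close> is given in
  its standard basis \<open>s\<^sub>1 \<and> \<dots> \<and> s\<^sub>k\<close>, \<open>s\<^sub>1 < \<dots> < s\<^sub>k\<close>: the function \<open>f\<close> stands for the element whose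
  coefficient at this monomial is \<open>f {s\<^sub>1, \<dots>, s\<^sub>k}\<close>.
\<close>

type_synonym 'a ext = "'a set \<Rightarrow> int"

definition ext_carrier :: "'a set \<Rightarrow> 'a ext set" where
  "ext_carrier S = {f. \<forall>U. f U \<noteq> 0 \<longrightarrow> U \<subseteq> S}"

definition ext_one :: "'a ext" where
  "ext_one = (\<lambda>U. if U = {} then 1 else 0)"

definition ext_gen :: "'a \<Rightarrow> 'a ext" where
  "ext_gen s = (\<lambda>U. if U = {s} then 1 else 0)"

text \<open>The sign relating the concatenation of the monomials of \<open>A\<close> and \<open>B\<close> to the monomial of \<open>A \<union> B\<close>.\<close>

definition shuffle_sign :: "'a::linorder set \<Rightarrow> 'a set \<Rightarrow> int" where
  "shuffle_sign A B = (-1) ^ card {(s, t). s \<in> A \<and> t \<in> B \<and> t < s}"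

definition wedge :: "'a::linorder ext \<Rightarrow> 'a ext \<Rightarrow> 'a ext" (infixr \<open>\<and>\<^sub>e\<close> 70) where
  "f \<and>\<^sub>e g = (\<lambda>U. \<Sum>A\<in>Pow U. shuffle_sign A (U - A) * f A * g (U - A))"

definition wedge_list :: "'a::linorder list \<Rightarrow> 'a ext" where
  "wedge_list ss = foldr (\<lambda>s f. ext_gen s \<and>\<^sub>e f) ss ext_one"

text \<open>The algebra homomorphism induced by a map \<open>h\<close> of generators.\<close>

definition ext_map :: "('a::linorder \<Rightarrow> 'b::linorder) \<Rightarrow> 'a ext \<Rightarrow> 'b ext" where
  "ext_map h f = (\<lambda>U. \<Sum>A | f A \<noteq> 0. f A * wedge_list (map h (sorted_list_of_set A)) U)"


section \<open>Crossingless matchings and circles\<close>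

type_synonym matching = "nat set set"

text \<open>Two half-circles on the same side of the line intersect iff their end points interleave.\<close>

definition crossingless_matchings :: "nat \<Rightarrow> matching set" where
  "crossingless_matchings n =
     {a. partition_on {1..2 * n} a \<and> (\<forall>e \<in> a. card e = 2) \<and>
         \<not> (\<exists>i j k l. i < j \<and> j < k \<and> k < l \<and> {i, k} \<in> a \<and> {j, l} \<in> a)}"

text \<open>
  A collection of circles is given by a set \<open>E\<close> of edges on natural numbers; its circles are the
  connected components, and a circle is named by its least vertex. Thus \<open>circle_of E v\<close> is the
  circle through \<open>v\<close>, and the order of the circles used for \<open>ext\<close> is the order of least vertices.
\<close>

definition adjacent :: "nat set set \<Rightarrow> (nat \<times> nat) set" where
  "adjacent E = {(v, w). \<exists>e \<in> E. v \<in> e \<and> w \<in> e}"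

definition circle_of :: "nat set set \<Rightarrow> nat \<Rightarrow> nat" where
  "circle_of E v = (LEAST w. (v, w) \<in> (adjacent E)\<^sup>*)"

definition circles :: "matching \<Rightarrow> matching \<Rightarrow> nat set" where
  "circles b a = circle_of (b \<union> a) ` \<Union> (b \<union> a)"


section \<open>Multiplication rules\<close>

text \<open>
  For a triple \<open>(c, b, a)\<close>, a rule gives the list of all points in the chosen total order, and the
  source \<open>i\<close> of the orientation \<open>i \<rightarrow> j\<close> of each arc \<open>{i, j}\<close> of \<open>b\<close>.
\<close>

type_synonym mult_rule = "matching \<Rightarrow> matching \<Rightarrow> matching \<Rightarrow> nat list \<times> (nat set \<Rightarrow> nat)"

definition precedes :: "'a list \<Rightarrow> 'a \<Rightarrow> 'a \<Rightarrow> bool" where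
  "precedes xs u v \<longleftrightarrow> (\<exists>p q. p < q \<and> q < length xs \<and> xs ! p = u \<and> xs ! q = v)"

definition admissible_order :: "nat \<Rightarrow> matching \<Rightarrow> nat list \<Rightarrow> bool" where
  "admissible_order n b xs \<longleftrightarrow>
     distinct xs \<and> set xs = {1..2 * n} \<and>
     (\<forall>i j k. {i, j} \<in> b \<and> i < k \<and> k < j \<longrightarrow> precedes xs i k \<or> precedes xs j k)"

definition mult_rules :: "nat \<Rightarrow> mult_rule set" where
  "mult_rules n = {C.
     \<forall>c \<in> crossingless_matchings n. \<forall>b \<in> crossingless_matchings n. \<forall>a \<in> crossingless_matchings n.
       admissible_order n b (fst (C c b a)) \<and> (\<forall>e \<in> b. snd (C c b a) e \<in> e)}"


section \<open>The odd arc algebra\<close>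

text \<open>
  The diagram obtained from \<open>W(c)b\<close> placed above \<open>W(b)a\<close> by surgery on the arcs in \<open>T \<subseteq> b\<close>. The upper
  point \<open>i\<close> is the vertex \<open>i\<close> and the lower point \<open>i\<close> is the vertex \<open>2 * n + i\<close>; in particular, after
  all surgeries the circles have the same names as those of \<open>W(c)a\<close>.
\<close>

definition stacked :: "nat \<Rightarrow> matching \<Rightarrow> matching \<Rightarrow> matching \<Rightarrow> nat set set \<Rightarrow> nat set set" where
  "stacked n c b a T =
     c \<union> (b - T) \<union> (\<lambda>e. (+) (2 * n) ` e) ` ((b - T) \<union> a) \<union> {{i, 2 * n + i} |i. i \<in> \<Union> T}"

text \<open>
  The map of a surgery \<open>E \<leadsto> E'\<close> on the arc \<open>i \<rightarrow> j\<close>. It is a merge if the two deleted copies of this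
  arc lie on different circles of \<open>E\<close>, and a split otherwise.
\<close>

definition surgery_map ::
    "nat \<Rightarrow> nat set set \<Rightarrow> nat set set \<Rightarrow> nat \<Rightarrow> nat \<Rightarrow> nat ext \<Rightarrow> nat ext" where
  "surgery_map n E E' i j x =
     (let a1 = circle_of E i; a2 = circle_of E (2 * n + i);
          ei = circle_of E' i; ej = circle_of E' j
      in if a1 \<noteq> a2
         then ext_map (\<lambda>s. if s = a1 \<or> s = a2 then ei else s) x
         else (\<lambda>U. ext_gen ei U - ext_gen ej U) \<and>\<^sub>e ext_map (\<lambda>s. if s = a1 then ei else s) x)"

definition arc_at :: "matching \<Rightarrow> nat \<Rightarrow> nat set" where
  "arc_at b p = (THE e. e \<in> b \<and> p \<in> e)"

text \<open>The state consists of the set of arcs already treated and the current element.\<close>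

definition visit_point ::
    "nat \<Rightarrow> mult_rule \<Rightarrow> matching \<Rightarrow> matching \<Rightarrow> matching \<Rightarrow> nat \<Rightarrow>
     nat set set \<times> nat ext \<Rightarrow> nat set set \<times> nat ext" where
  "visit_point n C c b a p = (\<lambda>(T, x).
     let e = arc_at b p; i = snd (C c b a) e; j = the_elem (e - {i})
     in if e \<in> T then (T, x)
        else (insert e T,
              surgery_map n (stacked n c b a T) (stacked n c b a (insert e T)) i j x))"

definition mult_cba ::
    "nat \<Rightarrow> mult_rule \<Rightarrow> matching \<Rightarrow> matching \<Rightarrow> matching \<Rightarrow> nat ext \<Rightarrow> nat ext \<Rightarrow> nat ext" where
  "mult_cba n C c b a x y =
     snd (fold (visit_point n C c b a) (fst (C c b a)) ({}, x \<and>\<^sub>e ext_map ((+) (2 * n)) y))"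

text \<open>
  \<open>x b a\<close> is the component of \<open>x\<close> in \<open>b(OH\<^sup>n)a\<close>. The ring record below is in general not associative.
\<close>

type_synonym arc_elt = "matching \<Rightarrow> matching \<Rightarrow> nat ext"

definition OH_carrier :: "nat \<Rightarrow> arc_elt set" where
  "OH_carrier n = {x. \<forall>b a.
     if b \<in> crossingless_matchings n \<and> a \<in> crossingless_matchings n
     then x b a \<in> ext_carrier (circles b a) else x b a = (\<lambda>U. 0)}"

definition OH :: "nat \<Rightarrow> mult_rule \<Rightarrow> arc_elt ring" where
  "OH n C =
     \<lparr>carrier = OH_carrier n,
      mult = (\<lambda>x y c a U. \<Sum>b\<in>crossingless_matchings n. mult_cba n C c b a (x c b) (y b a) U),
      one = (\<lambda>b a. if b = a \<and> a \<in> crossingless_matchings n then ext_one else (\<lambda>U. 0)),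
      zero = (\<lambda>b a U. 0),
      add = (\<lambda>x y b a U. x b a U + y b a U)\<rparr>"

definition OH_degree :: "nat \<Rightarrow> int \<Rightarrow> arc_elt set" where
  "OH_degree n d = {x \<in> OH_carrier n.
     \<forall>b a U. x b a U \<noteq> 0 \<longrightarrow> 2 * int (card U) + int n - int (card (circles b a)) = d}"


section \<open>The odd center\<close>

definition ext_part :: "nat \<Rightarrow> arc_elt \<Rightarrow> arc_elt" where
  "ext_part k x = (\<lambda>b a U. if card U = k then x b a U else 0)"

text \<open>
  The bilinear extension of \<open>zx - (-1)\<^bsup>p(z)p(x)\<^esup> xz\<close>. Exterior degrees are at most \<open>n\<close>, since every
  circle of \<open>W(b)a\<close> passes through at least two of the \<open>2n\<close> points.
\<close>

definition odd_commutator :: "nat \<Rightarrow> mult_rule \<Rightarrow> arc_elt \<Rightarrow> arc_elt \<Rightarrow> arc_elt" where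
  "odd_commutator n C z x = (\<lambda>b a U. \<Sum>k\<le>n. \<Sum>l\<le>n.
     (ext_part k z \<otimes>\<^bsub>OH n C\<^esub> ext_part l x) b a U
       - (-1) ^ (k * l) * (ext_part l x \<otimes>\<^bsub>OH n C\<^esub> ext_part k z) b a U)"

definition OZ :: "nat \<Rightarrow> mult_rule \<Rightarrow> arc_elt ring" where
  "OZ n C = (OH n C)\<lparr>carrier :=
     {z \<in> carrier (OH n C). \<forall>x \<in> carrier (OH n C). odd_commutator n C z x = \<zero>\<^bsub>OH n C\<^esub>}\<rparr>"

definition OZ_degree :: "nat \<Rightarrow> mult_rule \<Rightarrow> int \<Rightarrow> arc_elt set" where
  "OZ_degree n C d = carrier (OZ n C) \<inter> OH_degree n d"


section \<open>The odd cohomology of the (n,n) Springer variety\<close>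

text \<open>
  The free ring \<open>\<int>\<langle>x\<^sub>1, \<dots>, x\<^sub>m\<rangle>\<close>: finitely supported functions on words in \<open>{1..m}\<close>, with the
  concatenation product.
\<close>

type_synonym ncpoly = "nat list \<Rightarrow> int"

definition free_ring :: "nat \<Rightarrow> ncpoly ring" where
  "free_ring m =
     \<lparr>carrier = {f. finite {w. f w \<noteq> 0} \<and> (\<forall>w. f w \<noteq> 0 \<longrightarrow> set w \<subseteq> {1..m})},
      mult = (\<lambda>f g w. \<Sum>k\<le>length w. f (take k w) * g (drop k w)),
      one = (\<lambda>w. if w = [] then 1 else 0),
      zero = (\<lambda>w. 0),
      add = (\<lambda>f g w. f w + g w)\<rparr>"

definition free_var :: "nat \<Rightarrow> ncpoly" where
  "free_var i = (\<lambda>w. if w = [i] then 1 else 0)"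

definition skew_ideal :: "nat \<Rightarrow> ncpoly set" where
  "skew_ideal m = Idl\<^bsub>free_ring m\<^esub>
     {free_var i \<otimes>\<^bsub>free_ring m\<^esub> free_var j \<oplus>\<^bsub>free_ring m\<^esub> free_var j \<otimes>\<^bsub>free_ring m\<^esub> free_var i
        |i j. i \<in> {1..m} \<and> j \<in> {1..m} \<and> i \<noteq> j}"

definition OPol :: "nat \<Rightarrow> ncpoly set ring" where
  "OPol m = free_ring m Quot skew_ideal m"

definition pol_var :: "nat \<Rightarrow> nat \<Rightarrow> ncpoly set" where
  "pol_var m i = skew_ideal m +>\<^bsub>free_ring m\<^esub> free_var i"

text \<open>The position of \<open>i \<in> I\<close> is one plus the number of smaller elements of \<open>I\<close>.\<close>

definition signed_var :: "nat \<Rightarrow> nat set \<Rightarrow> nat \<Rightarrow> ncpoly set" where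
  "signed_var m I i =
     (if even (card {j \<in> I. j < i}) then pol_var m i else \<ominus>\<^bsub>OPol m\<^esub> pol_var m i)"

definition odd_elementary :: "nat \<Rightarrow> nat set \<Rightarrow> nat \<Rightarrow> ncpoly set" where
  "odd_elementary m I r =
     (\<Oplus>\<^bsub>OPol m\<^esub>J\<in>{J. J \<subseteq> I \<and> card J = r}.
        foldr (\<lambda>i p. signed_var m I i \<otimes>\<^bsub>OPol m\<^esub> p) (sorted_list_of_set J) \<one>\<^bsub>OPol m\<^esub>)"

definition left_ideal :: "'r set \<Rightarrow> ('r, 'm) ring_scheme \<Rightarrow> bool" where
  "left_ideal L R \<longleftrightarrow>
     additive_subgroup L R \<and> (\<forall>r \<in> carrier R. \<forall>x \<in> L. r \<otimes>\<^bsub>R\<^esub> x \<in> L)"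

definition gen_left_ideal :: "('r, 'm) ring_scheme \<Rightarrow> 'r set \<Rightarrow> 'r set" where
  "gen_left_ideal R S = \<Inter> {L. left_ideal L R \<and> S \<subseteq> L}"

definition OI :: "nat \<Rightarrow> ncpoly set set" where
  "OI n = gen_left_ideal (OPol (2 * n))
     {odd_elementary (2 * n) I r |I r k.
        k \<in> {1..n} \<and> I \<subseteq> {1..2 * n} \<and> card I = n + k \<and> r \<in> {n - k + 1..n + k}}"

definition OSpringer :: "nat \<Rightarrow> ncpoly set set ring" where
  "OSpringer n = OPol (2 * n) Quot OI n"

text \<open>Every \<open>x\<^sub>i\<close> has degree 2.\<close>

definition OSpringer_degree :: "nat \<Rightarrow> int \<Rightarrow> ncpoly set set set" where
  "OSpringer_degree n d =
     {OI n +>\<^bsub>OPol (2 * n)\<^esub> (skew_ideal (2 * n) +>\<^bsub>free_ring (2 * n)\<^esub> f) |f.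
        f \<in> carrier (free_ring (2 * n)) \<and> (\<forall>w. f w \<noteq> 0 \<longrightarrow> 2 * int (length w) = d)}"

end

theory Submission
  imports Defs "HOL-Algebra.UnivPoly" "HOL-Library.Multiset"
begin

text \<open>
  An element \<open>z\<close> of the odd center is diagonal, since it commutes with the units \<open>1\<^sub>a\<close>, and all surgeries in its
  products are merges. Hence the odd center is the ring of families \<open>z\<^sub>a\<close> in the exterior algebras of the
  \<open>W(a)a\<close> such that \<open>z\<^sub>a\<close> and \<open>z\<^sub>b\<close> have the same image in the exterior algebra of \<open>W(b)a\<close>, for every rule.

  Sending \<open>x\<^sub>i\<close> to the family of the circles through the point \<open>i\<close> gives a homomorphism from the skew
  polynomials to these families, and the odd elementary polynomials generating \<open>OI\<^sub>n\<close> are mapped to zero by a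
  sign-reversing involution. Modulo \<open>OI\<^sub>n\<close> the skew polynomials are spanned by the monomials of the ballot sets,
  that is, of the sets of right ends of closed markings. A family is determined by its
  coefficients at the closed markings, and the matrix of these coefficients of the ballot monomials is
  triangular with diagonal entries \<open>1\<close> or \<open>-1\<close>, so the ballot monomials are mapped to a basis.
\<close>


subsection \<open>Exterior algebras\<close>

text \<open>Splits are the surgeries whose sign depends on the rule, and they never enter here: a
  product with an element of a diagonal summand uses merges only, and a merge is an algebra
  homomorphism without a choice of sign. The isomorphism is obtained without comparing ranks. The
  ballot monomials span modulo \<open>OI n\<close> and have linearly independent images; together
  these two facts force the kernel of the map from skew polynomials to be \<open>OI n\<close>. Over
  the integers independence alone does not give surjectivity; that the diagonal entries of the
  triangular matrix are units does. The degrees of the generators of \<open>OI n\<close> are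
  explained by a count of arcs: \<open>r > n - k\<close> is the inequality that guarantees a partner
  for every term in the cancellation (\<open>exists_even_arc\<close>).\<close>

definition ext_ind :: "'a set \<Rightarrow> 'a ext" where
  "ext_ind A = (\<lambda>U. if U = A then 1 else 0)"

text \<open>\<open>ext_map\<close> sums over the support of its argument and lists each monomial in
  increasing order. For an infinite support the sum collapses to 0, and for an infinite monomial the
  list is empty, so linearity and multiplicativity are stated under this condition.\<close>

definition ext_finite :: "'a ext \<Rightarrow> bool" where
  "ext_finite f \<longleftrightarrow> finite {A. f A \<noteq> 0} \<and> (\<forall>A. f A \<noteq> 0 \<longrightarrow> finite A)"

definition ext_homog :: "nat \<Rightarrow> 'a ext \<Rightarrow> bool" where
  "ext_homog k f \<longleftrightarrow> (\<forall>U. f U \<noteq> 0 \<longrightarrow> card U = k)"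

lemma ext_finite_carrier: "finite S \<Longrightarrow> f \<in> ext_carrier S \<Longrightarrow> ext_finite f"
  unfolding ext_finite_def ext_carrier_def
  by (auto intro: finite_subset[of _ "Pow S"] finite_subset[of _ S])

section \<open>Signs of shuffles\<close>

lemma shuffle_sign_singleton:
  "shuffle_sign {s} B = (-1) ^ card {t \<in> B. t < s}"
proof -
  have "{(u, t). u \<in> {s} \<and> t \<in> B \<and> t < u} = Pair s ` {t \<in> B. t < s}" by auto
  then show ?thesis by (simp add: shuffle_sign_def card_image inj_on_def)
qed

lemma shuffle_sign_empty [simp]: "shuffle_sign {} B = 1" "shuffle_sign A {} = 1"
  by (simp_all add: shuffle_sign_def)

lemma shuffle_sign_Un_left:
  assumes "finite A" "finite B" "finite C" "A \<inter> B = {}"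
  shows "shuffle_sign (A \<union> B) C = shuffle_sign A C * shuffle_sign B C"
proof -
  let ?P = "\<lambda>A. {(s, t). s \<in> A \<and> t \<in> C \<and> t < s}"
  have "?P (A \<union> B) = ?P A \<union> ?P B" by auto
  moreover have "finite (?P A)" "finite (?P B)"
    using assms by (auto intro: finite_subset[of _ "A \<times> C"] finite_subset[of _ "B \<times> C"])
  moreover have "?P A \<inter> ?P B = {}" using assms by auto
  ultimately show ?thesis
    by (simp add: shuffle_sign_def card_Un_disjoint power_add)
qed

lemma shuffle_sign_Un_right:
  assumes "finite A" "finite B" "finite C" "B \<inter> C = {}"
  shows "shuffle_sign A (B \<union> C) = shuffle_sign A B * shuffle_sign A C"
proof -
  let ?P = "\<lambda>B. {(s, t). s \<in> A \<and> t \<in> B \<and> t < s}"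
  have "?P (B \<union> C) = ?P B \<union> ?P C" by auto
  moreover have "finite (?P B)" "finite (?P C)"
    using assms by (auto intro: finite_subset[of _ "A \<times> B"] finite_subset[of _ "A \<times> C"])
  moreover have "?P B \<inter> ?P C = {}" using assms by auto
  ultimately show ?thesis
    by (simp add: shuffle_sign_def card_Un_disjoint power_add)
qed

text \<open>Since \<open>A\<close> and \<open>B\<close> are disjoint, each pair in
  \<open>A \<times> B\<close> is an inversion of exactly one of the two concatenations, so the two
  inversion numbers add up to \<open>card A * card B\<close>.\<close>

lemma shuffle_sign_commute:
  assumes "finite A" "finite B" "A \<inter> B = {}"
  shows "shuffle_sign A B = (-1) ^ (card A * card B) * shuffle_sign B A"
proof -
  let ?P = "{(s, t). s \<in> A \<and> t \<in> B \<and> t < s}"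
  let ?Q = "{(s, t). s \<in> B \<and> t \<in> A \<and> t < s}"
  have fin: "finite ?P" "finite ?Q"
    using assms by (auto intro: finite_subset[of _ "A \<times> B"] finite_subset[of _ "B \<times> A"])
  have "A \<times> B = ?P \<union> prod.swap ` ?Q"
    using assms(3) by (force simp: image_iff not_less order.order_iff_strict)
  moreover have "?P \<inter> prod.swap ` ?Q = {}" by auto
  ultimately have "card (A \<times> B) = card ?P + card (prod.swap ` ?Q)"
    using fin by (simp add: card_Un_disjoint)
  then have "card A * card B = card ?P + card ?Q"
    by (simp add: card_cartesian_product card_image inj_on_def)
  then have "(-1::int) ^ (card A * card B) * (-1) ^ card ?Q = (-1) ^ (card ?P + 2 * card ?Q)"
    by (simp add: power_add mult_2)
  then show ?thesis by (simp add: shuffle_sign_def power_add)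
qed

section \<open>The wedge product\<close>

lemma wedge_assoc: "(f \<and>\<^sub>e g) \<and>\<^sub>e h = f \<and>\<^sub>e g \<and>\<^sub>e h"
proof
  fix U :: "'a set"
  show "((f \<and>\<^sub>e g) \<and>\<^sub>e h) U = (f \<and>\<^sub>e g \<and>\<^sub>e h) U"
  proof (cases "finite U")
    case False
    then show ?thesis by (simp add: wedge_def finite_Pow_iff)
  next
    case True
    let ?l = "\<lambda>(D, A). shuffle_sign D (U - D) * (shuffle_sign A (D - A) * f A * g (D - A)) * h (U - D)"
    let ?r = "\<lambda>(A, B). shuffle_sign A (U - A) * f A * (shuffle_sign B (U - A - B) * g B * h (U - A - B))"
    have "((f \<and>\<^sub>e g) \<and>\<^sub>e h) U = sum ?l (SIGMA D:Pow U. Pow D)"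
      using True by (simp add: wedge_def sum_distrib_left sum_distrib_right sum.Sigma finite_subset)
    \<comment> \<open>Both sides run over ordered splittings of \<open>U\<close> into three blocks
      \<open>A\<close>, \<open>D - A\<close>, \<open>U - D\<close>; multiplicativity of
      \<open>shuffle_sign\<close> in each argument turns both signs into the product of the three
      pairwise signs.\<close>
    also have "\<dots> = sum ?r (SIGMA A:Pow U. Pow (U - A))"
    proof (rule sum.reindex_bij_witness[where i = "\<lambda>(A, B). (A \<union> B, A)" and j = "\<lambda>(D, A). (A, D - A)"])
      fix x assume "x \<in> (SIGMA D:Pow U. Pow D)"
      then obtain D A where x: "x = (D, A)" "D \<subseteq> U" "A \<subseteq> D" by auto
      then have fin: "finite D" "finite A" "finite (D - A)" "finite (U - D)"
        using True by (auto intro: finite_subset)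
      have "shuffle_sign D (U - D) = shuffle_sign A (U - D) * shuffle_sign (D - A) (U - D)"
        using shuffle_sign_Un_left[of A "D - A" "U - D"] fin x by (simp add: Un_absorb1)
      moreover have "shuffle_sign A (U - A) = shuffle_sign A (D - A) * shuffle_sign A (U - D)"
      proof -
        have "U - A = (D - A) \<union> (U - D)" using x by auto
        moreover have "(D - A) \<inter> (U - D) = {}" by auto
        ultimately show ?thesis using shuffle_sign_Un_right[of A "D - A" "U - D"] fin by simp
      qed
      moreover have "U - A - (D - A) = U - D" using x by auto
      ultimately show "(case case x of (D, A) \<Rightarrow> (A, D - A) of (A, B) \<Rightarrow> shuffle_sign A (U - A) * f A *
         (shuffle_sign B (U - A - B) * g B * h (U - A - B))) = (case x of (D, A) \<Rightarrow>
          shuffle_sign D (U - D) * (shuffle_sign A (D - A) * f A * g (D - A)) * h (U - D))"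
        using x by simp
    qed auto
    also have "\<dots> = (f \<and>\<^sub>e g \<and>\<^sub>e h) U"
      using True by (simp add: wedge_def sum_distrib_left sum.Sigma finite_subset)
    finally show ?thesis .
  qed
qed

lemma wedge_sum_left:
  "(\<lambda>U. \<Sum>i\<in>S. c i * f i U) \<and>\<^sub>e g = (\<lambda>U. \<Sum>i\<in>S. c i * (f i \<and>\<^sub>e g) U)"
proof
  fix U
  have "((\<lambda>U. \<Sum>i\<in>S. c i * f i U) \<and>\<^sub>e g) U =
      (\<Sum>A\<in>Pow U. \<Sum>i\<in>S. c i * (shuffle_sign A (U - A) * f i A * g (U - A)))"
    by (simp add: wedge_def sum_distrib_left sum_distrib_right mult_ac)
  also have "\<dots> = (\<Sum>i\<in>S. \<Sum>A\<in>Pow U. c i * (shuffle_sign A (U - A) * f i A * g (U - A)))"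
    by (rule sum.swap)
  finally show "((\<lambda>U. \<Sum>i\<in>S. c i * f i U) \<and>\<^sub>e g) U = (\<Sum>i\<in>S. c i * (f i \<and>\<^sub>e g) U)"
    by (simp add: wedge_def sum_distrib_left)
qed

lemma wedge_sum_right:
  "g \<and>\<^sub>e (\<lambda>U. \<Sum>i\<in>S. c i * f i U) = (\<lambda>U. \<Sum>i\<in>S. c i * (g \<and>\<^sub>e f i) U)"
proof
  fix U
  have "(g \<and>\<^sub>e (\<lambda>U. \<Sum>i\<in>S. c i * f i U)) U =
      (\<Sum>A\<in>Pow U. \<Sum>i\<in>S. c i * (shuffle_sign A (U - A) * g A * f i (U - A)))"
    by (simp add: wedge_def sum_distrib_left sum_distrib_right mult_ac)
  also have "\<dots> = (\<Sum>i\<in>S. \<Sum>A\<in>Pow U. c i * (shuffle_sign A (U - A) * g A * f i (U - A)))"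
    by (rule sum.swap)
  finally show "(g \<and>\<^sub>e (\<lambda>U. \<Sum>i\<in>S. c i * f i U)) U = (\<Sum>i\<in>S. c i * (g \<and>\<^sub>e f i) U)"
    by (simp add: wedge_def sum_distrib_left)
qed

lemma wedge_zero [simp]: "(\<lambda>U. 0) \<and>\<^sub>e f = (\<lambda>U. 0)" "f \<and>\<^sub>e (\<lambda>U. 0) = (\<lambda>U. 0)"
  by (simp_all add: wedge_def)

lemma wedge_add_left: "(\<lambda>U. f U + g U) \<and>\<^sub>e h = (\<lambda>U. (f \<and>\<^sub>e h) U + (g \<and>\<^sub>e h) U)"
  by (simp add: wedge_def distrib_left distrib_right sum.distrib)

lemma wedge_add_right: "h \<and>\<^sub>e (\<lambda>U. f U + g U) = (\<lambda>U. (h \<and>\<^sub>e f) U + (h \<and>\<^sub>e g) U)"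
  by (simp add: wedge_def distrib_left distrib_right sum.distrib)

lemma wedge_smult_left: "(\<lambda>U. c * f U) \<and>\<^sub>e h = (\<lambda>U. c * (f \<and>\<^sub>e h) U)"
  by (simp add: wedge_def sum_distrib_left mult_ac)

lemma wedge_smult_right: "h \<and>\<^sub>e (\<lambda>U. c * f U) = (\<lambda>U. c * (h \<and>\<^sub>e f) U)"
  by (simp add: wedge_def sum_distrib_left mult_ac)

text \<open>\<open>wedge\<close> returns 0 at every infinite set, because the sum over an infinite
  \<open>Pow U\<close> is 0; hence the condition on the support of \<open>f\<close>.\<close>

lemma wedge_one_left:
  assumes "\<And>U. f U \<noteq> 0 \<Longrightarrow> finite U"
  shows "ext_one \<and>\<^sub>e f = f"
proof
  fix U
  show "(ext_one \<and>\<^sub>e f) U = f U"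
  proof (cases "finite U")
    case True
    have "(ext_one \<and>\<^sub>e f) U = (\<Sum>A\<in>{{}}. shuffle_sign A (U - A) * ext_one A * f (U - A))"
      unfolding wedge_def using True by (intro sum.mono_neutral_right) (auto simp: ext_one_def)
    then show ?thesis by (simp add: ext_one_def)
  qed (use assms in \<open>auto simp: wedge_def finite_Pow_iff\<close>)
qed

lemma wedge_one_right:
  assumes "\<And>U. f U \<noteq> 0 \<Longrightarrow> finite U"
  shows "f \<and>\<^sub>e ext_one = f"
proof
  fix U
  show "(f \<and>\<^sub>e ext_one) U = f U"
  proof (cases "finite U")
    case True
    have "(f \<and>\<^sub>e ext_one) U = (\<Sum>A\<in>{U}. shuffle_sign A (U - A) * f A * ext_one (U - A))"
      unfolding wedge_def using True by (intro sum.mono_neutral_right) (auto simp: ext_one_def)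
    then show ?thesis by (simp add: ext_one_def)
  qed (use assms in \<open>auto simp: wedge_def finite_Pow_iff\<close>)
qed

lemma wedge_nonzeroD:
  assumes "(f \<and>\<^sub>e g) U \<noteq> 0"
  obtains A where "finite U" "A \<subseteq> U" "f A \<noteq> 0" "g (U - A) \<noteq> 0"
proof -
  have "finite U" using assms by (auto simp: wedge_def finite_Pow_iff intro: ccontr)
  moreover obtain A where "A \<in> Pow U" "shuffle_sign A (U - A) * f A * g (U - A) \<noteq> 0"
    using assms unfolding wedge_def by (rule sum.not_neutral_contains_not_neutral)
  ultimately show thesis using that by auto
qed

lemma wedge_carrier:
  assumes "f \<in> ext_carrier S" "g \<in> ext_carrier S"
  shows "f \<and>\<^sub>e g \<in> ext_carrier S"
proof -
  have "U \<subseteq> S" if nz: "(f \<and>\<^sub>e g) U \<noteq> 0" for U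
  proof -
    obtain A where "A \<subseteq> U" "f A \<noteq> 0" "g (U - A) \<noteq> 0" using nz by (rule wedge_nonzeroD)
    then have "A \<subseteq> S" "U - A \<subseteq> S" using assms by (auto simp: ext_carrier_def)
    then show ?thesis using \<open>A \<subseteq> U\<close> by auto
  qed
  then show ?thesis by (auto simp: ext_carrier_def)
qed

text \<open>Complementation in \<open>U\<close> exchanges the roles of the two factors, and
  \<open>shuffle_sign_commute\<close> supplies the sign wherever both coefficients are
  non-zero.\<close>

lemma wedge_homog_commute:
  assumes "ext_homog k f" "ext_homog l g"
  shows "f \<and>\<^sub>e g = (\<lambda>U. (-1) ^ (k * l) * (g \<and>\<^sub>e f) U)"
proof
  fix U
  show "(f \<and>\<^sub>e g) U = (-1) ^ (k * l) * (g \<and>\<^sub>e f) U"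
  proof (cases "finite U")
    case False
    then show ?thesis by (simp add: wedge_def finite_Pow_iff)
  next
    case True
    have "(f \<and>\<^sub>e g) U = (\<Sum>A\<in>Pow U. (-1) ^ (k * l) * (shuffle_sign A (U - A) * g A * f (U - A)))"
      unfolding wedge_def
    proof (rule sum.reindex_bij_witness[where i = "\<lambda>A. U - A" and j = "\<lambda>A. U - A"])
      fix A assume "A \<in> Pow U"
      then have A: "A \<subseteq> U" "finite A" using True finite_subset by auto
      then have UA: "U - (U - A) = A" by auto
      show "(-1) ^ (k * l) * (shuffle_sign (U - A) (U - (U - A)) * g (U - A) * f (U - (U - A))) =
            shuffle_sign A (U - A) * f A * g (U - A)"
      proof (cases "f A = 0 \<or> g (U - A) = 0")
        case False
        then have "card A = k" "card (U - A) = l" using assms by (auto simp: ext_homog_def)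
        then have "shuffle_sign A (U - A) = (-1) ^ (k * l) * shuffle_sign (U - A) A"
          using shuffle_sign_commute[of A "U - A"] A True by auto
        then show ?thesis by (simp add: UA)
      qed (auto simp: UA)
    qed auto
    then show ?thesis by (simp add: wedge_def sum_distrib_left)
  qed
qed

lemma ext_gen_homog: "ext_homog 1 (ext_gen s)"
  by (simp add: ext_homog_def ext_gen_def)

text \<open>Graded commutativity in degrees 1 and 1 gives \<open>x = - x\<close>, and an integer
  with this property is 0.\<close>

lemma ext_gen_square [simp]: "ext_gen s \<and>\<^sub>e ext_gen s = (\<lambda>U. 0)"
proof
  fix U
  show "(ext_gen s \<and>\<^sub>e ext_gen s) U = 0"
    using fun_cong[OF wedge_homog_commute[OF ext_gen_homog ext_gen_homog, of s s], of U] by simp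
qed

lemma ext_gen_anticommute:
  "ext_gen s \<and>\<^sub>e ext_gen t \<and>\<^sub>e f = (\<lambda>U. - (ext_gen t \<and>\<^sub>e ext_gen s \<and>\<^sub>e f) U)"
proof -
  have "ext_gen s \<and>\<^sub>e ext_gen t = (\<lambda>U. (-1) * (ext_gen t \<and>\<^sub>e ext_gen s) U)"
    using wedge_homog_commute[OF ext_gen_homog ext_gen_homog, of s t] by simp
  then have "(ext_gen s \<and>\<^sub>e ext_gen t) \<and>\<^sub>e f = (\<lambda>U. (-1) * ((ext_gen t \<and>\<^sub>e ext_gen s) \<and>\<^sub>e f) U)"
    by (simp only: wedge_smult_left)
  then show ?thesis by (simp add: wedge_assoc)
qed

lemma ext_gen_wedge:
  "(ext_gen s \<and>\<^sub>e f) U =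
     (if finite U \<and> s \<in> U then (-1) ^ card {t \<in> U. t < s} * f (U - {s}) else 0)"
proof (cases "finite U")
  case True
  have "(ext_gen s \<and>\<^sub>e f) U = (\<Sum>A\<in>Pow U. if A = {s} then shuffle_sign {s} (U - {s}) * f (U - {s}) else 0)"
    unfolding wedge_def by (rule sum.cong) (auto simp: ext_gen_def)
  also have "\<dots> = (if {s} \<in> Pow U then shuffle_sign {s} (U - {s}) * f (U - {s}) else 0)"
    using True by (subst sum.delta) auto
  also have "{t \<in> U - {s}. t < s} = {t \<in> U. t < s}" by auto
  then have "shuffle_sign {s} (U - {s}) = (-1) ^ card {t \<in> U. t < s}"
    by (simp add: shuffle_sign_singleton)
  finally show ?thesis using True by auto
qed (auto simp: wedge_def finite_Pow_iff)

section \<open>Products of generators along a list\<close>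

lemma wedge_list_simps [simp]:
  "wedge_list [] = ext_one"
  "wedge_list (s # l) = ext_gen s \<and>\<^sub>e wedge_list l"
  by (simp_all add: wedge_list_def)

lemma wedge_list_finite: "wedge_list l U \<noteq> 0 \<Longrightarrow> finite U"
  by (cases l) (auto simp: ext_one_def ext_gen_wedge split: if_splits)

lemma wedge_list_append: "wedge_list (l @ l') = wedge_list l \<and>\<^sub>e wedge_list l'"
  by (induction l) (simp_all add: wedge_assoc wedge_one_left wedge_list_finite)

text \<open>By anticommutation the leading \<open>s\<close> moves past the other factors until it
  meets its second copy, where the square vanishes.\<close>

lemma wedge_list_Cons_member:
  assumes "s \<in> set l"
  shows "wedge_list (s # l) = (\<lambda>U. 0)"
  using assms
proof (induction l)
  case (Cons t l)
  show ?case
  proof (cases "t = s")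
    case True
    have "wedge_list (s # t # l) = (ext_gen s \<and>\<^sub>e ext_gen s) \<and>\<^sub>e wedge_list l"
      by (simp only: True wedge_assoc wedge_list_simps)
    then show ?thesis by simp
  next
    case False
    then have "ext_gen s \<and>\<^sub>e wedge_list l = (\<lambda>U. 0)" using Cons by simp
    then show ?thesis using ext_gen_anticommute[of s t "wedge_list l"] by simp
  qed
qed simp

lemma wedge_list_nondistinct: "\<not> distinct l \<Longrightarrow> wedge_list l = (\<lambda>U. 0)"
proof (induction l)
  case (Cons s l)
  then show ?case by (cases "s \<in> set l") (use wedge_list_Cons_member in auto)
qed simp

lemma wedge_list_sorted:
  "sorted l \<Longrightarrow> distinct l \<Longrightarrow> wedge_list l = ext_ind (set l)"
proof (induction l)
  case Nil
  then show ?case by (auto simp: ext_one_def ext_ind_def)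
next
  case (Cons s l)
  have sm: "{t \<in> insert s (set l). t < s} = {}" using Cons.prems(1) by auto
  have "(ext_gen s \<and>\<^sub>e ext_ind (set l)) U = ext_ind (set (s # l)) U" for U
  proof (cases "U = insert s (set l)")
    case True
    then have "U - {s} = set l" using Cons.prems(2) by auto
    have "card {t \<in> insert s (set l). t < s} = 0" by (simp only: sm card.empty)
    then have "(-1::int) ^ card {t \<in> insert s (set l). t < s} = 1" by (simp only: power_0)
    then show ?thesis
      using \<open>U - {s} = set l\<close> unfolding True ext_gen_wedge ext_ind_def by (simp del: insert_iff add: insertI1)
  next
    case False
    then show ?thesis using Cons.prems(2) by (auto simp: ext_gen_wedge ext_ind_def)
  qed
  then have "ext_gen s \<and>\<^sub>e ext_ind (set l) = ext_ind (set (s # l))" by (rule ext)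
  then show ?case using Cons by simp
qed

lemma wedge_list_sorted_list_of_set:
  "finite A \<Longrightarrow> wedge_list (sorted_list_of_set A) = ext_ind A"
  by (simp add: wedge_list_sorted)

text \<open>For a distinct list this is the sign of the sorting permutation, as the parity of the
  number of inversions.\<close>

fun inv_sign :: "'a::linorder list \<Rightarrow> int" where
  "inv_sign [] = 1"
| "inv_sign (s # l) = (-1) ^ length (filter (\<lambda>t. t < s) l) * inv_sign l"

lemma inv_sign_cases: "inv_sign l = 1 \<or> inv_sign l = -1"
  by (induction l) (auto simp: minus_one_power_iff)

text \<open>The sign is counted in the order of the indices before \<open>h\<close> is applied,
  because \<open>ext_map\<close> lists a monomial in that order and \<open>h\<close> need not be
  monotone.\<close>

lemma wedge_list_map_insort:
  assumes "sorted l"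
  shows "wedge_list (map h (s # l)) =
    (\<lambda>U. (-1) ^ length (filter (\<lambda>t. t < s) l) * wedge_list (map h (insort s l)) U)"
  using assms
proof (induction l)
  case (Cons t l)
  show ?case
  proof (cases "s \<le> t")
    case True
    then have "filter (\<lambda>u. u < s) (t # l) = []" using Cons.prems by (auto simp: filter_empty_conv)
    then show ?thesis using True by simp
  next
    case False
    have "wedge_list (map h (s # t # l)) =
        (\<lambda>U. - (ext_gen (h t) \<and>\<^sub>e wedge_list (map h (s # l))) U)"
      using ext_gen_anticommute[of "h s" "h t"] by simp
    also have "\<dots> = (\<lambda>U. - ((-1) ^ length (filter (\<lambda>t. t < s) l) *
        (ext_gen (h t) \<and>\<^sub>e wedge_list (map h (insort s l))) U))"
      using Cons by (simp only: wedge_smult_right sorted_simps)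
    finally have "wedge_list (map h (s # t # l)) = \<dots>" .
    moreover have "insort s (t # l) = t # insort s l" "length (filter (\<lambda>u. u < s) (t # l)) = Suc (length (filter (\<lambda>u. u < s) l))"
      using False by auto
    ultimately show ?thesis by simp
  qed
qed simp

lemma wedge_list_map_sort:
  "wedge_list (map h l) = (\<lambda>U. inv_sign l * wedge_list (map h (sort l)) U)"
proof (induction l)
  case (Cons s l)
  have len: "length (filter (\<lambda>t. t < s) (sort l)) = length (filter (\<lambda>t. t < s) l)"
    by (simp add: filter_sort)
  have "wedge_list (map h (s # l)) = (\<lambda>U. inv_sign l * wedge_list (map h (s # sort l)) U)"
    using Cons by (simp add: wedge_smult_right)
  also have "\<dots> = (\<lambda>U. inv_sign (s # l) * wedge_list (map h (insort s (sort l))) U)"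
    by (subst wedge_list_map_insort) (simp_all add: len mult_ac)
  finally show ?case by simp
qed simp

lemma wedge_list_distinct:
  assumes "distinct l"
  shows "wedge_list l = (\<lambda>U. inv_sign l * ext_ind (set l) U)"
  using wedge_list_map_sort[of "\<lambda>x. x" l] wedge_list_sorted[of "sort l"] assms by simp

lemma wedge_list_nonzeroD:
  assumes "wedge_list l U \<noteq> 0"
  shows "distinct l" "U = set l"
proof -
  show "distinct l" using wedge_list_nondistinct[of l] assms by (cases "distinct l") auto
  then show "U = set l" using wedge_list_distinct[of l] assms
    by (auto simp: ext_ind_def split: if_splits)
qed

lemma wedge_list_set:
  assumes "distinct l"
  shows "wedge_list l (set l) = 1 \<or> wedge_list l (set l) = -1"
  using wedge_list_distinct[OF assms] inv_sign_cases[of l] by (simp add: ext_ind_def)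

section \<open>Algebra homomorphisms induced by maps of generators\<close>

lemma ext_map_eq_sum:
  assumes "finite T" "{A. f A \<noteq> 0} \<subseteq> T"
  shows "ext_map h f U = (\<Sum>A\<in>T. f A * wedge_list (map h (sorted_list_of_set A)) U)"
  unfolding ext_map_def using assms by (intro sum.mono_neutral_left) auto

lemma ext_map_zero [simp]: "ext_map h (\<lambda>U. 0) = (\<lambda>U. 0)"
  by (simp add: ext_map_def)

lemma ext_finite_sum:
  assumes "\<And>i. i \<in> S \<Longrightarrow> ext_finite (f i)" "finite S"
  shows "ext_finite (\<lambda>U. \<Sum>i\<in>S. c i * f i U)"
proof -
  have ex: "\<exists>i\<in>S. f i A \<noteq> 0" if "(\<Sum>i\<in>S. c i * f i A) \<noteq> 0" for A
    using that by (metis (mono_tags, lifting) mult_zero_right sum.neutral)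
  then have "{A. (\<Sum>i\<in>S. c i * f i A) \<noteq> 0} \<subseteq> (\<Union>i\<in>S. {A. f i A \<noteq> 0})" by auto
  moreover have "finite (\<Union>i\<in>S. {A. f i A \<noteq> 0})" using assms by (auto simp: ext_finite_def)
  ultimately show ?thesis using ex assms(1) unfolding ext_finite_def
    by (meson finite_subset)
qed

lemma ext_map_sum:
  assumes "finite S" "\<And>i. i \<in> S \<Longrightarrow> ext_finite (f i)"
  shows "ext_map h (\<lambda>U. \<Sum>i\<in>S. c i * f i U) = (\<lambda>U. \<Sum>i\<in>S. c i * ext_map h (f i) U)"
proof
  fix U
  let ?T = "\<Union>i\<in>S. {A. f i A \<noteq> 0}"
  have fin: "finite ?T" using assms by (auto simp: ext_finite_def)
  have sub: "{A. (\<Sum>i\<in>S. c i * f i A) \<noteq> 0} \<subseteq> ?T"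
  proof
    fix A assume "A \<in> {A. (\<Sum>i\<in>S. c i * f i A) \<noteq> 0}"
    then have "(\<Sum>i\<in>S. c i * f i A) \<noteq> 0" by simp
    then obtain i where "i \<in> S" "c i * f i A \<noteq> 0" by (rule sum.not_neutral_contains_not_neutral)
    then show "A \<in> ?T" by auto
  qed
  have "ext_map h (\<lambda>U. \<Sum>i\<in>S. c i * f i U) U =
      (\<Sum>A\<in>?T. \<Sum>i\<in>S. c i * (f i A * wedge_list (map h (sorted_list_of_set A)) U))"
    by (subst ext_map_eq_sum[OF fin sub]) (simp add: sum_distrib_right mult.assoc)
  also have "\<dots> = (\<Sum>i\<in>S. \<Sum>A\<in>?T. c i * (f i A * wedge_list (map h (sorted_list_of_set A)) U))"
    by (rule sum.swap)
  also have "\<dots> = (\<Sum>i\<in>S. c i * ext_map h (f i) U)"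
  proof (rule sum.cong)
    fix i assume "i \<in> S"
    then have "{A. f i A \<noteq> 0} \<subseteq> ?T" by auto
    then show "(\<Sum>A\<in>?T. c i * (f i A * wedge_list (map h (sorted_list_of_set A)) U)) =
        c i * ext_map h (f i) U"
      by (subst ext_map_eq_sum[OF fin]) (auto simp: sum_distrib_left)
  qed simp
  finally show "ext_map h (\<lambda>U. \<Sum>i\<in>S. c i * f i U) U = (\<Sum>i\<in>S. c i * ext_map h (f i) U)" .
qed

lemma ext_map_add:
  assumes "ext_finite f" "ext_finite g"
  shows "ext_map h (\<lambda>U. f U + g U) = (\<lambda>U. ext_map h f U + ext_map h g U)"
  using ext_map_sum[of "{True, False}" "\<lambda>i. if i then f else g" h "\<lambda>_. 1"] assms by simp

lemma ext_map_smult: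
  assumes "ext_finite f"
  shows "ext_map h (\<lambda>U. c * f U) = (\<lambda>U. c * ext_map h f U)"
  using ext_map_sum[of "{True}" "\<lambda>i. f" h "\<lambda>_. c"] assms by simp

lemma ext_finite_ind: "finite A \<Longrightarrow> ext_finite (ext_ind A)"
  by (auto simp: ext_finite_def ext_ind_def)

lemma ext_finite_wedge_list: "ext_finite (wedge_list l)"
proof -
  have "{A. wedge_list l A \<noteq> 0} \<subseteq> {set l}" using wedge_list_nonzeroD by auto
  then show ?thesis unfolding ext_finite_def
    using wedge_list_finite finite_subset by blast
qed

lemma ext_map_ind:
  "ext_map h (ext_ind A) = wedge_list (map h (sorted_list_of_set A))"
  by (rule ext, subst ext_map_eq_sum[of "{A}"]) (auto simp: ext_ind_def)

text \<open>The definition of \<open>ext_map\<close> uses increasing lists only. Sorting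
  \<open>l\<close> changes both sides by the same \<open>inv_sign l\<close>, so the factors may come
  in any order; multiplicativity and functoriality rest on this.\<close>

lemma ext_map_wedge_list: "ext_map h (wedge_list l) = wedge_list (map h l)"
proof (cases "distinct l")
  case True
  then have "sorted_list_of_set (set l) = sort l"
    by (simp add: sorted_list_of_set_sort_remdups distinct_remdups_id)
  then show ?thesis
    unfolding wedge_list_distinct[OF True]
    by (simp add: ext_map_smult ext_finite_ind ext_map_ind wedge_list_map_sort[of h l])
next
  case False
  then have "\<not> distinct (map h l)" by (simp add: distinct_map)
  then show ?thesis using False by (simp add: wedge_list_nondistinct)
qed

lemma ext_expand:
  assumes "ext_finite f"
  shows "f = (\<lambda>U. \<Sum>A\<in>{A. f A \<noteq> 0}. f A * wedge_list (sorted_list_of_set A) U)"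
proof
  fix U
  have "(\<Sum>A\<in>{A. f A \<noteq> 0}. f A * wedge_list (sorted_list_of_set A) U) =
      (\<Sum>A\<in>{A. f A \<noteq> 0}. if A = U then f A else 0)"
    using assms by (intro sum.cong) (auto simp: wedge_list_sorted_list_of_set ext_ind_def ext_finite_def)
  also have "\<dots> = f U" using assms by (subst sum.delta) (auto simp: ext_finite_def)
  finally show "f U = (\<Sum>A\<in>{A. f A \<noteq> 0}. f A * wedge_list (sorted_list_of_set A) U)" by simp
qed

lemma ext_map_expand:
  "ext_map h f = (\<lambda>U. \<Sum>A\<in>{A. f A \<noteq> 0}. f A * wedge_list (map h (sorted_list_of_set A)) U)"
  by (simp add: ext_map_def)

text \<open>By bilinearity it is enough to treat monomials, on which the product is concatenation of
  lists and \<open>ext_map\<close> is \<open>map\<close>.\<close>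

lemma ext_map_wedge:
  assumes "ext_finite f" "ext_finite g"
  shows "ext_map h (f \<and>\<^sub>e g) = ext_map h f \<and>\<^sub>e ext_map h g"
proof -
  let ?F = "{A. f A \<noteq> 0}" and ?G = "{A. g A \<noteq> 0}"
  have fin: "finite ?F" "finite ?G" using assms by (auto simp: ext_finite_def)
  have "f \<and>\<^sub>e g = (\<lambda>U. \<Sum>A\<in>?F. \<Sum>B\<in>?G. f A *
      (g B * wedge_list (sorted_list_of_set A @ sorted_list_of_set B) U))"
  proof -
    have "f \<and>\<^sub>e g = (\<lambda>U. \<Sum>A\<in>?F. f A * wedge_list (sorted_list_of_set A) U) \<and>\<^sub>e
        (\<lambda>U. \<Sum>B\<in>?G. g B * wedge_list (sorted_list_of_set B) U)"
      using arg_cong2[OF ext_expand[OF assms(1)] ext_expand[OF assms(2)], of "(\<and>\<^sub>e)"] .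
    then show ?thesis
      by (simp only: wedge_sum_left wedge_sum_right wedge_list_append sum_distrib_left)
  qed
  also have "\<dots> = (\<lambda>U. \<Sum>x\<in>?F \<times> ?G. (f (fst x) * g (snd x)) *
      wedge_list (sorted_list_of_set (fst x) @ sorted_list_of_set (snd x)) U)"
    by (simp only: sum.cartesian_product' mult.assoc fst_conv snd_conv)
  finally have "ext_map h (f \<and>\<^sub>e g) = (\<lambda>U. \<Sum>x\<in>?F \<times> ?G. (f (fst x) * g (snd x)) *
      wedge_list (map h (sorted_list_of_set (fst x) @ sorted_list_of_set (snd x))) U)"
    using fin by (simp only: ext_map_sum ext_finite_wedge_list ext_map_wedge_list finite_cartesian_product)
  also have "\<dots> = (\<lambda>U. \<Sum>A\<in>?F. f A * (\<Sum>B\<in>?G.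
      (g B * wedge_list (map h (sorted_list_of_set A) @ map h (sorted_list_of_set B)) U)))"
    by (simp only: sum.cartesian_product' mult.assoc sum_distrib_left map_append fst_conv snd_conv)
  also have "\<dots> = ext_map h f \<and>\<^sub>e ext_map h g"
    unfolding ext_map_expand wedge_sum_left by (simp only: wedge_sum_right wedge_list_append)
  finally show ?thesis .
qed

lemma ext_map_comp:
  assumes "ext_finite f"
  shows "ext_map g (ext_map h f) = ext_map (\<lambda>s. g (h s)) f"
proof -
  have "ext_map g (ext_map h f) = (\<lambda>U. \<Sum>A\<in>{A. f A \<noteq> 0}. f A *
      wedge_list (map g (map h (sorted_list_of_set A))) U)"
    unfolding ext_map_expand[of h f] using assms
    by (subst ext_map_sum) (auto simp: ext_finite_wedge_list ext_map_wedge_list ext_finite_def[of f])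
  then show ?thesis by (simp add: ext_map_expand comp_def)
qed

lemma ext_finite_map: "ext_finite f \<Longrightarrow> ext_finite (ext_map h f)"
  unfolding ext_map_expand
  by (rule ext_finite_sum) (auto simp: ext_finite_wedge_list ext_finite_def[of f])

lemma ext_finite_wedge:
  assumes "ext_finite f" "ext_finite g"
  shows "ext_finite (f \<and>\<^sub>e g)"
proof -
  have "{U. (f \<and>\<^sub>e g) U \<noteq> 0} \<subseteq> (\<lambda>(A, B). A \<union> B) ` ({A. f A \<noteq> 0} \<times> {A. g A \<noteq> 0})"
  proof
    fix U assume "U \<in> {U. (f \<and>\<^sub>e g) U \<noteq> 0}"
    then have "(f \<and>\<^sub>e g) U \<noteq> 0" by simp
    then obtain A where "A \<subseteq> U" "f A \<noteq> 0" "g (U - A) \<noteq> 0" by (rule wedge_nonzeroD)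
    then show "U \<in> (\<lambda>(A, B). A \<union> B) ` ({A. f A \<noteq> 0} \<times> {A. g A \<noteq> 0})"
      by (intro image_eqI[of _ _ "(A, U - A)"]) auto
  qed
  moreover have "finite ((\<lambda>(A, B). A \<union> B) ` ({A. f A \<noteq> 0} \<times> {A. g A \<noteq> 0}))"
    using assms by (simp add: ext_finite_def)
  moreover have "finite U" if "(f \<and>\<^sub>e g) U \<noteq> 0" for U
    using that by (rule wedge_nonzeroD)
  ultimately show ?thesis unfolding ext_finite_def by (meson finite_subset)
qed

lemma ext_map_cong:
  assumes "f \<in> ext_carrier S" "finite S" "\<And>s. s \<in> S \<Longrightarrow> h s = h' s"
  shows "ext_map h f = ext_map h' f"
proof -
  have "map h (sorted_list_of_set A) = map h' (sorted_list_of_set A)" if "f A \<noteq> 0" for A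
  proof (rule map_cong)
    fix x assume "x \<in> set (sorted_list_of_set A)"
    moreover have "A \<subseteq> S" using assms(1) that by (auto simp: ext_carrier_def)
    ultimately show "h x = h' x"
      using assms(2,3) finite_subset by (metis set_sorted_list_of_set subsetD)
  qed simp
  then show ?thesis unfolding ext_map_expand by (intro ext sum.cong) (auto simp del: map_eq_conv)
qed

lemma ext_map_id:
  assumes "f \<in> ext_carrier S" "finite S" "\<And>s. s \<in> S \<Longrightarrow> h s = s"
  shows "ext_map h f = f"
  using ext_expand[OF ext_finite_carrier[OF assms(2,1)]] ext_map_cong[OF assms(1,2), of h "\<lambda>x. x"] assms(3)
  by (simp add: ext_map_expand)

text \<open>A monomial on which \<open>h\<close> is not injective acquires a repeated factor and
  dies, so every monomial of the image comes from one on which \<open>h\<close> is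
  injective.\<close>

lemma ext_map_nonzeroD:
  assumes "ext_map h f U \<noteq> 0" "ext_finite f"
  obtains A where "f A \<noteq> 0" "inj_on h A" "U = h ` A" "finite A"
proof -
  obtain A where A: "f A \<noteq> 0" "wedge_list (map h (sorted_list_of_set A)) U \<noteq> 0"
    using assms(1) unfolding ext_map_expand
    by (metis (mono_tags, lifting) mem_Collect_eq mult_zero_right sum.neutral)
  then have "finite A" using assms(2) by (auto simp: ext_finite_def)
  then show thesis using wedge_list_nonzeroD[OF A(2)] A(1) that by (auto simp: distinct_map)
qed

lemma ext_map_carrier:
  assumes "f \<in> ext_carrier S" "finite S"
  shows "ext_map h f \<in> ext_carrier (h ` S)"
proof -
  have "U \<subseteq> h ` S" if nz: "ext_map h f U \<noteq> 0" for U
  proof -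
    obtain A where "f A \<noteq> 0" "U = h ` A"
      using nz ext_finite_carrier[OF assms(2,1)] by (rule ext_map_nonzeroD)
    then show ?thesis using assms(1) by (auto simp: ext_carrier_def)
  qed
  then show ?thesis by (auto simp: ext_carrier_def)
qed

lemma ext_map_one [simp]: "ext_map h ext_one = ext_one"
  using ext_map_wedge_list[of h "[]"] by simp

lemma ext_map_homog_part:
  assumes "ext_finite f"
  shows "ext_map h (\<lambda>U. if card U = k then f U else 0) = (\<lambda>U. if card U = k then ext_map h f U else 0)"
proof
  fix U
  let ?F = "{A. f A \<noteq> 0}"
  let ?w = "\<lambda>A. wedge_list (map h (sorted_list_of_set A)) U"
  have fin: "finite ?F" using assms by (simp add: ext_finite_def)
  have card: "card A = card U" if "f A \<noteq> 0" "?w A \<noteq> 0" for A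
  proof -
    have "inj_on h A" "U = h ` A"
      using wedge_list_nonzeroD[OF that(2)] that(1) assms by (auto simp: distinct_map ext_finite_def)
    then show ?thesis by (simp add: card_image)
  qed
  have "ext_map h (\<lambda>U. if card U = k then f U else 0) U =
      (\<Sum>A\<in>?F. (if card A = k then f A else 0) * ?w A)"
    by (rule ext_map_eq_sum[OF fin]) auto
  also have "\<dots> = (\<Sum>A\<in>?F. if card U = k then f A * ?w A else 0)"
    by (intro sum.cong) (use card in \<open>fastforce+\<close>)
  also have "\<dots> = (if card U = k then ext_map h f U else 0)"
    by (simp add: ext_map_def)
  finally show "ext_map h (\<lambda>U. if card U = k then f U else 0) U =
      (if card U = k then ext_map h f U else 0)" .
qed


subsection \<open>Circles\<close>

definition conn :: "nat set set \<Rightarrow> (nat \<times> nat) set" where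
  "conn E = (adjacent E)\<^sup>*"

lemma conn_refl [simp]: "(v, v) \<in> conn E"
  by (simp add: conn_def)

lemma conn_trans: "(u, v) \<in> conn E \<Longrightarrow> (v, w) \<in> conn E \<Longrightarrow> (u, w) \<in> conn E"
  by (simp add: conn_def)

lemma conn_sym: "(v, w) \<in> conn E \<Longrightarrow> (w, v) \<in> conn E"
proof -
  have "sym (adjacent E)" by (auto simp: adjacent_def sym_def)
  then show "(v, w) \<in> conn E \<Longrightarrow> (w, v) \<in> conn E"
    unfolding conn_def by (metis sym_rtrancl symD)
qed

lemma conn_edge: "e \<in> E \<Longrightarrow> v \<in> e \<Longrightarrow> w \<in> e \<Longrightarrow> (v, w) \<in> conn E"
  unfolding conn_def by (rule r_into_rtrancl) (auto simp: adjacent_def)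

lemma conn_subset:
  assumes "\<And>e v w. e \<in> E \<Longrightarrow> v \<in> e \<Longrightarrow> w \<in> e \<Longrightarrow> (v, w) \<in> conn E'"
  shows "conn E \<subseteq> conn E'"
proof -
  have "adjacent E \<subseteq> (adjacent E')\<^sup>*" using assms by (auto simp: adjacent_def conn_def)
  then show ?thesis unfolding conn_def by (rule rtrancl_subset_rtrancl)
qed

lemma conn_mono: "E \<subseteq> E' \<Longrightarrow> conn E \<subseteq> conn E'"
  by (rule conn_subset) (auto intro: conn_edge)

text \<open>Induction principle for components: to confine a circle to a set, it suffices that no
  edge leaves the set.\<close>

lemma conn_closed:
  assumes "(v, w) \<in> conn E" "v \<in> S" "\<And>e x y. e \<in> E \<Longrightarrow> x \<in> e \<Longrightarrow> y \<in> e \<Longrightarrow> x \<in> S \<Longrightarrow> y \<in> S"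
  shows "w \<in> S"
  using assms(1) unfolding conn_def
  by (induction rule: rtrancl_induct) (use assms(2,3) in \<open>auto simp: adjacent_def\<close>)

lemma conn_map:
  assumes "(v, w) \<in> conn E" "\<And>e x y. e \<in> E \<Longrightarrow> x \<in> e \<Longrightarrow> y \<in> e \<Longrightarrow> (f x, f y) \<in> conn E'"
  shows "(f v, f w) \<in> conn E'"
  using assms(1) unfolding conn_def[of E]
proof (induction rule: rtrancl_induct)
  case (step y z)
  then show ?case using assms(2) conn_trans by (auto simp: adjacent_def)
qed simp

lemma circle_of_alt: "circle_of E v = (LEAST w. (v, w) \<in> conn E)"
  by (simp add: circle_of_def conn_def)

lemma circle_of_conn: "(v, circle_of E v) \<in> conn E"
  unfolding circle_of_alt by (rule LeastI[of _ v]) simp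

lemma circle_of_le: "(v, w) \<in> conn E \<Longrightarrow> circle_of E v \<le> w"
  unfolding circle_of_alt by (rule Least_le)

lemma circle_of_cong: "(v, w) \<in> conn E \<Longrightarrow> circle_of E v = circle_of E w"
  by (rule antisym; meson circle_of_conn circle_of_le conn_sym conn_trans)

lemma circle_of_eq_iff: "circle_of E v = circle_of E w \<longleftrightarrow> (v, w) \<in> conn E"
proof
  assume "circle_of E v = circle_of E w"
  then have "(v, circle_of E w) \<in> conn E" using circle_of_conn[of v E] by simp
  then show "(v, w) \<in> conn E" using conn_trans conn_sym[OF circle_of_conn] by blast
qed (rule circle_of_cong)

text \<open>Names are least vertices, and the least vertex of a component lies in the coarser
  component too. Renaming circles in stages therefore agrees with renaming them at once.\<close>

lemma circle_of_circle_of: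
  assumes "conn E \<subseteq> conn E'"
  shows "circle_of E' (circle_of E v) = circle_of E' v"
proof -
  have "(v, circle_of E v) \<in> conn E'" using circle_of_conn[of v E] assms by blast
  then show ?thesis by (rule circle_of_cong[symmetric])
qed

text \<open>The hypothesis compares components rather than edges: a surgery exchanges edges, and in
  the merges treated below only its effect on components is that of one additional vertical edge.
  The right-hand side is the renaming done by the merge branch of
  \<open>surgery_map\<close>.\<close>

lemma circle_of_merge:
  assumes "conn E' = conn (insert {i, k} E)"
  shows "circle_of E' v =
    (if circle_of E v = circle_of E i \<or> circle_of E v = circle_of E k then circle_of E' i
     else circle_of E v)"
proof (cases "(v, i) \<in> conn E \<or> (v, k) \<in> conn E")
  case True
  have "conn E \<subseteq> conn E'" using assms conn_mono[of E "insert {i, k} E"] by auto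
  moreover have "(k, i) \<in> conn E'" using conn_edge[of "{i, k}" "insert {i, k} E" k i] assms by auto
  ultimately have "(v, i) \<in> conn E'" using True conn_trans by blast
  then show ?thesis using True by (auto simp: circle_of_eq_iff)
next
  case False
  have "(v, w) \<in> conn E" if w: "(v, w) \<in> conn E'" for w
  proof -
    have "w \<in> {w. (v, w) \<in> conn E}"
    proof (rule conn_closed[where S = "{w. (v, w) \<in> conn E}"])
      show "(v, w) \<in> conn (insert {i, k} E)" using w assms by simp
    next
      fix e x y assume "e \<in> insert {i, k} E" "x \<in> e" "y \<in> e" "x \<in> {w. (v, w) \<in> conn E}"
      then show "y \<in> {w. (v, w) \<in> conn E}"
        using False conn_edge conn_trans by auto
    qed simp
    then show ?thesis by simp
  qed
  moreover have "conn E \<subseteq> conn E'" using assms conn_mono[of E "insert {i, k} E"] by auto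
  ultimately have "(v, w) \<in> conn E' \<longleftrightarrow> (v, w) \<in> conn E" for w by blast
  then show ?thesis using False by (simp add: circle_of_eq_iff) (simp add: circle_of_alt)
qed


subsection \<open>Crossingless matchings as involutions\<close>

text \<open>The ground set is arbitrary because \<open>nc_invol_exists\<close> removes arcs one at a
  time. The second clause is empty at right ends, so each arc is tested once, from its left
  end.\<close>

definition nc_invol :: "nat set \<Rightarrow> (nat \<Rightarrow> nat) \<Rightarrow> bool" where
  "nc_invol V \<mu> \<longleftrightarrow>
     (\<forall>v\<in>V. \<mu> v \<in> V \<and> \<mu> v \<noteq> v \<and> \<mu> (\<mu> v) = v) \<and>
     (\<forall>u\<in>V. \<forall>v\<in>V. u < v \<and> v < \<mu> u \<longrightarrow> u < \<mu> v \<and> \<mu> v < \<mu> u)"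

definition matching_of :: "nat set \<Rightarrow> (nat \<Rightarrow> nat) \<Rightarrow> matching" where
  "matching_of V \<mu> = (\<lambda>v. {v, \<mu> v}) ` V"

definition partner :: "matching \<Rightarrow> nat \<Rightarrow> nat" where
  "partner a v = (THE w. {v, w} \<in> a)"

lemma cm_disjoint:
  assumes "a \<in> crossingless_matchings n" "e \<in> a" "e' \<in> a" "x \<in> e" "x \<in> e'"
  shows "e = e'"
  using assms by (auto simp: crossingless_matchings_def partition_on_def disjoint_def)

lemma cm_Union: "a \<in> crossingless_matchings n \<Longrightarrow> \<Union> a = {1..2 * n}"
  by (simp add: crossingless_matchings_def partition_on_def)

lemma cm_pair:
  assumes "a \<in> crossingless_matchings n" "{v, w} \<in> a"
  shows "v \<noteq> w" "v \<in> {1..2 * n}" "w \<in> {1..2 * n}"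
proof -
  have "card {v, w} = 2" using assms unfolding crossingless_matchings_def by blast
  then show "v \<noteq> w" by auto
  show "v \<in> {1..2 * n}" "w \<in> {1..2 * n}" using cm_Union[OF assms(1)] assms(2) by blast+
qed

lemma cm_partner_eq:
  assumes "a \<in> crossingless_matchings n" "{v, w} \<in> a"
  shows "partner a v = w"
  unfolding partner_def
proof (rule the_equality)
  fix u assume "{v, u} \<in> a"
  then have "{v, u} = {v, w}" using cm_disjoint[OF assms(1), of "{v, u}" "{v, w}" v] assms(2) by auto
  then show "u = w" by (auto simp: doubleton_eq_iff)
qed (rule assms)

lemma cm_arc:
  assumes "a \<in> crossingless_matchings n" "e \<in> a" "v \<in> e"
  shows "e = {v, partner a v}"
proof -
  have "card e = 2" using assms by (auto simp: crossingless_matchings_def)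
  then obtain x y where "e = {x, y}" by (meson card_2_iff)
  then obtain w where "e = {v, w}" using assms(3) by auto
  then show ?thesis using cm_partner_eq[OF assms(1)] assms(2) by auto
qed

lemma cm_partner:
  assumes "a \<in> crossingless_matchings n" "v \<in> {1..2 * n}"
  shows "{v, partner a v} \<in> a"
  using cm_Union[OF assms(1)] cm_arc[OF assms(1)] assms(2) by (metis UnionE)

lemma cm_nc_invol:
  assumes "a \<in> crossingless_matchings n"
  shows "nc_invol {1..2 * n} (partner a)"
proof -
  have 1: "partner a v \<in> {1..2 * n} \<and> partner a v \<noteq> v \<and> partner a (partner a v) = v"
    if "v \<in> {1..2 * n}" for v
    using cm_partner[OF assms that] cm_pair[OF assms, of v "partner a v"]
      cm_partner_eq[OF assms, of "partner a v" v] by (auto simp: insert_commute)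
  have cr: "\<not> (i < j \<and> j < k \<and> k < l \<and> {i, k} \<in> a \<and> {j, l} \<in> a)" for i j k l
    using assms by (auto simp: crossingless_matchings_def)
  have 2: "u < partner a v \<and> partner a v < partner a u"
    if uv: "u \<in> {1..2 * n}" "v \<in> {1..2 * n}" "u < v" "v < partner a u" for u v
  proof (rule ccontr)
    assume neg: "\<not> (u < partner a v \<and> partner a v < partner a u)"
    have "partner a v \<noteq> u" using 1[OF uv(2)] uv by auto
    moreover have "partner a v \<noteq> partner a u" using 1 uv by (metis less_irrefl)
    ultimately have "partner a v < u \<or> partner a u < partner a v" using neg by auto
    then show False
      using cr[of "partner a v" u v "partner a u"] cr[of u v "partner a u" "partner a v"]
        cm_partner[OF assms uv(1)] cm_partner[OF assms uv(2)] uv by (auto simp: insert_commute)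
  qed
  show ?thesis using 1 2 by (auto simp: nc_invol_def)
qed

lemma matching_of_cm:
  assumes "nc_invol {1..2 * n} \<mu>"
  shows "matching_of {1..2 * n} \<mu> \<in> crossingless_matchings n"
proof -
  have inv: "\<mu> v \<in> {1..2 * n}" "\<mu> v \<noteq> v" "\<mu> (\<mu> v) = v" if "v \<in> {1..2 * n}" for v
    using assms that by (auto simp: nc_invol_def)
  have nc: "u < \<mu> v \<and> \<mu> v < \<mu> u" if "u \<in> {1..2 * n}" "v \<in> {1..2 * n}" "u < v" "v < \<mu> u" for u v
    using assms that by (auto simp: nc_invol_def)
  let ?a = "matching_of {1..2 * n} \<mu>"
  have arc: "x \<in> {1..2 * n} \<and> y = \<mu> x" if "{x, y} \<in> ?a" for x y
    using that inv by (auto simp: matching_of_def doubleton_eq_iff)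
  have "partition_on {1..2 * n} ?a"
  proof (rule partition_onI)
    show "\<Union> ?a = {1..2 * n}" using inv by (auto simp: matching_of_def)
  next
    fix p q assume pq: "p \<in> ?a" "q \<in> ?a" "p \<noteq> q"
    obtain v w where vw: "p = {v, \<mu> v}" "q = {w, \<mu> w}" "v \<in> {1..2 * n}" "w \<in> {1..2 * n}"
      using pq(1,2) unfolding matching_of_def by blast
    have "v \<noteq> w" using pq(3) vw by auto
    moreover have "\<mu> v \<noteq> w" using pq(3) vw inv(3)[OF vw(3)] by auto
    moreover have "v \<noteq> \<mu> w" using pq(3) vw inv(3)[OF vw(4)] by auto
    moreover have "\<mu> v \<noteq> \<mu> w" using \<open>v \<noteq> w\<close> inv(3)[OF vw(3)] inv(3)[OF vw(4)] by metis
    ultimately have "v \<noteq> w" "\<mu> v \<noteq> w" "\<mu> v \<noteq> \<mu> w" "v \<noteq> \<mu> w" by auto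
    then show "disjnt p q" using vw by (auto simp: disjnt_def)
  qed (auto simp: matching_of_def)
  moreover have "card e = 2" if e: "e \<in> ?a" for e
  proof -
    obtain v where "e = {v, \<mu> v}" "v \<in> {1..2 * n}" using e unfolding matching_of_def by blast
    then show ?thesis using inv(2)[of v] by (metis card_2_iff)
  qed
  moreover have "\<not> (\<exists>i j k l. i < j \<and> j < k \<and> k < l \<and> {i, k} \<in> ?a \<and> {j, l} \<in> ?a)"
    using arc nc by (metis less_asym)
  ultimately show ?thesis by (simp add: crossingless_matchings_def)
qed

lemma partner_matching_of:
  assumes "nc_invol {1..2 * n} \<mu>" "v \<in> {1..2 * n}"
  shows "partner (matching_of {1..2 * n} \<mu>) v = \<mu> v"
  using cm_partner_eq[OF matching_of_cm[OF assms(1)]] assms(2) by (auto simp: matching_of_def)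

lemma finite_cm: "finite (crossingless_matchings n)"
proof -
  have "crossingless_matchings n \<subseteq> Pow (Pow {1..2 * n})"
    using cm_Union by blast
  then show ?thesis by (rule finite_subset) simp
qed

lemma cm_circles:
  assumes "b \<in> crossingless_matchings n" "a \<in> crossingless_matchings n"
  shows "circles b a = circle_of (b \<union> a) ` {1..2 * n}"
  using cm_Union[OF assms(1)] cm_Union[OF assms(2)] by (simp add: circles_def)

lemma finite_circles:
  assumes "b \<in> crossingless_matchings n" "a \<in> crossingless_matchings n"
  shows "finite (circles b a)"
  using cm_circles[OF assms] by simp

lemma circles_subset:
  assumes "b \<in> crossingless_matchings n" "a \<in> crossingless_matchings n"
  shows "circles b a \<subseteq> {1..2 * n}"
proof -
  have "circle_of (b \<union> a) v \<in> {1..2 * n}" if "v \<in> {1..2 * n}" for v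
    by (rule conn_closed[OF circle_of_conn that]) (use cm_Union[OF assms(1)] cm_Union[OF assms(2)] in blast)
  then show ?thesis using cm_circles[OF assms] by auto
qed

lemma circle_of_circles: "s \<in> circles b a \<Longrightarrow> circle_of (b \<union> a) s = s"
  using circle_of_circle_of[of "b \<union> a" "b \<union> a"] by (auto simp: circles_def)

lemma cm_card:
  assumes "a \<in> crossingless_matchings n"
  shows "card a = n"
proof -
  have part: "partition_on {1..2 * n} a" and c2: "\<And>e. e \<in> a \<Longrightarrow> card e = 2"
    using assms by (auto simp: crossingless_matchings_def)
  have fin: "finite a" using part finite_elements by blast
  have "card (\<Union> a) = (\<Sum>e\<in>a. card e)"
    by (rule card_Union_disjoint)
       (use part c2 in \<open>auto simp: partition_on_def intro: card_ge_0_finite\<close>)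
  also have "\<dots> = 2 * card a" using c2 by simp
  finally show ?thesis using cm_Union[OF assms] by simp
qed

text \<open>Every circle runs through an arc of \<open>b\<close>, and \<open>b\<close> has
  \<open>n\<close> arcs. This is why the sums over \<open>k \<le> n\<close> in
  \<open>odd_commutator\<close> capture all exterior degrees.\<close>

lemma card_circles_le:
  assumes "b \<in> crossingless_matchings n" "a \<in> crossingless_matchings n"
  shows "card (circles b a) \<le> n"
proof -
  have fin: "finite b" using assms(1) cm_card card_ge_0_finite finite_cm
    by (metis (no_types, lifting) cm_Union finite_UnionD finite_atLeastAtMost)
  have "circles b a \<subseteq> (\<lambda>e. circle_of (b \<union> a) (Min e)) ` b"
  proof
    fix s assume "s \<in> circles b a"
    then obtain v where v: "v \<in> {1..2 * n}" "s = circle_of (b \<union> a) v" using cm_circles[OF assms] by auto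
    let ?e = "{v, partner b v}"
    have e: "?e \<in> b" using cm_partner[OF assms(1) v(1)] .
    have "Min ?e \<in> ?e" by (rule Min_in) auto
    then have "(v, Min ?e) \<in> conn (b \<union> a)" using e by (intro conn_edge[of ?e]) auto
    then have "s = circle_of (b \<union> a) (Min ?e)" using v circle_of_cong by blast
    then show "s \<in> (\<lambda>e. circle_of (b \<union> a) (Min e)) ` b" using e by blast
  qed
  then have "card (circles b a) \<le> card b" using fin by (meson card_image_le card_mono finite_imageI le_trans)
  then show ?thesis using cm_card[OF assms(1)] by simp
qed

lemma cm_conn:
  assumes "a \<in> crossingless_matchings n" "v \<in> {1..2 * n}"
  shows "(v, w) \<in> conn a \<longleftrightarrow> w = v \<or> w = partner a v"
proof
  assume "(v, w) \<in> conn a"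
  then have "w \<in> {v, partner a v}"
  proof (rule conn_closed)
    fix e x y assume e: "e \<in> a" "x \<in> e" "y \<in> e" "x \<in> {v, partner a v}"
    then have "e = {v, partner a v}"
      using cm_disjoint[OF assms(1) e(1) cm_partner[OF assms]] by blast
    then show "y \<in> {v, partner a v}" using e by simp
  qed simp
  then show "w = v \<or> w = partner a v" by simp
next
  assume "w = v \<or> w = partner a v"
  then show "(v, w) \<in> conn a" using conn_edge[OF cm_partner[OF assms]] by auto
qed

lemma circle_of_cm:
  assumes "a \<in> crossingless_matchings n" "v \<in> {1..2 * n}"
  shows "circle_of a v = min v (partner a v)"
  unfolding circle_of_alt cm_conn[OF assms]
  by (rule Least_equality) (auto simp: min_def)

lemma circles_self:
  assumes "a \<in> crossingless_matchings n"
  shows "circles a a = {v \<in> {1..2 * n}. v < partner a v}"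
proof -
  have inv: "partner a v \<in> {1..2 * n}" "partner a v \<noteq> v" "partner a (partner a v) = v"
    if "v \<in> {1..2 * n}" for v
    using cm_nc_invol[OF assms] that by (auto simp: nc_invol_def)
  have "circles a a = (\<lambda>v. min v (partner a v)) ` {1..2 * n}"
    using cm_circles[OF assms assms] circle_of_cm[OF assms] by auto
  moreover have "min v (partner a v) \<in> {v \<in> {1..2 * n}. v < partner a v}" if "v \<in> {1..2 * n}" for v
    using inv[OF that] that by (auto simp: min_def)
  moreover have "v \<in> (\<lambda>v. min v (partner a v)) ` {1..2 * n}" if "v \<in> {1..2 * n}" "v < partner a v" for v
    using that by (intro image_eqI[of _ _ v]) auto
  ultimately show ?thesis by auto
qed

text \<open>In \<open>W(a)a\<close> every arc closes up with its mirror image, so circles and arcs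
  correspond. Hence the degree shift of a diagonal summand is 0, and the degree is twice the
  exterior degree.\<close>

lemma card_circles_self:
  assumes "a \<in> crossingless_matchings n"
  shows "card (circles a a) = n"
proof -
  have inv: "partner a v \<in> {1..2 * n}" "partner a v \<noteq> v" "partner a (partner a v) = v"
    if "v \<in> {1..2 * n}" for v
    using cm_nc_invol[OF assms] that by (auto simp: nc_invol_def)
  have "{1..2 * n} = circles a a \<union> partner a ` circles a a"
  proof
    show "{1..2 * n} \<subseteq> circles a a \<union> partner a ` circles a a"
    proof
      fix v assume v: "v \<in> {1..2 * n}"
      show "v \<in> circles a a \<union> partner a ` circles a a"
      proof (cases "v < partner a v")
        case False
        then have "partner a v \<in> circles a a" using inv[OF v] v by (simp add: circles_self[OF assms])
        then show ?thesis using inv[OF v] by (metis UnCI imageI)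
      qed (use v in \<open>simp add: circles_self[OF assms]\<close>)
    qed
  qed (use inv in \<open>auto simp: circles_self[OF assms]\<close>)
  moreover have "circles a a \<inter> partner a ` circles a a = {}"
    using inv by (force simp: circles_self[OF assms])
  moreover have "card (partner a ` circles a a) = card (circles a a)"
    by (rule card_image, rule inj_onI) (metis (no_types, lifting) inv circles_self[OF assms] mem_Collect_eq)
  moreover have "finite (circles a a)" using finite_circles[OF assms assms] .
  ultimately have "card {1..2 * n} = card (circles a a) + card (circles a a)"
    by (metis card_Un_disjoint finite_imageI)
  then show ?thesis by simp
qed


subsection \<open>Multiplication by an element of a diagonal summand\<close>

text \<open>Diagrams are sets of edges, so for \<open>c = b\<close> the upper copy of a treated arc
  survives as an arc of \<open>c\<close> and only the lower copy disappears. Its ends stay joined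
  through the two vertical edges and the surviving copy; the case \<open>a = b\<close> is symmetric.
  Up to components, the surgery adds one vertical edge.\<close>

lemma stacked_step:
  assumes cm: "b \<in> crossingless_matchings n"
    and e: "{i, j} \<in> b" "{i, j} \<notin> T" and cba: "c = b \<or> a = b"
  shows "conn (stacked n c b a (insert {i, j} T)) = conn (insert {i, 2 * n + i} (stacked n c b a T))"
    (is "conn ?E' = conn ?E")
proof
  let ?N = "2 * n"
  have up: "(i, j) \<in> conn ?E" and lo: "(?N + i, ?N + j) \<in> conn ?E" and mid: "(i, ?N + i) \<in> conn ?E"
    using e by (auto simp: stacked_def intro: conn_edge[of "{i, j}"] conn_edge[of "(+) ?N ` {i, j}"]
        conn_edge[of "{i, ?N + i}"])
  have right: "(j, ?N + j) \<in> conn ?E"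
    using up lo mid conn_sym conn_trans by meson
  show "conn ?E' \<subseteq> conn ?E"
  proof (rule conn_subset)
    fix f v w assume f: "f \<in> ?E'" "v \<in> f" "w \<in> f"
    have "f \<in> ?E \<or> f = {j, ?N + j}" using f(1) by (auto simp: stacked_def)
    then show "(v, w) \<in> conn ?E" using f(2,3) right conn_sym[OF right] conn_edge[of f ?E v w] by auto
  qed
  have mid': "(i, ?N + i) \<in> conn ?E'" and right': "(j, ?N + j) \<in> conn ?E'"
    using e by (auto simp: stacked_def intro: conn_edge[of "{i, ?N + i}"] conn_edge[of "{j, ?N + j}"])
  have ul: "(i, j) \<in> conn ?E' \<and> (?N + i, ?N + j) \<in> conn ?E'"
    using cba
  proof
    assume "c = b"
    then have "(i, j) \<in> conn ?E'" using e by (auto simp: stacked_def intro: conn_edge[of "{i, j}"])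
    then show ?thesis using mid' right' conn_sym conn_trans by meson
  next
    assume "a = b"
    then have "(?N + i, ?N + j) \<in> conn ?E'"
      using e by (auto simp: stacked_def intro: conn_edge[of "(+) ?N ` {i, j}"])
    then show ?thesis using mid' right' conn_sym conn_trans by meson
  qed
  show "conn ?E \<subseteq> conn ?E'"
  proof (rule conn_subset)
    fix f v w assume f: "f \<in> ?E" "v \<in> f" "w \<in> f"
    have "f \<in> ?E' \<or> f = {i, j} \<or> f = {?N + i, ?N + j}" using f(1) by (auto simp: stacked_def)
    then show "(v, w) \<in> conn ?E'" using f(2,3) ul conn_sym conn_edge[of f ?E' v w] by auto
  qed
qed

text \<open>In the layer where both matchings are \<open>b\<close>, the ends of an untreated arc
  meet no other arc and no vertical edge, so \<open>{i, j}\<close> (or its shift by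
  \<open>2 * n\<close>) is closed under all edges.\<close>

lemma stacked_separate:
  assumes cm: "b \<in> crossingless_matchings n" "c \<in> crossingless_matchings n" "a \<in> crossingless_matchings n"
    and e: "{i, j} \<in> b" "{i, j} \<notin> T" and T: "T \<subseteq> b" and cba: "c = b \<or> a = b"
  shows "(i, 2 * n + i) \<notin> conn (stacked n c b a T)"
proof
  let ?N = "2 * n"
  assume con: "(i, ?N + i) \<in> conn (stacked n c b a T)"
  have ij: "i \<in> {1..?N}" "j \<in> {1..?N}" using cm_pair[OF cm(1) e(1)] by auto
  have range: "x \<in> {1..?N}" if "f \<in> c \<or> f \<in> b \<or> f \<in> a" "x \<in> f" for f x
    using that cm_Union cm by blast
  have notT: "i \<notin> \<Union> T" "j \<notin> \<Union> T"
    using cm_disjoint[OF cm(1)] e T by blast+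
  have b: "f = {i, j}" if "f \<in> b" "x \<in> f" "x \<in> {i, j}" for f x
    using cm_disjoint[OF cm(1) that(1) e(1) that(2)] that(3) by blast
  from cba show False
  proof
    assume c: "c = b"
    have "?N + i \<in> {i, j}"
    proof (rule conn_closed[OF con])
      fix f x y assume f: "f \<in> stacked n c b a T" "x \<in> f" "y \<in> f" "x \<in> {i, j}"
      consider "f \<in> b" | g where "g \<in> b \<or> g \<in> a" "f = (+) ?N ` g" | p where "f = {p, ?N + p}" "p \<in> \<Union> T"
        using f(1) c by (auto simp: stacked_def)
      then show "y \<in> {i, j}"
      proof cases
        case 1
        then show ?thesis using b f by blast
      next
        case 2
        then obtain z where "z \<in> g" "x = ?N + z" using f by auto
        then show ?thesis using range[of g z] 2 f(4) ij by auto
      next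
        case 3
        then have "p \<in> {1..?N}" using range T by blast
        then show ?thesis using 3 f(2,4) notT ij by auto
      qed
    qed simp
    then show False using ij by auto
  next
    assume a: "a = b"
    have "i \<in> {?N + i, ?N + j}"
    proof (rule conn_closed[OF conn_sym[OF con]])
      fix f x y assume f: "f \<in> stacked n c b a T" "x \<in> f" "y \<in> f" "x \<in> {?N + i, ?N + j}"
      consider "f \<in> b \<or> f \<in> c" | g where "g \<in> b" "f = (+) ?N ` g" | p where "f = {p, ?N + p}" "p \<in> \<Union> T"
        using f(1) a by (auto simp: stacked_def)
      then show "y \<in> {?N + i, ?N + j}"
      proof cases
        case 1
        then show ?thesis using range[of f x] f ij by auto
      next
        case 2
        then obtain z where "z \<in> g" "x = ?N + z" using f by auto
        then have "g = {i, j}" using b[of g z] 2(1) f(4) by auto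
        then show ?thesis using 2 f by auto
      next
        case 3
        then have "p \<in> {1..?N}" using range T by blast
        then show ?thesis using 3 f(2,4) notT ij by auto
      qed
    qed simp
    then show False using ij by auto
  qed
qed

text \<open>Identifying upper and lower points contracts the vertical edges and turns the diagram
  into \<open>W(c)a\<close>. This projection never increases a vertex, so least vertices are
  preserved as well.\<close>

lemma circle_of_stacked_full:
  assumes cm: "b \<in> crossingless_matchings n" "c \<in> crossingless_matchings n" "a \<in> crossingless_matchings n"
    and v: "v \<in> {1..2 * n}"
  shows "circle_of (stacked n c b a b) v = circle_of (c \<union> a) v"
    and "circle_of (stacked n c b a b) (2 * n + v) = circle_of (c \<union> a) v"
proof -
  let ?N = "2 * n" and ?E = "stacked n c b a b"
  define f where "f x = (if x \<le> ?N then x else x - ?N)" for x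
  have range: "x \<in> {1..?N}" if "g \<in> c \<or> g \<in> b \<or> g \<in> a" "x \<in> g" for g x
    using that cm_Union cm by blast
  have vert: "(p, ?N + p) \<in> conn ?E" if "p \<in> {1..?N}" for p
    using that cm_Union[OF cm(1)] by (intro conn_edge[of "{p, ?N + p}"]) (auto simp: stacked_def)
  have proj: "(f x, f y) \<in> conn (c \<union> a)" if "(x, y) \<in> conn ?E" for x y
  proof (rule conn_map[OF that])
    fix e x y assume e: "e \<in> ?E" "x \<in> e" "y \<in> e"
    consider "e \<in> c" | g where "g \<in> a" "e = (+) ?N ` g" | p where "e = {p, ?N + p}" "p \<in> {1..?N}"
      using e(1) cm_Union[OF cm(1)] by (auto simp: stacked_def)
    then show "(f x, f y) \<in> conn (c \<union> a)"
    proof cases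
      case 1
      then have "f x = x" "f y = y" using range[of e x] range[of e y] e by (auto simp: f_def)
      then show ?thesis using 1 e conn_edge[of e "c \<union> a" x y] by simp
    next
      case 2
      then have "f x \<in> g" "f y \<in> g" using range[of g] e(2,3) by (force simp: f_def)+
      then show ?thesis using 2 conn_edge[of g] by blast
    next
      case 3
      then show ?thesis using e by (auto simp: f_def)
    qed
  qed
  have sub: "conn (c \<union> a) \<subseteq> conn ?E"
  proof (rule conn_subset)
    fix e x y assume e: "e \<in> c \<union> a" "x \<in> e" "y \<in> e"
    show "(x, y) \<in> conn ?E"
    proof (cases "e \<in> c")
      case True
      then show ?thesis using e by (intro conn_edge[of e]) (auto simp: stacked_def)
    next
      case False
      then have "(?N + x, ?N + y) \<in> conn ?E"
        using e by (intro conn_edge[of "(+) ?N ` e"]) (auto simp: stacked_def)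
      then show ?thesis using vert[of x] vert[of y] range[of e] e False conn_sym conn_trans by (meson UnE)
    qed
  qed
  have fv: "f v = v" using v by (simp add: f_def)
  show 1: "circle_of ?E v = circle_of (c \<union> a) v"
  proof (rule antisym)
    show "circle_of ?E v \<le> circle_of (c \<union> a) v"
      using sub circle_of_conn circle_of_le by blast
    have "(v, f (circle_of ?E v)) \<in> conn (c \<union> a)"
      using proj[OF circle_of_conn[of v ?E]] fv by simp
    then have "circle_of (c \<union> a) v \<le> f (circle_of ?E v)" by (rule circle_of_le)
    also have "\<dots> \<le> circle_of ?E v" by (simp add: f_def)
    finally show "circle_of (c \<union> a) v \<le> circle_of ?E v" .
  qed
  show "circle_of ?E (?N + v) = circle_of (c \<union> a) v"
    using circle_of_cong[OF vert[OF v]] 1 by simp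
qed

text \<open>Start of the induction over surgeries: nothing joins the two layers yet, so each circle
  keeps its name, shifted by \<open>2 * n\<close> in the lower layer.\<close>

lemma circle_of_stacked_empty:
  assumes cm: "b \<in> crossingless_matchings n" "c \<in> crossingless_matchings n" "a \<in> crossingless_matchings n"
  shows "s \<in> circles c b \<Longrightarrow> circle_of (stacked n c b a {}) s = s"
    and "s \<in> circles b a \<Longrightarrow> circle_of (stacked n c b a {}) (2 * n + s) = 2 * n + s"
proof -
  let ?N = "2 * n" and ?E = "stacked n c b a {}"
  have E: "?E = (c \<union> b) \<union> ((`) ((+) ?N)) ` (b \<union> a)" by (auto simp: stacked_def)
  have range: "x \<in> {1..?N}" if "g \<in> c \<or> g \<in> b \<or> g \<in> a" "x \<in> g" for g x
    using that cm_Union cm by blast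
  show "circle_of ?E s = s" if s: "s \<in> circles c b"
  proof (rule antisym)
    have "s \<in> {1..?N}" using s circles_subset[OF cm(2,1)] by auto
    have "circle_of ?E s \<in> {w. w \<in> {1..?N} \<and> (s, w) \<in> conn (c \<union> b)}"
    proof (rule conn_closed[OF circle_of_conn])
      show "s \<in> {w. w \<in> {1..?N} \<and> (s, w) \<in> conn (c \<union> b)}" using \<open>s \<in> {1..?N}\<close> by simp
      fix e x y assume e: "e \<in> ?E" "x \<in> e" "y \<in> e" "x \<in> {w. w \<in> {1..?N} \<and> (s, w) \<in> conn (c \<union> b)}"
      have "e \<in> c \<union> b"
      proof (rule ccontr)
        assume "e \<notin> c \<union> b"
        then obtain g where "g \<in> b \<union> a" "e = (+) ?N ` g" using e(1) E by auto
        then show False using range[of g] e(2,4) by force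
      qed
      then have "(x, y) \<in> conn (c \<union> b)" using e conn_edge[of e "c \<union> b" x y] by simp
      then show "y \<in> {w. w \<in> {1..?N} \<and> (s, w) \<in> conn (c \<union> b)}"
        using e \<open>e \<in> c \<union> b\<close> range[of e y] conn_trans by auto
    qed
    then have "circle_of (c \<union> b) s \<le> circle_of ?E s" using circle_of_le by blast
    then show "s \<le> circle_of ?E s" using circle_of_circles[OF s] by simp
  qed (rule circle_of_le, simp)
  show "circle_of ?E (?N + s) = ?N + s" if s: "s \<in> circles b a"
  proof (rule antisym)
    have "circle_of ?E (?N + s) \<in> (+) ?N ` {w. w \<in> {1..?N} \<and> (s, w) \<in> conn (b \<union> a)}"
    proof (rule conn_closed[OF circle_of_conn])
      show "?N + s \<in> (+) ?N ` {w. w \<in> {1..?N} \<and> (s, w) \<in> conn (b \<union> a)}"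
        using s circles_subset[OF cm(1,3)] by auto
      fix e x y assume e: "e \<in> ?E" "x \<in> e" "y \<in> e"
        "x \<in> (+) ?N ` {w. w \<in> {1..?N} \<and> (s, w) \<in> conn (b \<union> a)}"
      then obtain x' where x': "x = ?N + x'" "x' \<in> {1..?N}" "(s, x') \<in> conn (b \<union> a)" by auto
      have "e \<notin> c \<union> b" using range[of e x] e(2) x' by auto
      then obtain g where g: "g \<in> b \<union> a" "e = (+) ?N ` g" using e(1) E by auto
      then obtain y' where y': "y' \<in> g" "y = ?N + y'" using e by auto
      have "x' \<in> g" using g x' e by auto
      then have "(x', y') \<in> conn (b \<union> a)" using g(1) y'(1) conn_edge[of g "b \<union> a" x' y'] by simp
      then have "(s, y') \<in> conn (b \<union> a)" using x' conn_trans by blast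
      then show "y \<in> (+) ?N ` {w. w \<in> {1..?N} \<and> (s, w) \<in> conn (b \<union> a)}"
        using y' range[of g y'] g by auto
    qed
    then obtain w where w: "circle_of ?E (?N + s) = ?N + w" "(s, w) \<in> conn (b \<union> a)" by auto
    then have "circle_of (b \<union> a) s \<le> w" using circle_of_le by blast
    then show "?N + s \<le> circle_of ?E (?N + s)" using circle_of_circles[OF s] w by simp
  qed (rule circle_of_le, simp)
qed

lemma cm_arc_at:
  assumes "b \<in> crossingless_matchings n" "p \<in> {1..2 * n}"
  shows "arc_at b p = {p, partner b p}"
  unfolding arc_at_def
proof (rule the_equality)
  show "{p, partner b p} \<in> b \<and> p \<in> {p, partner b p}" using cm_partner[OF assms] by simp
  fix e assume "e \<in> b \<and> p \<in> e"
  then show "e = {p, partner b p}" by (intro cm_arc[OF assms(1)]) auto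
qed

text \<open>If \<open>c = b\<close> or \<open>a = b\<close>, one of the two circles through an untreated arc consists of the two copies
  of this arc only, so every surgery is a merge and neither the order nor the orientations matter.\<close>

lemma mult_cba_merge:
  assumes C: "C \<in> mult_rules n"
    and cm: "b \<in> crossingless_matchings n" "c \<in> crossingless_matchings n" "a \<in> crossingless_matchings n"
    and cba: "c = b \<or> a = b"
    and x: "x \<in> ext_carrier (circles c b)" and y: "y \<in> ext_carrier (circles b a)"
  shows "mult_cba n C c b a x y =
    ext_map (circle_of (c \<union> a)) x \<and>\<^sub>e ext_map (circle_of (c \<union> a)) y"
proof -
  let ?N = "2 * n" and ?E = "stacked n c b a"
  obtain ps src where Ceq: "C c b a = (ps, src)" by (cases "C c b a")
  have "admissible_order n b (fst (C c b a)) \<and> (\<forall>e\<in>b. snd (C c b a) e \<in> e)"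
    using C cm unfolding mult_rules_def by blast
  then have adm: "set ps = {1..?N}" and src: "\<And>e. e \<in> b \<Longrightarrow> src e \<in> e"
    by (simp_all add: Ceq admissible_order_def)
  have fx: "ext_finite x" and fy: "ext_finite y"
    using ext_finite_carrier[OF finite_circles] x y cm by blast+
  let ?z = "x \<and>\<^sub>e ext_map ((+) ?N) y"
  have fz: "ext_finite ?z" by (simp add: ext_finite_wedge ext_finite_map fx fy)
  \<comment> \<open>Invariant: after treating \<open>T\<close>, the current element is the image of
    the initial product under \<open>circle_of\<close> of the current diagram. It depends on the set
    \<open>T\<close> alone, which removes order and orientation at once.\<close>
  have step: "visit_point n C c b a p (T, ext_map (circle_of (?E T)) ?z) =
      (insert (arc_at b p) T, ext_map (circle_of (?E (insert (arc_at b p) T))) ?z)"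
    if p: "p \<in> {1..?N}" and T: "T \<subseteq> b" for p T
  proof (cases "arc_at b p \<in> T")
    case True
    then show ?thesis by (simp add: visit_point_def Let_def insert_absorb)
  next
    case False
    let ?e = "arc_at b p"
    have e: "?e \<in> b" using cm_arc_at[OF cm(1) p] cm_partner[OF cm(1) p] by simp
    define i where "i = src ?e"
    define j where "j = the_elem (?e - {i})"
    have ei: "?e = {i, partner b i}" using cm_arc[OF cm(1) e src[OF e]] by (simp add: i_def)
    have "i \<noteq> partner b i" using cm_pair(1)[OF cm(1)] e ei by metis
    then have "?e - {i} = {partner b i}" using ei by auto
    then have ej: "?e = {i, j}" using ei by (simp add: j_def)
    have con: "conn (?E (insert ?e T)) = conn (insert {i, ?N + i} (?E T))"
      using stacked_step[OF cm(1) _ _ cba, of i j T] e False ej by simp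
    have ne: "circle_of (?E T) i \<noteq> circle_of (?E T) (?N + i)"
      using stacked_separate[OF cm _ _ T cba, of i j] e False ej by (simp add: circle_of_eq_iff)
    have "visit_point n C c b a p (T, ext_map (circle_of (?E T)) ?z) =
      (insert ?e T, surgery_map n (?E T) (?E (insert ?e T)) i j (ext_map (circle_of (?E T)) ?z))"
      using False by (simp add: visit_point_def Let_def Ceq i_def j_def)
    also have "surgery_map n (?E T) (?E (insert ?e T)) i j (ext_map (circle_of (?E T)) ?z) =
      ext_map (circle_of (?E (insert ?e T))) ?z"
    proof -
      let ?h = "\<lambda>v. if circle_of (?E T) v = circle_of (?E T) i \<or> circle_of (?E T) v = circle_of (?E T) (?N + i)
          then circle_of (?E (insert ?e T)) i else circle_of (?E T) v"
      have "surgery_map n (?E T) (?E (insert ?e T)) i j (ext_map (circle_of (?E T)) ?z) = ext_map ?h ?z"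
        using ne by (simp add: surgery_map_def ext_map_comp[OF fz])
      moreover have "?h = circle_of (?E (insert ?e T))"
        by (intro ext, rule sym, rule circle_of_merge, rule con)
      ultimately show ?thesis by simp
    qed
    finally show ?thesis .
  qed
  have fold: "fold (visit_point n C c b a) qs (T, ext_map (circle_of (?E T)) ?z) =
      (T \<union> arc_at b ` set qs, ext_map (circle_of (?E (T \<union> arc_at b ` set qs))) ?z)"
    if "set qs \<subseteq> {1..?N}" "T \<subseteq> b" for qs T
    using that
  proof (induction qs arbitrary: T)
    case (Cons q qs)
    have "arc_at b q \<in> b"
      using Cons.prems cm_arc_at[OF cm(1), of q] cm_partner[OF cm(1), of q] by simp
    then show ?case using Cons step[of q T] by simp
  qed simp
  have "arc_at b ` {1..?N} = b"
  proof
    show "arc_at b ` {1..?N} \<subseteq> b" using cm_arc_at[OF cm(1)] cm_partner[OF cm(1)] by auto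
    show "b \<subseteq> arc_at b ` {1..?N}"
    proof
      fix e assume e: "e \<in> b"
      then obtain v where "v \<in> e" using cm(1) by (auto simp: crossingless_matchings_def) (metis card.empty ex_in_conv zero_neq_numeral)
      moreover then have "v \<in> {1..?N}" using e cm_Union[OF cm(1)] by auto
      ultimately show "e \<in> arc_at b ` {1..?N}"
        using cm_arc[OF cm(1) e] cm_arc_at[OF cm(1)] by (intro image_eqI[of _ _ v]) auto
    qed
  qed
  moreover have "ext_map (circle_of (?E {})) ?z = ?z"
  proof -
    have "?z \<in> ext_carrier (circles c b \<union> (+) ?N ` circles b a)"
    proof (rule wedge_carrier)
      show "x \<in> ext_carrier (circles c b \<union> (+) ?N ` circles b a)"
        using x by (auto simp: ext_carrier_def)
      show "ext_map ((+) ?N) y \<in> ext_carrier (circles c b \<union> (+) ?N ` circles b a)"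
        using ext_map_carrier[OF y finite_circles[OF cm(1,3)], of "(+) ?N"]
        by (auto simp: ext_carrier_def)
    qed
    then show ?thesis
      by (rule ext_map_id)
         (use finite_circles[OF cm(1,3)] finite_circles[OF cm(2,1)] circle_of_stacked_empty[OF cm] in auto)
  qed
  ultimately have "mult_cba n C c b a x y = ext_map (circle_of (?E b)) ?z"
    using fold[of ps "{}"] adm by (simp add: mult_cba_def Ceq)
  also have "\<dots> = ext_map (circle_of (?E b)) x \<and>\<^sub>e ext_map (\<lambda>s. circle_of (?E b) (?N + s)) y"
    by (simp add: ext_map_wedge fx fy ext_finite_map ext_map_comp)
  also have "ext_map (circle_of (?E b)) x = ext_map (circle_of (c \<union> a)) x"
    using circle_of_stacked_full(1)[OF cm] circles_subset[OF cm(2,1)]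
    by (intro ext_map_cong[OF x finite_circles[OF cm(2,1)]]) auto
  also have "ext_map (\<lambda>s. circle_of (?E b) (?N + s)) y = ext_map (circle_of (c \<union> a)) y"
    using circle_of_stacked_full(2)[OF cm] circles_subset[OF cm(1,3)]
    by (intro ext_map_cong[OF y finite_circles[OF cm(1,3)]]) auto
  finally show ?thesis .
qed

lemma mult_cba_zero:
  assumes "x = (\<lambda>U. 0) \<or> y = (\<lambda>U. 0)"
  shows "mult_cba n C c b a x y = (\<lambda>U. 0)"
proof -
  have "snd (fold (visit_point n C c b a) qs (T, \<lambda>U. 0)) = (\<lambda>U. 0)" for qs T
  proof (induction qs arbitrary: T)
    case (Cons q qs)
    have "snd (visit_point n C c b a q (T, \<lambda>U. 0)) = (\<lambda>U. 0)"
      by (simp add: visit_point_def surgery_map_def Let_def)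
    then obtain T' where "visit_point n C c b a q (T, \<lambda>U. 0) = (T', \<lambda>U. 0)"
      by (metis prod.collapse)
    then show ?case using Cons.IH[of T'] by simp
  qed simp
  then show ?thesis using assms by (auto simp: mult_cba_def)
qed


subsection \<open>The odd center as a ring of compatible families\<close>

definition diagonal :: "arc_elt \<Rightarrow> bool" where
  "diagonal z \<longleftrightarrow> (\<forall>b a. b \<noteq> a \<longrightarrow> z b a = (\<lambda>U. 0))"

definition compatible :: "nat \<Rightarrow> arc_elt \<Rightarrow> bool" where
  "compatible n z \<longleftrightarrow> (\<forall>b \<in> crossingless_matchings n. \<forall>a \<in> crossingless_matchings n.
     ext_map (circle_of (b \<union> a)) (z b b) = ext_map (circle_of (b \<union> a)) (z a a))"

text \<open>No multiplication rule occurs here; this is the source of the independence of the odd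
  center from \<open>C\<close>.\<close>

definition families :: "nat \<Rightarrow> arc_elt set" where
  "families n = {z \<in> OH_carrier n. diagonal z \<and> compatible n z}"

abbreviation homog_part :: "nat \<Rightarrow> 'a ext \<Rightarrow> 'a ext" where
  "homog_part k f \<equiv> (\<lambda>U. if card U = k then f U else 0)"

lemma OH_carrierD:
  assumes "x \<in> OH_carrier n"
  shows "b \<in> crossingless_matchings n \<Longrightarrow> a \<in> crossingless_matchings n \<Longrightarrow>
      x b a \<in> ext_carrier (circles b a)"
    and "b \<notin> crossingless_matchings n \<or> a \<notin> crossingless_matchings n \<Longrightarrow> x b a = (\<lambda>U. 0)"
  using assms by (auto simp: OH_carrier_def dest!: spec[of _ b] spec[of _ a] split: if_splits)

lemma OH_carrier_finite:
  assumes "x \<in> OH_carrier n"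
  shows "ext_finite (x b a)"
proof (cases "b \<in> crossingless_matchings n \<and> a \<in> crossingless_matchings n")
  case True
  then show ?thesis using OH_carrierD(1)[OF assms] ext_finite_carrier finite_circles by blast
next
  case False
  then show ?thesis using OH_carrierD(2)[OF assms] by (simp add: ext_finite_def)
qed

lemma OH_carrier_card_le:
  assumes "x \<in> OH_carrier n" "x b a U \<noteq> 0"
  shows "card U \<le> n"
proof (cases "b \<in> crossingless_matchings n \<and> a \<in> crossingless_matchings n")
  case True
  then have "U \<subseteq> circles b a"
    using OH_carrierD(1)[OF assms(1), of b a] assms(2) by (auto simp: ext_carrier_def)
  then have "card U \<le> card (circles b a)" using True finite_circles by (auto intro: card_mono)
  then show ?thesis using card_circles_le True le_trans by blast
next
  case False
  then show ?thesis using OH_carrierD(2)[OF assms(1)] assms(2) by metis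
qed

lemma OH_sel [simp]:
  "carrier (OH n C) = OH_carrier n"
  "zero (OH n C) = (\<lambda>b a U. 0)"
  "one (OH n C) = (\<lambda>b a. if b = a \<and> a \<in> crossingless_matchings n then ext_one else (\<lambda>U. 0))"
  "add (OH n C) x y = (\<lambda>b a U. x b a U + y b a U)"
  by (simp_all add: OH_def)

lemma OH_mult:
  "(x \<otimes>\<^bsub>OH n C\<^esub> y) c a = (\<lambda>U. \<Sum>b\<in>crossingless_matchings n. mult_cba n C c b a (x c b) (y b a) U)"
  by (simp add: OH_def)

lemma circle_of_mem_circles:
  assumes "b \<in> crossingless_matchings n" "a \<in> crossingless_matchings n" "v \<in> {1..2 * n}"
  shows "circle_of (b \<union> a) v \<in> circles b a"
  using cm_circles[OF assms(1,2)] assms(3) by auto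

text \<open>Only the middle index \<open>b\<close> contributes, since \<open>z\<close> vanishes off
  the diagonal, and \<open>x b a\<close> is already expressed in circles of \<open>W(b)a\<close>,
  hence unchanged by the renaming.\<close>

lemma OH_mult_diagonal_left:
  assumes "C \<in> mult_rules n" "z \<in> OH_carrier n" "diagonal z" "x \<in> OH_carrier n"
    and cm: "b \<in> crossingless_matchings n" "a \<in> crossingless_matchings n"
  shows "(z \<otimes>\<^bsub>OH n C\<^esub> x) b a = ext_map (circle_of (b \<union> a)) (z b b) \<and>\<^sub>e x b a"
proof -
  have zc: "z b b \<in> ext_carrier (circles b b)" and xc: "x b a \<in> ext_carrier (circles b a)"
    using OH_carrierD(1) assms by blast+
  have "(\<Sum>c\<in>crossingless_matchings n. mult_cba n C b c a (z b c) (x c a) U) =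
      (\<Sum>c\<in>crossingless_matchings n. if c = b then mult_cba n C b b a (z b b) (x b a) U else 0)" for U
    using assms(3) by (intro sum.cong) (auto simp: diagonal_def mult_cba_zero)
  then have "(z \<otimes>\<^bsub>OH n C\<^esub> x) b a = mult_cba n C b b a (z b b) (x b a)"
    using cm(1) finite_cm by (simp add: OH_mult)
  also have "\<dots> = ext_map (circle_of (b \<union> a)) (z b b) \<and>\<^sub>e ext_map (circle_of (b \<union> a)) (x b a)"
    by (rule mult_cba_merge[OF assms(1) cm(1) cm(1) cm(2) _ zc xc]) simp
  also have "ext_map (circle_of (b \<union> a)) (x b a) = x b a"
    by (rule ext_map_id[OF xc finite_circles[OF cm] circle_of_circles])
  finally show ?thesis .
qed

lemma OH_mult_diagonal_right:
  assumes "C \<in> mult_rules n" "z \<in> OH_carrier n" "diagonal z" "x \<in> OH_carrier n"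
    and cm: "b \<in> crossingless_matchings n" "a \<in> crossingless_matchings n"
  shows "(x \<otimes>\<^bsub>OH n C\<^esub> z) b a = x b a \<and>\<^sub>e ext_map (circle_of (b \<union> a)) (z a a)"
proof -
  have zc: "z a a \<in> ext_carrier (circles a a)" and xc: "x b a \<in> ext_carrier (circles b a)"
    using OH_carrierD(1) assms by blast+
  have "(\<Sum>c\<in>crossingless_matchings n. mult_cba n C b c a (x b c) (z c a) U) =
      (\<Sum>c\<in>crossingless_matchings n. if c = a then mult_cba n C b a a (x b a) (z a a) U else 0)" for U
    using assms(3) by (intro sum.cong) (auto simp: diagonal_def mult_cba_zero)
  then have "(x \<otimes>\<^bsub>OH n C\<^esub> z) b a = mult_cba n C b a a (x b a) (z a a)"
    using cm(2) finite_cm by (simp add: OH_mult)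
  also have "\<dots> = ext_map (circle_of (b \<union> a)) (x b a) \<and>\<^sub>e ext_map (circle_of (b \<union> a)) (z a a)"
    by (rule mult_cba_merge[OF assms(1) cm(2) cm(1) cm(2) _ xc zc]) simp
  also have "ext_map (circle_of (b \<union> a)) (x b a) = x b a"
    by (rule ext_map_id[OF xc finite_circles[OF cm] circle_of_circles])
  finally show ?thesis .
qed

lemma OH_mult_outside:
  assumes "x \<in> OH_carrier n" "y \<in> OH_carrier n"
    and "b \<notin> crossingless_matchings n \<or> a \<notin> crossingless_matchings n"
  shows "(x \<otimes>\<^bsub>OH n C\<^esub> y) b a = (\<lambda>U. 0)"
proof -
  have "mult_cba n C b c a (x b c) (y c a) = (\<lambda>U. 0)" for c
    using OH_carrierD(2) assms by (intro mult_cba_zero) blast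
  then show ?thesis by (simp add: OH_mult)
qed

lemma ext_part_carrier: "x \<in> OH_carrier n \<Longrightarrow> ext_part k x \<in> OH_carrier n"
  by (auto simp: OH_carrier_def ext_carrier_def ext_part_def fun_eq_iff split: if_splits)

lemma ext_part_diagonal: "diagonal z \<Longrightarrow> diagonal (ext_part k z)"
  by (auto simp: diagonal_def ext_part_def fun_eq_iff)

lemma ext_part_apply: "ext_part k x b a = homog_part k (x b a)"
  by (simp add: ext_part_def)

lemma sum_homog_part:
  assumes "f U \<noteq> 0 \<Longrightarrow> card U \<le> n"
  shows "(\<Sum>k\<le>n. homog_part k f U) = f U"
  using assms by (cases "card U \<le> n") auto

text \<open>These are the units of the single summands \<open>b(OH^n)a\<close>; they serve as test
  elements in \<open>OZ_carrier\<close>.\<close>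

definition ext_unit :: "matching \<Rightarrow> matching \<Rightarrow> arc_elt" where
  "ext_unit b a = (\<lambda>b' a'. if b' = b \<and> a' = a then ext_one else (\<lambda>U. 0))"

lemma ext_unit_carrier:
  "b \<in> crossingless_matchings n \<Longrightarrow> a \<in> crossingless_matchings n \<Longrightarrow> ext_unit b a \<in> OH_carrier n"
  by (auto simp: ext_unit_def OH_carrier_def ext_carrier_def ext_one_def)

lemma ext_part_unit: "ext_part l (ext_unit b a) = (if l = 0 then ext_unit b a else (\<lambda>b a U. 0))"
  by (auto simp: ext_part_def ext_unit_def ext_one_def fun_eq_iff)

lemma OH_carrier_zero: "(\<lambda>b a U. 0) \<in> OH_carrier n"
  by (simp add: OH_carrier_def ext_carrier_def)

text \<open>Graded commutativity moves the image of \<open>z a a\<close> to the left of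
  \<open>x b a\<close> with exactly the sign that the commutator contains, so what remains is left
  multiplication by the difference \<open>D\<close> of the two images.\<close>

lemma odd_commutator_diagonal:
  assumes C: "C \<in> mult_rules n" and z: "z \<in> OH_carrier n" "diagonal z" and x: "x \<in> OH_carrier n"
    and cm: "b \<in> crossingless_matchings n" "a \<in> crossingless_matchings n"
  defines "D \<equiv> \<lambda>V. ext_map (circle_of (b \<union> a)) (z b b) V - ext_map (circle_of (b \<union> a)) (z a a) V"
  shows "odd_commutator n C z x b a =
    (\<lambda>U. \<Sum>k\<le>n. \<Sum>l\<le>n. (homog_part k D \<and>\<^sub>e homog_part l (x b a)) U)"
proof -
  let ?p = "circle_of (b \<union> a)"
  have "(ext_part k z \<otimes>\<^bsub>OH n C\<^esub> ext_part l x) b a U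
       - (-1) ^ (k * l) * (ext_part l x \<otimes>\<^bsub>OH n C\<^esub> ext_part k z) b a U =
      (homog_part k D \<and>\<^sub>e homog_part l (x b a)) U" for k l U
  proof -
    let ?x = "homog_part l (x b a)"
    have hom: "ext_homog l ?x" "ext_homog k (homog_part k (ext_map ?p (z a a)))"
      by (auto simp: ext_homog_def)
    have "(ext_part k z \<otimes>\<^bsub>OH n C\<^esub> ext_part l x) b a = homog_part k (ext_map ?p (z b b)) \<and>\<^sub>e ?x"
      using OH_mult_diagonal_left[OF C ext_part_carrier[OF z(1)] ext_part_diagonal[OF z(2)] ext_part_carrier[OF x] cm]
      by (simp only: ext_part_apply ext_map_homog_part[OF OH_carrier_finite[OF z(1)]])
    moreover have "(ext_part l x \<otimes>\<^bsub>OH n C\<^esub> ext_part k z) b a = ?x \<and>\<^sub>e homog_part k (ext_map ?p (z a a))"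
      using OH_mult_diagonal_right[OF C ext_part_carrier[OF z(1)] ext_part_diagonal[OF z(2)] ext_part_carrier[OF x] cm]
      by (simp only: ext_part_apply ext_map_homog_part[OF OH_carrier_finite[OF z(1)]])
    moreover have "?x \<and>\<^sub>e homog_part k (ext_map ?p (z a a)) =
        (\<lambda>U. (-1) ^ (l * k) * (homog_part k (ext_map ?p (z a a)) \<and>\<^sub>e ?x) U)"
      by (rule wedge_homog_commute[OF hom])
    moreover have "homog_part k D =
        (\<lambda>V. homog_part k (ext_map ?p (z b b)) V + (-1) * homog_part k (ext_map ?p (z a a)) V)"
      by (auto simp: D_def)
    then have "homog_part k D \<and>\<^sub>e ?x = (\<lambda>U. (homog_part k (ext_map ?p (z b b)) \<and>\<^sub>e ?x) U +
        (-1) * (homog_part k (ext_map ?p (z a a)) \<and>\<^sub>e ?x) U)"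
      by (simp only: wedge_add_left wedge_smult_left)
    moreover have "(-1::int) ^ (k * l) * ((-1) ^ (l * k) * w) = w" for w
      by (simp add: mult.commute[of l k] flip: mult.assoc power_add)
    ultimately show ?thesis by simp
  qed
  then show ?thesis by (simp add: odd_commutator_def)
qed

text \<open>For diagonal \<open>z\<close>, the commutator with the unit of \<open>b(OH^n)a\<close>
  is the difference \<open>D\<close> itself, so centrality forces compatibility. Conversely,
  \<open>D = 0\<close> for all pairs annihilates every commutator.\<close>

lemma OZ_carrier:
  assumes C: "C \<in> mult_rules n"
  shows "carrier (OZ n C) = families n"
proof
  show "carrier (OZ n C) \<subseteq> families n"
  proof
    fix z assume "z \<in> carrier (OZ n C)"
    then have z: "z \<in> OH_carrier n"
      and com: "\<And>x. x \<in> OH_carrier n \<Longrightarrow> odd_commutator n C z x = (\<lambda>b a U. 0)"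
      by (auto simp: OZ_def)
    have diag: "z b a = (\<lambda>U. 0)" if "b \<noteq> a" for b a
    proof (cases "b \<in> crossingless_matchings n \<and> a \<in> crossingless_matchings n")
      case True
      then have cm: "b \<in> crossingless_matchings n" "a \<in> crossingless_matchings n" by auto
      let ?u = "ext_unit a a"
      have u: "ext_part l ?u \<in> OH_carrier n" "diagonal (ext_part l ?u)" for l
        using ext_unit_carrier[OF cm(2,2)] ext_part_carrier ext_part_diagonal[of ?u l]
        by (auto simp: diagonal_def ext_unit_def)
      \<comment> \<open>In the component \<open>(b, a)\<close> with \<open>b \<noteq> a\<close>,
        multiplication by this unit from the right keeps \<open>z b a\<close>; from the left it
        gives 0, because the unit has no entry at \<open>(b, b)\<close>.\<close>
      have "(ext_part k z \<otimes>\<^bsub>OH n C\<^esub> ext_part l ?u) b a U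
         - (-1) ^ (k * l) * (ext_part l ?u \<otimes>\<^bsub>OH n C\<^esub> ext_part k z) b a U =
         (if l = 0 then homog_part k (z b a) U else 0)" for k l U
      proof -
        have "(ext_part k z \<otimes>\<^bsub>OH n C\<^esub> ext_part l ?u) b a =
            homog_part k (z b a) \<and>\<^sub>e (if l = 0 then ext_one else (\<lambda>U. 0))"
          using OH_mult_diagonal_right[OF C u ext_part_carrier[OF z] cm, of k l]
          by (simp add: ext_part_unit ext_part_apply) (simp add: ext_unit_def)
        moreover have "homog_part k (z b a) \<and>\<^sub>e ext_one = homog_part k (z b a)"
          using OH_carrier_finite[OF z, of b a] by (intro wedge_one_right) (auto simp: ext_finite_def split: if_splits)
        moreover have "(ext_part l ?u \<otimes>\<^bsub>OH n C\<^esub> ext_part k z) b a = (\<lambda>U. 0)"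
          using OH_mult_diagonal_left[OF C u ext_part_carrier[OF z] cm, of l k] \<open>b \<noteq> a\<close>
          by (simp add: ext_part_unit) (simp add: ext_unit_def)
        ultimately show ?thesis by simp
      qed
      then have "odd_commutator n C z ?u b a U = (\<Sum>k\<le>n. homog_part k (z b a) U)" for U
        by (simp add: odd_commutator_def)
      then have "odd_commutator n C z ?u b a U = z b a U" for U
        using sum_homog_part[of "z b a" U n] OH_carrier_card_le[OF z] by auto
      then show ?thesis using com[OF ext_unit_carrier[OF cm(2,2)]] by (simp add: fun_eq_iff)
    next
      case False
      then show ?thesis using OH_carrierD(2)[OF z] by auto
    qed
    then have d: "diagonal z" by (simp add: diagonal_def)
    have "compatible n z"
      unfolding compatible_def
    proof (intro ballI)
      fix b a assume cm: "b \<in> crossingless_matchings n" "a \<in> crossingless_matchings n"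
      let ?p = "circle_of (b \<union> a)"
      define D where "D = (\<lambda>V. ext_map ?p (z b b) V - ext_map ?p (z a a) V)"
      have zc: "z b b \<in> ext_carrier (circles b b)" "z a a \<in> ext_carrier (circles a a)"
        using OH_carrierD(1)[OF z] cm by auto
      have sub: "?p ` circles b b \<subseteq> circles b a" "?p ` circles a a \<subseteq> circles b a"
        using circle_of_mem_circles[OF cm] circles_subset cm by blast+
      have Dc: "D \<in> ext_carrier (circles b a)"
      proof -
        have "U \<subseteq> circles b a" if "D U \<noteq> 0" for U
        proof -
          have "ext_map ?p (z b b) U \<noteq> 0 \<or> ext_map ?p (z a a) U \<noteq> 0" using that by (auto simp: D_def)
          then have "U \<subseteq> ?p ` circles b b \<or> U \<subseteq> ?p ` circles a a"
            using ext_map_carrier[OF zc(1) finite_circles[OF cm(1,1)], of ?p]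
              ext_map_carrier[OF zc(2) finite_circles[OF cm(2,2)], of ?p]
            by (auto simp only: ext_carrier_def mem_Collect_eq)
          then show ?thesis using sub by blast
        qed
        then show ?thesis by (simp add: ext_carrier_def)
      qed
      have Dle: "card U \<le> n" if "D U \<noteq> 0" for U
      proof -
        have "U \<subseteq> circles b a" using Dc that by (auto simp: ext_carrier_def)
        then have "card U \<le> card (circles b a)" using finite_circles[OF cm] by (auto intro: card_mono)
        then show ?thesis using card_circles_le[OF cm] by simp
      qed
      have Df: "ext_finite D" using ext_finite_carrier[OF finite_circles[OF cm] Dc] .
      have one: "homog_part k D \<and>\<^sub>e homog_part l (ext_unit b a b a) = (if l = 0 then homog_part k D else (\<lambda>U. 0))" for k l
      proof -
        have "homog_part l (ext_unit b a b a) = (if l = 0 then ext_one else (\<lambda>U. 0))"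
          by (auto simp: ext_unit_def ext_one_def)
        moreover have "homog_part k D \<and>\<^sub>e ext_one = homog_part k D"
          using Df by (intro wedge_one_right) (auto simp: ext_finite_def split: if_splits)
        ultimately show ?thesis by simp
      qed
      have "0 = odd_commutator n C z (ext_unit b a) b a U" for U
        using com[OF ext_unit_carrier[OF cm]] by simp
      also have "odd_commutator n C z (ext_unit b a) b a U = (\<Sum>k\<le>n. homog_part k D U)" for U
      proof -
        have "odd_commutator n C z (ext_unit b a) b a =
            (\<lambda>U. \<Sum>k\<le>n. \<Sum>l\<le>n. (homog_part k D \<and>\<^sub>e homog_part l (ext_unit b a b a)) U)"
          using odd_commutator_diagonal[OF C z d ext_unit_carrier[OF cm] cm] by (simp only: D_def)
        also have "\<dots> = (\<lambda>U. \<Sum>k\<le>n. \<Sum>l\<le>n. (if l = 0 then homog_part k D else (\<lambda>U. 0)) U)"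
          by (simp only: one)
        also have "\<dots> = (\<lambda>U. \<Sum>k\<le>n. homog_part k D U)"
          by (simp add: if_distribR)
        finally show ?thesis by (rule fun_cong)
      qed
      also have "(\<Sum>k\<le>n. homog_part k D U) = D U" for U by (rule sum_homog_part) (rule Dle)
      finally show "ext_map ?p (z b b) = ext_map ?p (z a a)" by (simp add: D_def fun_eq_iff)
    qed
    then show "z \<in> families n" using z d by (simp add: families_def)
  qed
  show "families n \<subseteq> carrier (OZ n C)"
  proof
    fix z assume "z \<in> families n"
    then have z: "z \<in> OH_carrier n" and d: "diagonal z" and c: "compatible n z"
      by (auto simp: families_def)
    have "odd_commutator n C z x = (\<lambda>b a U. 0)" if x: "x \<in> OH_carrier n" for x
    proof (intro ext)
      fix b a U
      show "odd_commutator n C z x b a U = 0"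
      proof (cases "b \<in> crossingless_matchings n \<and> a \<in> crossingless_matchings n")
        case True
        then have eq: "ext_map (circle_of (b \<union> a)) (z b b) = ext_map (circle_of (b \<union> a)) (z a a)"
          using c by (auto simp: compatible_def)
        have "homog_part k (\<lambda>V. g V - g V) = (\<lambda>V. 0)" for k and g :: "nat ext" by auto
        then show ?thesis using True odd_commutator_diagonal[OF C z d x, of b a] by (simp only: eq) simp
      next
        case False
        then show ?thesis
          by (simp add: odd_commutator_def OH_mult_outside ext_part_carrier z x)
      qed
    qed
    then show "z \<in> carrier (OZ n C)" using z by (simp add: OZ_def)
  qed
qed

lemma OZ_sel [simp]:
  "zero (OZ n C) = (\<lambda>b a U. 0)"
  "one (OZ n C) = (\<lambda>b a. if b = a \<and> a \<in> crossingless_matchings n then ext_one else (\<lambda>U. 0))"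
  "add (OZ n C) x y = (\<lambda>b a U. x b a U + y b a U)"
  "x \<otimes>\<^bsub>OZ n C\<^esub> y = x \<otimes>\<^bsub>OH n C\<^esub> y"
  by (simp_all add: OZ_def)

lemma families_entry_zero:
  assumes "z \<in> families n" "\<not> (b = a \<and> a \<in> crossingless_matchings n)"
  shows "z b a = (\<lambda>U. 0)"
proof (cases "b = a")
  case True
  then show ?thesis using assms OH_carrierD(2)[of z n b a] by (simp add: families_def)
next
  case False
  then show ?thesis using assms by (simp add: families_def diagonal_def)
qed

lemma families_eqI:
  assumes "z \<in> families n" "w \<in> families n" "\<And>a. a \<in> crossingless_matchings n \<Longrightarrow> z a a = w a a"
  shows "z = w"
proof (intro ext)
  fix b a U
  show "z b a U = w b a U"
  proof (cases "b = a \<and> a \<in> crossingless_matchings n")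
    case False
    then show ?thesis using assms(1,2)[THEN families_entry_zero] by simp
  qed (use assms(3) in auto)
qed

lemma families_mult:
  assumes "C \<in> mult_rules n" "z \<in> families n" "w \<in> families n"
  shows "z \<otimes>\<^bsub>OH n C\<^esub> w =
    (\<lambda>b a. if b = a \<and> a \<in> crossingless_matchings n then z a a \<and>\<^sub>e w a a else (\<lambda>U. 0))"
proof (intro ext)
  fix b a U
  have z: "z \<in> OH_carrier n" "diagonal z" and w: "w \<in> OH_carrier n" "diagonal w"
    using assms(2,3) by (auto simp: families_def)
  show "(z \<otimes>\<^bsub>OH n C\<^esub> w) b a U =
      (if b = a \<and> a \<in> crossingless_matchings n then z a a \<and>\<^sub>e w a a else (\<lambda>U. 0)) U"
  proof (cases "b \<in> crossingless_matchings n \<and> a \<in> crossingless_matchings n")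
    case True
    then have "(z \<otimes>\<^bsub>OH n C\<^esub> w) b a = ext_map (circle_of (b \<union> a)) (z b b) \<and>\<^sub>e w b a"
      using OH_mult_diagonal_left[OF assms(1) z w(1)] by simp
    moreover have "ext_map (circle_of (a \<union> a)) (z a a) = z a a"
      using True by (intro ext_map_id[OF OH_carrierD(1)[OF z(1)] finite_circles] circle_of_circles) auto
    ultimately show ?thesis using True w(2) by (auto simp: diagonal_def)
  next
    case False
    then show ?thesis using OH_mult_outside[OF z(1) w(1)] by auto
  qed
qed

lemma familiesI:
  assumes "\<And>a. a \<in> crossingless_matchings n \<Longrightarrow> f a \<in> ext_carrier (circles a a)"
    and "\<And>b a. b \<in> crossingless_matchings n \<Longrightarrow> a \<in> crossingless_matchings n \<Longrightarrow>
      ext_map (circle_of (b \<union> a)) (f b) = ext_map (circle_of (b \<union> a)) (f a)"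
  shows "(\<lambda>b a. if b = a \<and> a \<in> crossingless_matchings n then f a else (\<lambda>U. 0)) \<in> families n"
  using assms by (auto simp: families_def OH_carrier_def diagonal_def compatible_def ext_carrier_def)

lemma familiesD:
  assumes "z \<in> families n"
  shows "z = (\<lambda>b a. if b = a \<and> a \<in> crossingless_matchings n then z a a else (\<lambda>U. 0))"
    and "a \<in> crossingless_matchings n \<Longrightarrow> z a a \<in> ext_carrier (circles a a)"
    and "b \<in> crossingless_matchings n \<Longrightarrow> a \<in> crossingless_matchings n \<Longrightarrow>
      ext_map (circle_of (b \<union> a)) (z b b) = ext_map (circle_of (b \<union> a)) (z a a)"
    and "ext_finite (z b a)"
proof -
  show "z = (\<lambda>b a. if b = a \<and> a \<in> crossingless_matchings n then z a a else (\<lambda>U. 0))"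
  proof (intro ext)
    fix b a U
    show "z b a U = (if b = a \<and> a \<in> crossingless_matchings n then z a a else (\<lambda>U. 0)) U"
      using families_entry_zero[OF assms, of b a] by (cases "b = a \<and> a \<in> crossingless_matchings n") (simp, simp only: if_False not_False_eq_True)
  qed
qed (use assms OH_carrierD(1) OH_carrier_finite in \<open>auto simp: families_def compatible_def\<close>)

lemma families_add:
  assumes "z \<in> families n" "w \<in> families n"
  shows "(\<lambda>b a U. z b a U + w b a U) \<in> families n"
proof -
  have "(\<lambda>b a U. z b a U + w b a U) =
      (\<lambda>b a. if b = a \<and> a \<in> crossingless_matchings n then (\<lambda>U. z a a U + w a a U) else (\<lambda>U. 0))"
    by (subst familiesD(1)[OF assms(1)], subst familiesD(1)[OF assms(2)]) (auto simp: fun_eq_iff)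
  also have "\<dots> \<in> families n"
    using familiesD(2-4)[OF assms(1)] familiesD(2-4)[OF assms(2)]
  proof (intro familiesI)
    fix b a assume cm: "b \<in> crossingless_matchings n" "a \<in> crossingless_matchings n"
    show "ext_map (circle_of (b \<union> a)) (\<lambda>U. z b b U + w b b U) =
        ext_map (circle_of (b \<union> a)) (\<lambda>U. z a a U + w a a U)"
      using familiesD(3)[OF assms(1) cm] familiesD(3)[OF assms(2) cm]
      by (simp only: ext_map_add familiesD(4)[OF assms(1)] familiesD(4)[OF assms(2)])
  qed (auto simp: ext_carrier_def, metis add.right_neutral subsetD)
  finally show ?thesis .
qed

lemma families_smult:
  assumes "z \<in> families n"
  shows "(\<lambda>b a U. c * z b a U) \<in> families n"
proof -
  have "(\<lambda>b a U. c * z b a U) =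
      (\<lambda>b a. if b = a \<and> a \<in> crossingless_matchings n then (\<lambda>U. c * z a a U) else (\<lambda>U. 0))"
    by (subst familiesD(1)[OF assms(1)]) (auto simp: fun_eq_iff)
  also have "\<dots> \<in> families n"
    using familiesD(2-4)[OF assms(1)]
  proof (intro familiesI)
    fix b a assume cm: "b \<in> crossingless_matchings n" "a \<in> crossingless_matchings n"
    show "ext_map (circle_of (b \<union> a)) (\<lambda>U. c * z b b U) = ext_map (circle_of (b \<union> a)) (\<lambda>U. c * z a a U)"
      using familiesD(3)[OF assms(1) cm] by (simp only: ext_map_smult familiesD(4)[OF assms(1)])
  qed (auto simp: ext_carrier_def)
  finally show ?thesis .
qed

lemma families_zero: "(\<lambda>b a U. 0) \<in> families n"
  by (simp add: families_def OH_carrier_zero diagonal_def compatible_def)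

lemma families_ext_part:
  assumes "z \<in> families n"
  shows "ext_part k z \<in> families n"
proof -
  have "ext_part k z = (\<lambda>b a. if b = a \<and> a \<in> crossingless_matchings n then homog_part k (z a a) else (\<lambda>U. 0))"
    by (subst familiesD(1)[OF assms]) (auto simp: ext_part_def fun_eq_iff)
  also have "\<dots> \<in> families n"
    using familiesD(2-4)[OF assms]
  proof (intro familiesI)
    fix b a assume cm: "b \<in> crossingless_matchings n" "a \<in> crossingless_matchings n"
    show "ext_map (circle_of (b \<union> a)) (homog_part k (z b b)) = ext_map (circle_of (b \<union> a)) (homog_part k (z a a))"
      using familiesD(3)[OF assms(1) cm] by (simp only: ext_map_homog_part familiesD(4)[OF assms(1)])
  qed (auto simp: ext_carrier_def)
  finally show ?thesis .
qed

lemma OZ_mult_closed: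
  assumes C: "C \<in> mult_rules n" and z: "z \<in> families n" and w: "w \<in> families n"
  shows "z \<otimes>\<^bsub>OH n C\<^esub> w \<in> families n"
  unfolding families_mult[OF assms]
  using familiesD(2-4)[OF z] familiesD(2-4)[OF w]
proof (intro familiesI)
  fix b a assume cm: "b \<in> crossingless_matchings n" "a \<in> crossingless_matchings n"
  show "ext_map (circle_of (b \<union> a)) (z b b \<and>\<^sub>e w b b) = ext_map (circle_of (b \<union> a)) (z a a \<and>\<^sub>e w a a)"
    using familiesD(3)[OF z cm] familiesD(3)[OF w cm]
    by (simp only: ext_map_wedge familiesD(4)[OF z] familiesD(4)[OF w])
qed (simp add: wedge_carrier)

lemma OZ_one_closed: "one (OZ n C) \<in> families n"
proof -
  have "ext_one \<in> ext_carrier S" for S :: "nat set" by (simp add: ext_carrier_def ext_one_def)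
  then show ?thesis unfolding OZ_sel by (intro familiesI) simp_all
qed

text \<open>On families the product is the wedge product in each component, so associativity is
  inherited although \<open>OH n C\<close> itself is in general not associative.\<close>

lemma OZ_ring:
  assumes C: "C \<in> mult_rules n"
  shows "ring (OZ n C)"
proof (rule ringI)
  note car = OZ_carrier[OF C]
  note mult = families_mult[OF C]
  show "abelian_group (OZ n C)"
  proof (rule abelian_groupI)
    fix x assume "x \<in> carrier (OZ n C)"
    then show "\<exists>y\<in>carrier (OZ n C). y \<oplus>\<^bsub>OZ n C\<^esub> x = \<zero>\<^bsub>OZ n C\<^esub>"
      using families_smult[of x n "-1"] car by (intro bexI[of _ "\<lambda>b a U. (-1) * x b a U"]) auto
  qed (auto simp: car families_add families_zero add_ac)
  show "monoid (OZ n C)"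
  proof (rule monoidI)
    fix x y z assume "x \<in> carrier (OZ n C)" "y \<in> carrier (OZ n C)" "z \<in> carrier (OZ n C)"
    then show "x \<otimes>\<^bsub>OZ n C\<^esub> y \<otimes>\<^bsub>OZ n C\<^esub> z = x \<otimes>\<^bsub>OZ n C\<^esub> (y \<otimes>\<^bsub>OZ n C\<^esub> z)"
      using OZ_mult_closed[OF C] car by (simp add: mult wedge_assoc fun_eq_iff)
  next
    fix x assume x: "x \<in> carrier (OZ n C)"
    then have "finite U" if "x a a U \<noteq> 0" for a U
      using familiesD(4)[of x n a a] car that by (auto simp: ext_finite_def)
    then have one: "ext_one \<and>\<^sub>e x a a = x a a" "x a a \<and>\<^sub>e ext_one = x a a" for a
      using wedge_one_left wedge_one_right by blast+
    have fx: "x \<in> families n" using x car by simp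
    have one': "\<one>\<^bsub>OZ n C\<^esub> a a = ext_one" if "a \<in> crossingless_matchings n" for a
      using that by simp
    have "\<one>\<^bsub>OZ n C\<^esub> \<otimes>\<^bsub>OZ n C\<^esub> x =
        (\<lambda>b a. if b = a \<and> a \<in> crossingless_matchings n then x a a else (\<lambda>U. 0))"
      unfolding OZ_sel(4) mult[OF OZ_one_closed fx] using one one' by (intro ext) (simp del: OZ_sel)
    then show "\<one>\<^bsub>OZ n C\<^esub> \<otimes>\<^bsub>OZ n C\<^esub> x = x"
      by (rule trans) (rule familiesD(1)[OF fx, symmetric])
    have "x \<otimes>\<^bsub>OZ n C\<^esub> \<one>\<^bsub>OZ n C\<^esub> =
        (\<lambda>b a. if b = a \<and> a \<in> crossingless_matchings n then x a a else (\<lambda>U. 0))"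
      unfolding OZ_sel(4) mult[OF fx OZ_one_closed] using one one' by (intro ext) (simp del: OZ_sel)
    then show "x \<otimes>\<^bsub>OZ n C\<^esub> \<one>\<^bsub>OZ n C\<^esub> = x"
      by (rule trans) (rule familiesD(1)[OF fx, symmetric])
  qed (use OZ_mult_closed[OF C] OZ_one_closed car in auto)
next
  fix x y z assume "x \<in> carrier (OZ n C)" "y \<in> carrier (OZ n C)" "z \<in> carrier (OZ n C)"
  then have fam: "x \<in> families n" "y \<in> families n" "z \<in> families n" using OZ_carrier[OF C] by auto
  note mult = families_mult[OF C]
  show "(x \<oplus>\<^bsub>OZ n C\<^esub> y) \<otimes>\<^bsub>OZ n C\<^esub> z = x \<otimes>\<^bsub>OZ n C\<^esub> z \<oplus>\<^bsub>OZ n C\<^esub> y \<otimes>\<^bsub>OZ n C\<^esub> z"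
    using fam families_add[OF fam(1,2)] by (simp add: mult wedge_add_left fun_eq_iff)
  show "z \<otimes>\<^bsub>OZ n C\<^esub> (x \<oplus>\<^bsub>OZ n C\<^esub> y) = z \<otimes>\<^bsub>OZ n C\<^esub> x \<oplus>\<^bsub>OZ n C\<^esub> z \<otimes>\<^bsub>OZ n C\<^esub> y"
    using fam families_add[OF fam(1,2)] by (simp add: mult wedge_add_right fun_eq_iff)
qed

section \<open>The grading of the odd center\<close>

lemma OZ_finsum:
  assumes C: "C \<in> mult_rules n" and "finite S" "\<And>i. i \<in> S \<Longrightarrow> z i \<in> families n"
  shows "(\<Oplus>\<^bsub>OZ n C\<^esub>i\<in>S. z i) = (\<lambda>b a U. \<Sum>i\<in>S. z i b a U)"
proof -
  interpret ring "OZ n C" using OZ_ring[OF C] .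
  show ?thesis using assms(2,3)
  proof (induction S rule: finite_induct)
    case empty
    then show ?case by simp
  next
    case (insert i S)
    then show ?case by (subst finsum_insert) (auto simp: OZ_carrier[OF C])
  qed
qed

lemma OZ_degree_iff:
  assumes C: "C \<in> mult_rules n" and z: "z \<in> families n"
  shows "z \<in> OZ_degree n C d \<longleftrightarrow> (\<forall>a U. z a a U \<noteq> 0 \<longrightarrow> 2 * int (card U) = d)"
proof -
  have "a \<in> crossingless_matchings n \<and> b = a" if "z b a U \<noteq> 0" for b a U
    using that familiesD(1)[OF z] by metis
  then show ?thesis
    using z card_circles_self OZ_carrier[OF C]
    by (auto simp: OZ_degree_def OH_degree_def families_def) (metis add_diff_cancel_right')+
qed

text \<open>The degree is an integer because gradings are indexed by integers; for negative or odd
  \<open>d\<close> the component is 0 automatically.\<close>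

definition degree_part :: "int \<Rightarrow> arc_elt \<Rightarrow> arc_elt" where
  "degree_part d z = (\<lambda>b a U. if 2 * int (card U) = d then z b a U else 0)"

lemma degree_part_families:
  assumes "z \<in> families n"
  shows "degree_part d z \<in> families n"
proof (cases "\<exists>k::nat. d = 2 * int k")
  case True
  then obtain k :: nat where "d = 2 * int k" by auto
  then have "degree_part d z = ext_part k z" by (auto simp: degree_part_def ext_part_def fun_eq_iff)
  then show ?thesis using families_ext_part[OF assms] by simp
next
  case False
  then have "degree_part d z = (\<lambda>b a U. 0)" by (auto simp: degree_part_def fun_eq_iff)
  then show ?thesis by (simp add: families_zero)
qed

lemma OZ_graded:
  assumes C: "C \<in> mult_rules n"
  shows "graded_ring (OZ n C) (OZ_degree n C)"
  unfolding graded_ring_def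
proof (intro conjI allI ballI)
  interpret ring "OZ n C" using OZ_ring[OF C] .
  note car = OZ_carrier[OF C] and deg = OZ_degree_iff[OF C]
  have sub: "OZ_degree n C d \<subseteq> families n" for d using car by (auto simp: OZ_degree_def)
  show "ring (OZ n C)" by (rule ring_axioms)
  show "additive_subgroup (OZ_degree n C d) (OZ n C)" for d
  proof (rule additive_subgroup.intro, rule subgroup.intro)
    show "OZ_degree n C d \<subseteq> carrier (add_monoid (OZ n C))" using sub car by simp
    fix x y assume xy: "x \<in> OZ_degree n C d" "y \<in> OZ_degree n C d"
    then have fam: "x \<in> families n" "y \<in> families n" using sub by auto
    have "x \<oplus>\<^bsub>OZ n C\<^esub> y \<in> OZ_degree n C d"
      using xy unfolding deg[OF fam(1)] deg[OF fam(2)] OZ_sel deg[OF families_add[OF fam]]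
      by (metis add.right_neutral)
    then show "x \<otimes>\<^bsub>add_monoid (OZ n C)\<^esub> y \<in> OZ_degree n C d" by simp
    have neg: "(\<lambda>b a U. (-1) * x b a U) \<in> families n" using families_smult[OF fam(1)] .
    have "\<ominus>\<^bsub>OZ n C\<^esub> x = (\<lambda>b a U. (-1) * x b a U)"
      using fam(1) neg car by (intro minus_equality) auto
    then have "\<ominus>\<^bsub>OZ n C\<^esub> x \<in> OZ_degree n C d"
      using xy(1) unfolding deg[OF fam(1)] by (simp add: deg[OF neg, simplified])
    then show "inv\<^bsub>add_monoid (OZ n C)\<^esub> x \<in> OZ_degree n C d" by (simp add: a_inv_def)
  next
    show "\<one>\<^bsub>add_monoid (OZ n C)\<^esub> \<in> OZ_degree n C d"
      using deg[OF families_zero] by simp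
  qed
  show "\<one>\<^bsub>OZ n C\<^esub> \<in> OZ_degree n C 0"
    unfolding deg[OF OZ_one_closed] by (auto simp: ext_one_def)
  show "x \<otimes>\<^bsub>OZ n C\<^esub> y \<in> OZ_degree n C (d + e)"
    if x: "x \<in> OZ_degree n C d" and y: "y \<in> OZ_degree n C e" for d e x y
  proof -
    have fam: "x \<in> families n" "y \<in> families n" using sub x y by auto
    have "2 * int (card U) = d + e" if nz: "(x a a \<and>\<^sub>e y a a) U \<noteq> 0" for a U
    proof -
      obtain A where A: "finite U" "A \<subseteq> U" "x a a A \<noteq> 0" "y a a (U - A) \<noteq> 0"
        using nz by (rule wedge_nonzeroD)
      then have "2 * int (card A) = d" "2 * int (card (U - A)) = e"
        using x y deg fam by auto
      moreover have "card U = card A + card (U - A)"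
        using A by (metis card_Diff_subset card_mono finite_subset le_add_diff_inverse)
      ultimately show ?thesis by simp
    qed
    then have "\<forall>a U. (x \<otimes>\<^bsub>OH n C\<^esub> y) a a U \<noteq> 0 \<longrightarrow> 2 * int (card U) = d + e"
      by (auto simp: families_mult[OF C fam])
    then show ?thesis using deg[OF OZ_mult_closed[OF C fam]] by simp
  qed
  fix x assume "x \<in> carrier (OZ n C)"
  then have x: "x \<in> families n" using car by simp
  show "\<exists>!y. (\<forall>d. y d \<in> OZ_degree n C d) \<and> finite {d. y d \<noteq> \<zero>\<^bsub>OZ n C\<^esub>} \<and>
        x = (\<Oplus>\<^bsub>OZ n C\<^esub>d\<in>{d. y d \<noteq> \<zero>\<^bsub>OZ n C\<^esub>}. y d)"
  proof (rule ex1I)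
    let ?y = "\<lambda>d. degree_part d x"
    let ?S = "{d. ?y d \<noteq> \<zero>\<^bsub>OZ n C\<^esub>}"
    have "?S \<subseteq> (\<lambda>k. 2 * int k) ` {..n}"
    proof
      fix d assume "d \<in> ?S"
      then obtain b a U where "?y d b a U \<noteq> 0" by (auto simp: fun_eq_iff)
      then have "d = 2 * int (card U)" "x b a U \<noteq> 0" by (auto simp: degree_part_def split: if_splits)
      moreover then have "card U \<le> n" using x OH_carrier_card_le by (auto simp: families_def)
      ultimately show "d \<in> (\<lambda>k. 2 * int k) ` {..n}" by auto
    qed
    then have fin: "finite ?S" by (rule finite_subset) simp
    have "(\<Oplus>\<^bsub>OZ n C\<^esub>d\<in>?S. ?y d) = (\<lambda>b a U. \<Sum>d\<in>?S. ?y d b a U)"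
      by (rule OZ_finsum[OF C fin]) (rule degree_part_families[OF x])
    also have "\<dots> = x"
    proof (intro ext)
      fix b a U
      have "(\<Sum>d\<in>?S. ?y d b a U) = (\<Sum>d\<in>?S. if d = 2 * int (card U) then x b a U else 0)"
        by (intro sum.cong) (auto simp: degree_part_def)
      also have "\<dots> = (if 2 * int (card U) \<in> ?S then x b a U else 0)"
        by (simp only: sum.delta[OF fin])
      also have "\<dots> = x b a U"
        by (auto simp: degree_part_def fun_eq_iff)
      finally show "(\<Sum>d\<in>?S. ?y d b a U) = x b a U" .
    qed
    finally have "x = (\<Oplus>\<^bsub>OZ n C\<^esub>d\<in>?S. ?y d)" by simp
    moreover have "?y d \<in> OZ_degree n C d" for d
      unfolding deg[OF degree_part_families[OF x]] by (auto simp: degree_part_def)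
    ultimately show "(\<forall>d. ?y d \<in> OZ_degree n C d) \<and> finite ?S \<and> x = (\<Oplus>\<^bsub>OZ n C\<^esub>d\<in>?S. ?y d)"
      using fin by simp
  next
    fix y assume y: "(\<forall>d. y d \<in> OZ_degree n C d) \<and> finite {d. y d \<noteq> \<zero>\<^bsub>OZ n C\<^esub>} \<and>
        x = (\<Oplus>\<^bsub>OZ n C\<^esub>d\<in>{d. y d \<noteq> \<zero>\<^bsub>OZ n C\<^esub>}. y d)"
    let ?S = "{d. y d \<noteq> \<zero>\<^bsub>OZ n C\<^esub>}"
    have yf: "y d \<in> families n" for d using y sub by auto
    have fin: "finite ?S" using y by simp
    have xs: "x = (\<lambda>b a U. \<Sum>d\<in>?S. y d b a U)"
      using y OZ_finsum[OF C fin, of y] yf by simp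
    have hom: "y d a a U = 0" if "2 * int (card U) \<noteq> d" for d a U
      using y deg[OF yf] that by blast
    show "y = (\<lambda>d. degree_part d x)"
    proof
      fix d
      show "y d = degree_part d x"
      proof (rule families_eqI[OF yf degree_part_families[OF x]])
        fix a
        show "y d a a = degree_part d x a a"
        proof
          fix U
          show "y d a a U = degree_part d x a a U"
          proof (cases "2 * int (card U) = d")
            case True
            have "x a a U = (\<Sum>e\<in>?S. if e = d then y d a a U else 0)"
              unfolding xs using hom True by (intro sum.cong) auto
            also have "\<dots> = (if d \<in> ?S then y d a a U else 0)" by (simp only: sum.delta[OF fin])
            also have "\<dots> = y d a a U" by auto
            finally show ?thesis using True by (simp add: degree_part_def)
          qed (simp add: degree_part_def hom)
        qed
      qed
    qed
  qed
qed

text \<open>The identity map works: by \<open>OZ_carrier\<close> and \<open>families_mult\<close>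
  the carrier and the product are given by formulas without the rule.\<close>

lemma OZ_graded_isomorphic:
  assumes "C \<in> mult_rules n" "C' \<in> mult_rules n"
  shows "graded_isomorphic (OZ n C) (OZ_degree n C) (OZ n C') (OZ_degree n C')"
proof -
  have "(\<lambda>x. x) \<in> ring_iso (OZ n C) (OZ n C')"
    by (rule ring_iso_memI) (auto simp: OZ_carrier assms families_mult bij_betw_def)
  moreover have "OZ_degree n C = OZ_degree n C'"
    by (simp add: OZ_degree_def OZ_carrier assms fun_eq_iff)
  ultimately show ?thesis
    using OZ_graded[OF assms(1)] OZ_graded[OF assms(2)] unfolding graded_isomorphic_def
    by (intro conjI bexI[of _ "\<lambda>x. x"]) simp_all
qed

text \<open>Used to obtain the grading on the Springer side. A direct proof of uniqueness of
  homogeneous components there would first require homogeneity of \<open>OI n\<close>.\<close>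

lemma graded_ring_transfer:
  assumes R: "graded_ring R G" and S: "ring S" and h: "h \<in> ring_iso R S" and im: "\<And>d. h ` G d = H d"
  shows "graded_ring S H"
proof -
  have Rring: "ring R" using R by (simp add: graded_ring_def)
  interpret R: ring R by fact
  interpret S: ring S by fact
  interpret hom: ring_hom_ring R S h
    using h by (intro ring_hom_ringI2[OF Rring S]) (simp add: ring_iso_def)
  have bij: "bij_betw h (carrier R) (carrier S)" using h by (simp add: ring_iso_def)
  have inj: "inj_on h (carrier R)" using bij by (simp add: bij_betw_def)
  have G: "additive_subgroup (G d) R" for d using R by (simp add: graded_ring_def)
  have Gsub: "G d \<subseteq> carrier R" for d using additive_subgroup.a_subset[OF G] .
  have h0: "h u = \<zero>\<^bsub>S\<^esub> \<longleftrightarrow> u = \<zero>\<^bsub>R\<^esub>" if "u \<in> carrier R" for u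
    using inj that hom.hom_zero by (metis R.zero_closed inj_onD)
  have sup: "{d. h (y d) \<noteq> \<zero>\<^bsub>S\<^esub>} = {d. y d \<noteq> \<zero>\<^bsub>R\<^esub>}" if "\<forall>d. y d \<in> G d" for y
    using that Gsub h0 by blast
  have fs: "h (\<Oplus>\<^bsub>R\<^esub>d\<in>A. y d) = (\<Oplus>\<^bsub>S\<^esub>d\<in>A. h (y d))" if "\<forall>d. y d \<in> G d" for y and A :: "int set"
    using that Gsub by (subst hom.hom_finsum) (auto simp: comp_def)
  show ?thesis
    unfolding graded_ring_def
  proof (intro conjI allI ballI)
    show "ring S" by fact
    show "additive_subgroup (H d) S" for d
      using hom.img_is_add_subgroup[OF additive_subgroup.a_subgroup[OF G[of d]]] im
      by (simp add: additive_subgroup_def)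
    have "\<one>\<^bsub>R\<^esub> \<in> G 0" using R by (simp add: graded_ring_def)
    then show "\<one>\<^bsub>S\<^esub> \<in> H 0" using im[of 0] hom.hom_one by (metis imageI)
    show "x \<otimes>\<^bsub>S\<^esub> y \<in> H (d + e)" if xy: "x \<in> H d" "y \<in> H e" for d e x y
    proof -
      obtain u v where uv: "u \<in> G d" "v \<in> G e" "x = h u" "y = h v" using xy im by (metis imageE)
      then have "u \<otimes>\<^bsub>R\<^esub> v \<in> G (d + e)" using R by (auto simp: graded_ring_def)
      then have "h (u \<otimes>\<^bsub>R\<^esub> v) \<in> H (d + e)" using im by blast
      then show ?thesis using uv Gsub hom.hom_mult by (metis subsetD)
    qed
    fix x assume "x \<in> carrier S"
    then obtain u where u: "u \<in> carrier R" "x = h u" using bij by (auto simp: bij_betw_def)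
    have "\<exists>!y. (\<forall>d. y d \<in> G d) \<and> finite {d. y d \<noteq> \<zero>\<^bsub>R\<^esub>} \<and> u = (\<Oplus>\<^bsub>R\<^esub>d\<in>{d. y d \<noteq> \<zero>\<^bsub>R\<^esub>}. y d)"
      using R u(1) by (simp add: graded_ring_def)
    then obtain y where y: "\<forall>d. y d \<in> G d" "finite {d. y d \<noteq> \<zero>\<^bsub>R\<^esub>}"
        "u = (\<Oplus>\<^bsub>R\<^esub>d\<in>{d. y d \<noteq> \<zero>\<^bsub>R\<^esub>}. y d)"
      and uniq: "\<And>y'. \<lbrakk>\<forall>d. y' d \<in> G d; finite {d. y' d \<noteq> \<zero>\<^bsub>R\<^esub>};
        u = (\<Oplus>\<^bsub>R\<^esub>d\<in>{d. y' d \<noteq> \<zero>\<^bsub>R\<^esub>}. y' d)\<rbrakk> \<Longrightarrow> y' = y"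
      by (elim ex1E) blast
    show "\<exists>!y. (\<forall>d. y d \<in> H d) \<and> finite {d. y d \<noteq> \<zero>\<^bsub>S\<^esub>} \<and> x = (\<Oplus>\<^bsub>S\<^esub>d\<in>{d. y d \<noteq> \<zero>\<^bsub>S\<^esub>}. y d)"
    proof (rule ex1I)
      show "(\<forall>d. h (y d) \<in> H d) \<and> finite {d. h (y d) \<noteq> \<zero>\<^bsub>S\<^esub>} \<and>
          x = (\<Oplus>\<^bsub>S\<^esub>d\<in>{d. h (y d) \<noteq> \<zero>\<^bsub>S\<^esub>}. h (y d))"
        unfolding sup[OF y(1)] using y im fs[OF y(1)] u(2) by auto
    next
      fix w assume w: "(\<forall>d. w d \<in> H d) \<and> finite {d. w d \<noteq> \<zero>\<^bsub>S\<^esub>} \<and>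
          x = (\<Oplus>\<^bsub>S\<^esub>d\<in>{d. w d \<noteq> \<zero>\<^bsub>S\<^esub>}. w d)"
      have "\<forall>d. \<exists>v\<in>G d. h v = w d" using w im by (metis imageE)
      then obtain v where v: "\<forall>d. v d \<in> G d" "\<And>d. h (v d) = w d" by metis
      have "h (\<Oplus>\<^bsub>R\<^esub>d\<in>{d. v d \<noteq> \<zero>\<^bsub>R\<^esub>}. v d) = h u"
        using fs[OF v(1)] sup[OF v(1)] w u(2) v(2) by simp
      moreover have "(\<Oplus>\<^bsub>R\<^esub>d\<in>{d. v d \<noteq> \<zero>\<^bsub>R\<^esub>}. v d) \<in> carrier R"
        using v(1) Gsub by (intro R.finsum_closed) auto
      ultimately have "u = (\<Oplus>\<^bsub>R\<^esub>d\<in>{d. v d \<noteq> \<zero>\<^bsub>R\<^esub>}. v d)" using inj u(1) by (metis inj_onD)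
      moreover have "finite {d. v d \<noteq> \<zero>\<^bsub>R\<^esub>}" using sup[OF v(1)] w v(2) by simp
      ultimately have "v = y" using uniq v(1) by blast
      then show "w = (\<lambda>d. h (y d))" using v(2) by auto
    qed
  qed
qed


subsection \<open>Free rings and skew polynomials\<close>

text \<open>The linear extension of \<open>W\<close> from words to polynomials, evaluated at
  \<open>f\<close>. Since \<open>W\<close> is arbitrary, it covers both the coefficient functionals
  and the entries of an evaluated family.\<close>

definition word_lin :: "ncpoly \<Rightarrow> (nat list \<Rightarrow> int) \<Rightarrow> int" where
  "word_lin f W = (\<Sum>w | f w \<noteq> 0. f w * W w)"

definition word_ind :: "nat list \<Rightarrow> ncpoly" where
  "word_ind w = (\<lambda>u. if u = w then 1 else 0)"

lemma free_sel [simp]: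
  "zero (free_ring m) = (\<lambda>w. 0)"
  "one (free_ring m) = word_ind []"
  "add (free_ring m) f g = (\<lambda>w. f w + g w)"
  by (simp_all add: free_ring_def word_ind_def fun_eq_iff)

lemma free_mult: "(f \<otimes>\<^bsub>free_ring m\<^esub> g) w = (\<Sum>k\<le>length w. f (take k w) * g (drop k w))"
  by (simp add: free_ring_def)

lemma free_carrier:
  "f \<in> carrier (free_ring m) \<longleftrightarrow> finite {w. f w \<noteq> 0} \<and> (\<forall>w. f w \<noteq> 0 \<longrightarrow> set w \<subseteq> {1..m})"
  by (simp add: free_ring_def)

lemma word_lin_eq_sum:
  assumes "finite T" "{w. f w \<noteq> 0} \<subseteq> T"
  shows "word_lin f W = (\<Sum>w\<in>T. f w * W w)"
  unfolding word_lin_def using assms by (intro sum.mono_neutral_left) auto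

lemma word_lin_ind [simp]: "word_lin (word_ind w) W = W w"
  by (subst word_lin_eq_sum[of "{w}"]) (auto simp: word_ind_def)

lemma word_lin_add:
  assumes "finite {w. f w \<noteq> 0}" "finite {w. g w \<noteq> 0}"
  shows "word_lin (\<lambda>w. f w + g w) W = word_lin f W + word_lin g W"
proof -
  let ?T = "{w. f w \<noteq> 0} \<union> {w. g w \<noteq> 0}"
  have "word_lin (\<lambda>w. f w + g w) W = (\<Sum>w\<in>?T. (f w + g w) * W w)"
    "word_lin f W = (\<Sum>w\<in>?T. f w * W w)" "word_lin g W = (\<Sum>w\<in>?T. g w * W w)"
    using assms by (intro word_lin_eq_sum; auto)+
  then show ?thesis by (simp add: distrib_right sum.distrib)
qed

lemma word_lin_nonzeroD:
  assumes "word_lin f W \<noteq> 0"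
  obtains w where "f w \<noteq> 0" "W w \<noteq> 0"
proof -
  obtain w where "w \<in> {w. f w \<noteq> 0}" "f w * W w \<noteq> 0"
    using assms unfolding word_lin_def by (rule sum.not_neutral_contains_not_neutral)
  then show thesis using that by auto
qed

lemma word_lin_delta: "finite {w. f w \<noteq> 0} \<Longrightarrow> word_lin f (\<lambda>u. if u = w then 1 else 0) = f w"
  by (simp add: word_lin_def if_distrib[of "(*) _"] cong: if_cong)

lemma free_mult_support:
  "{w. (f \<otimes>\<^bsub>free_ring m\<^esub> g) w \<noteq> 0} \<subseteq> (\<lambda>(u, v). u @ v) ` ({w. f w \<noteq> 0} \<times> {w. g w \<noteq> 0})"
proof
  fix w assume "w \<in> {w. (f \<otimes>\<^bsub>free_ring m\<^esub> g) w \<noteq> 0}"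
  then have "(\<Sum>k\<le>length w. f (take k w) * g (drop k w)) \<noteq> 0" by (simp add: free_mult)
  then obtain k where "f (take k w) * g (drop k w) \<noteq> 0" by (rule sum.not_neutral_contains_not_neutral)
  then show "w \<in> (\<lambda>(u, v). u @ v) ` ({w. f w \<noteq> 0} \<times> {w. g w \<noteq> 0})"
    by (intro image_eqI[of _ _ "(take k w, drop k w)"]) auto
qed

text \<open>A word with a cut in it is the same as a pair of words. With this formula the monoid
  laws reduce to those of concatenation, since by \<open>free_eqI\<close> the functionals
  \<open>word_lin _ W\<close> separate polynomials.\<close>

lemma word_lin_mult:
  assumes "finite {w. f w \<noteq> 0}" "finite {w. g w \<noteq> 0}"
  shows "word_lin (f \<otimes>\<^bsub>free_ring m\<^esub> g) W = word_lin f (\<lambda>u. word_lin g (\<lambda>v. W (u @ v)))"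
proof -
  let ?F = "{w. f w \<noteq> 0}" and ?G = "{w. g w \<noteq> 0}"
  let ?t = "\<lambda>(w, k). f (take k w) * g (drop k w) * W w"
  define T where "T = (\<lambda>(u, v). u @ v) ` (?F \<times> ?G)"
  have fin: "finite T" using assms by (simp add: T_def)
  have app: "u @ v \<in> T" if "f u \<noteq> 0" "g v \<noteq> 0" for u v
    using that unfolding T_def by (intro image_eqI[of _ _ "(u, v)"]) auto
  have "word_lin (f \<otimes>\<^bsub>free_ring m\<^esub> g) W = (\<Sum>w\<in>T. \<Sum>k\<le>length w. f (take k w) * g (drop k w) * W w)"
    by (subst word_lin_eq_sum[OF fin free_mult_support[of m f g, folded T_def]]) (simp only: free_mult sum_distrib_right)
  also have "\<dots> = sum ?t (SIGMA w:T. {..length w})"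
    using fin by (simp add: sum.Sigma)
  also have "\<dots> = sum ?t {(w, k). w \<in> T \<and> k \<le> length w \<and> f (take k w) \<noteq> 0 \<and> g (drop k w) \<noteq> 0}"
    by (rule sum.mono_neutral_right) (use fin in auto)
  also have "\<dots> = (\<Sum>(u, v)\<in>?F \<times> ?G. f u * g v * W (u @ v))"
    by (rule sum.reindex_bij_witness[where i = "\<lambda>(u, v). (u @ v, length u)"
          and j = "\<lambda>(w, k). (take k w, drop k w)"]) (auto simp: app)
  also have "\<dots> = word_lin f (\<lambda>u. word_lin g (\<lambda>v. W (u @ v)))"
    by (simp add: word_lin_def sum.cartesian_product[symmetric] sum_distrib_left mult_ac)
  finally show ?thesis .
qed

lemma free_mult_closed:
  assumes "f \<in> carrier (free_ring m)" "g \<in> carrier (free_ring m)"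
  shows "f \<otimes>\<^bsub>free_ring m\<^esub> g \<in> carrier (free_ring m)"
  unfolding free_carrier
proof (intro conjI allI impI)
  show "finite {w. (f \<otimes>\<^bsub>free_ring m\<^esub> g) w \<noteq> 0}"
    using finite_subset[OF free_mult_support] assms by (simp add: free_carrier)
  fix w assume "(f \<otimes>\<^bsub>free_ring m\<^esub> g) w \<noteq> 0"
  then obtain u v where "w = u @ v" "f u \<noteq> 0" "g v \<noteq> 0" using subsetD[OF free_mult_support[of m f g], of w] by auto
  then show "set w \<subseteq> {1..m}" using assms by (auto simp: free_carrier)
qed

lemma free_eqI:
  assumes "f \<in> carrier (free_ring m)" "g \<in> carrier (free_ring m)" "\<And>W. word_lin f W = word_lin g W"
  shows "f = g"
proof
  fix w
  show "f w = g w"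
    using assms(3)[of "\<lambda>u. if u = w then 1 else 0"] assms(1,2) by (simp add: word_lin_delta free_carrier)
qed

lemma word_ind_closed: "set w \<subseteq> {1..m} \<Longrightarrow> word_ind w \<in> carrier (free_ring m)"
  by (simp add: free_carrier word_ind_def)

lemma free_add_closed:
  assumes "f \<in> carrier (free_ring m)" "g \<in> carrier (free_ring m)"
  shows "(\<lambda>w. f w + g w) \<in> carrier (free_ring m)"
proof -
  have "{w. f w + g w \<noteq> 0} \<subseteq> {w. f w \<noteq> 0} \<union> {w. g w \<noteq> 0}" by auto
  then have "finite {w. f w + g w \<noteq> 0}" using assms by (auto simp: free_carrier intro: finite_subset)
  moreover have "set w \<subseteq> {1..m}" if "f w + g w \<noteq> 0" for w
    using that assms unfolding free_carrier by (metis add.right_neutral)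
  ultimately show ?thesis by (simp add: free_carrier)
qed

lemma free_ring_ring: "ring (free_ring m)"
proof (rule ringI)
  note closed = free_mult_closed[of _ m] free_add_closed[of _ m] word_ind_closed[of "[]" m]
  have fin: "finite {w. f w \<noteq> 0}" if "f \<in> carrier (free_ring m)" for f
    using that by (simp add: free_carrier)
  have fin_mult: "finite {w. (f \<otimes>\<^bsub>free_ring m\<^esub> g) w \<noteq> 0}"
    if "f \<in> carrier (free_ring m)" "g \<in> carrier (free_ring m)" for f g
    using fin[OF free_mult_closed[OF that]] .
  show "abelian_group (free_ring m)"
  proof (rule abelian_groupI)
    fix f assume "f \<in> carrier (free_ring m)"
    then show "\<exists>g\<in>carrier (free_ring m). g \<oplus>\<^bsub>free_ring m\<^esub> f = \<zero>\<^bsub>free_ring m\<^esub>"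
      by (intro bexI[of _ "\<lambda>w. - f w"]) (auto simp: free_carrier)
  qed (auto simp: closed add_ac, simp add: free_carrier)
  show "monoid (free_ring m)"
  proof (rule monoidI)
    fix f g h assume fgh: "f \<in> carrier (free_ring m)" "g \<in> carrier (free_ring m)" "h \<in> carrier (free_ring m)"
    show "f \<otimes>\<^bsub>free_ring m\<^esub> g \<otimes>\<^bsub>free_ring m\<^esub> h = f \<otimes>\<^bsub>free_ring m\<^esub> (g \<otimes>\<^bsub>free_ring m\<^esub> h)"
      by (rule free_eqI[of _ m]) (simp_all add: fgh closed word_lin_mult fin fin_mult)
  next
    fix f assume f: "f \<in> carrier (free_ring m)"
    have one: "finite {w. word_ind [] w \<noteq> 0}" by (simp add: word_ind_def)
    show "\<one>\<^bsub>free_ring m\<^esub> \<otimes>\<^bsub>free_ring m\<^esub> f = f"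
      by (rule free_eqI[of _ m]) (simp_all add: f closed word_lin_mult fin one)
    show "f \<otimes>\<^bsub>free_ring m\<^esub> \<one>\<^bsub>free_ring m\<^esub> = f"
      by (rule free_eqI[of _ m]) (simp_all add: f closed word_lin_mult fin one)
  qed (use closed in auto)
  fix f g h
  show "(f \<oplus>\<^bsub>free_ring m\<^esub> g) \<otimes>\<^bsub>free_ring m\<^esub> h = f \<otimes>\<^bsub>free_ring m\<^esub> h \<oplus>\<^bsub>free_ring m\<^esub> g \<otimes>\<^bsub>free_ring m\<^esub> h"
    by (rule ext) (simp add: free_mult distrib_right sum.distrib)
  show "h \<otimes>\<^bsub>free_ring m\<^esub> (f \<oplus>\<^bsub>free_ring m\<^esub> g) = h \<otimes>\<^bsub>free_ring m\<^esub> f \<oplus>\<^bsub>free_ring m\<^esub> h \<otimes>\<^bsub>free_ring m\<^esub> g"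
    by (rule ext) (simp add: free_mult distrib_left sum.distrib)
qed

lemma free_var_ind: "free_var i = word_ind [i]"
  by (simp add: free_var_def word_ind_def fun_eq_iff)

lemma word_ind_mult:
  assumes "set u \<subseteq> {1..m}" "set v \<subseteq> {1..m}"
  shows "word_ind u \<otimes>\<^bsub>free_ring m\<^esub> word_ind v = word_ind (u @ v)"
proof -
  have "finite {x. word_ind w x \<noteq> 0}" for w by (simp add: word_ind_def)
  then show ?thesis using assms
    by (intro free_eqI[of _ m]) (simp_all add: free_mult_closed word_ind_closed word_lin_mult)
qed

text \<open>Words generate the additive group, and integer multiples are reached by repeated
  addition and negation, so closure of \<open>P\<close> under scalars need not be assumed.\<close>

lemma free_induct:
  assumes f: "f \<in> carrier (free_ring m)"
    and zero: "P (\<lambda>w. 0)" and ind: "\<And>w. set w \<subseteq> {1..m} \<Longrightarrow> f w \<noteq> 0 \<Longrightarrow> P (word_ind w)"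
    and add: "\<And>g h. g \<in> carrier (free_ring m) \<Longrightarrow> h \<in> carrier (free_ring m) \<Longrightarrow> P g \<Longrightarrow> P h \<Longrightarrow>
      P (\<lambda>w. g w + h w)"
    and neg: "\<And>g. g \<in> carrier (free_ring m) \<Longrightarrow> P g \<Longrightarrow> P (\<lambda>w. - g w)"
  shows "P f"
proof -
  let ?c = "carrier (free_ring m)"
  have sc: "(\<lambda>u. c * word_ind w u) \<in> ?c" if "set w \<subseteq> {1..m}" for c w
    using that by (simp add: free_carrier word_ind_def)
  have nat: "P (\<lambda>u. int k * word_ind w u)" if w: "set w \<subseteq> {1..m}" "f w \<noteq> 0" for k w
  proof (induction k)
    case (Suc k)
    then show ?case using add[OF word_ind_closed[OF w(1)] sc[OF w(1), of "int k"] ind[OF w]]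
      by (simp add: distrib_right)
  qed (simp add: zero)
  have int: "P (\<lambda>u. c * word_ind w u)" if w: "set w \<subseteq> {1..m}" "f w \<noteq> 0" for c w
  proof (cases "c \<ge> 0")
    case True
    then show ?thesis using nat[OF w, of "nat c"] by simp
  next
    case False
    then show ?thesis using neg[OF sc[OF w(1)] nat[OF w, of "nat (- c)"]] by simp
  qed
  have "P (\<lambda>u. \<Sum>w\<in>S. f w * word_ind w u) \<and> (\<lambda>u. \<Sum>w\<in>S. f w * word_ind w u) \<in> ?c"
    if "finite S" "S \<subseteq> {w. f w \<noteq> 0}" for S
    using that
  proof (induction S rule: finite_induct)
    case empty
    then show ?case using zero by (simp add: free_carrier)
  next
    case (insert w S)
    then have "set w \<subseteq> {1..m}" "f w \<noteq> 0" using f by (auto simp: free_carrier)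
    then show ?case using insert int sc add free_add_closed by simp
  qed
  then have "P (\<lambda>u. \<Sum>w\<in>{w. f w \<noteq> 0}. f w * word_ind w u)" using f by (simp add: free_carrier)
  moreover have "(\<lambda>u. \<Sum>w\<in>{w. f w \<noteq> 0}. f w * word_ind w u) = f"
  proof
    fix u
    have "(\<Sum>w\<in>{w. f w \<noteq> 0}. f w * word_ind w u) = (\<Sum>w\<in>{w. f w \<noteq> 0}. if w = u then f w else 0)"
      by (intro sum.cong) (auto simp: word_ind_def)
    then show "(\<Sum>w\<in>{w. f w \<noteq> 0}. f w * word_ind w u) = f u"
      using f by (simp add: free_carrier)
  qed
  ultimately show ?thesis by simp
qed

section \<open>Skew polynomials as a quotient\<close>

lemma skew_ideal_ideal: "ideal (skew_ideal m) (free_ring m)"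
proof -
  interpret ring "free_ring m" by (rule free_ring_ring)
  show ?thesis unfolding skew_ideal_def
    by (rule genideal_ideal) (auto simp: free_var_ind word_ind_closed simp del: free_sel)
qed

lemma OPol_ring: "ring (OPol m)"
  unfolding OPol_def by (rule ideal.quotient_is_ring[OF skew_ideal_ideal])

definition opol_class :: "nat \<Rightarrow> ncpoly \<Rightarrow> ncpoly set" where
  "opol_class m f = skew_ideal m +>\<^bsub>free_ring m\<^esub> f"

lemma opol_class_hom: "ring_hom_ring (free_ring m) (OPol m) (opol_class m)"
  unfolding OPol_def opol_class_def[abs_def] by (rule ideal.rcos_ring_hom_ring[OF skew_ideal_ideal])

lemma opol_class_surj: "opol_class m ` carrier (free_ring m) = carrier (OPol m)"
  unfolding OPol_def opol_class_def FactRing_def A_RCOSETS_def' by auto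

lemma pol_var_class: "pol_var m i = opol_class m (word_ind [i])"
  by (simp add: pol_var_def opol_class_def free_var_ind)

lemma pol_var_anticommute:
  assumes "i \<in> {1..m}" "j \<in> {1..m}" "i \<noteq> j"
  shows "pol_var m i \<otimes>\<^bsub>OPol m\<^esub> pol_var m j = \<ominus>\<^bsub>OPol m\<^esub> (pol_var m j \<otimes>\<^bsub>OPol m\<^esub> pol_var m i)"
proof -
  interpret ring_hom_ring "free_ring m" "OPol m" "opol_class m" by (rule opol_class_hom)
  interpret I: ideal "skew_ideal m" "free_ring m" by (rule skew_ideal_ideal)
  have c: "word_ind [i] \<in> carrier (free_ring m)" "word_ind [j] \<in> carrier (free_ring m)"
    using assms word_ind_closed by auto
  let ?r = "word_ind [i] \<otimes>\<^bsub>free_ring m\<^esub> word_ind [j] \<oplus>\<^bsub>free_ring m\<^esub> word_ind [j] \<otimes>\<^bsub>free_ring m\<^esub> word_ind [i]"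
  have "?r \<in> skew_ideal m"
    unfolding skew_ideal_def
    by (rule subsetD[OF R.genideal_self])
       (use assms in \<open>auto simp: free_var_ind word_ind_closed simp del: free_sel\<close>)
  then have "opol_class m ?r = \<zero>\<^bsub>OPol m\<^esub>"
    unfolding opol_class_def OPol_def FactRing_def by (simp del: free_sel add: I.a_rcos_const)
  then have "pol_var m i \<otimes>\<^bsub>OPol m\<^esub> pol_var m j \<oplus>\<^bsub>OPol m\<^esub> pol_var m j \<otimes>\<^bsub>OPol m\<^esub> pol_var m i = \<zero>\<^bsub>OPol m\<^esub>"
    using c by (simp del: free_sel add: pol_var_class)
  then show ?thesis using c
    by (intro S.minus_equality[symmetric]) (auto simp: pol_var_class simp del: free_sel)
qed

definition opol_word :: "nat \<Rightarrow> nat list \<Rightarrow> ncpoly set" where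
  "opol_word m w = foldr (\<lambda>i p. pol_var m i \<otimes>\<^bsub>OPol m\<^esub> p) w \<one>\<^bsub>OPol m\<^esub>"

lemma opol_class_word: "set w \<subseteq> {1..m} \<Longrightarrow> opol_class m (word_ind w) = opol_word m w"
proof (induction w)
  interpret ring_hom_ring "free_ring m" "OPol m" "opol_class m" by (rule opol_class_hom)
  {
    case Nil
    then show ?case using hom_one by (simp add: opol_word_def)
  next
    case (Cons i w)
    then have "word_ind (i # w) = word_ind [i] \<otimes>\<^bsub>free_ring m\<^esub> word_ind w"
      using word_ind_mult[of "[i]" m w] by simp
    then show ?case using Cons by (simp add: opol_word_def pol_var_class word_ind_closed del: free_sel)
  }
qed

text \<open>\<open>h\<close> is constant on the cosets of \<open>I\<close>, so
  \<open>the_elem\<close> picks its unique value. The ideal may be smaller than the kernel, as is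
  the case in general for the skew ideal.\<close>

lemma (in ring_hom_ring) induced_on_quotient:
  assumes "ideal I R" "I \<subseteq> a_kernel R S h"
  obtains h' where "ring_hom_ring (R Quot I) S h'" "\<And>x. x \<in> carrier R \<Longrightarrow> h' (I +> x) = h x"
proof -
  interpret I: ideal I R by fact
  define h' where "h' X = the_elem (h ` X)" for X
  have h': "h' (I +> x) = h x" if x: "x \<in> carrier R" for x
  proof -
    have "h (i \<oplus> x) = h x" if "i \<in> I" for i
    proof -
      have "i \<in> a_kernel R S h" using assms(2) that by blast
      then have "i \<in> carrier R" "h i = \<zero>\<^bsub>S\<^esub>" unfolding a_kernel_def' by auto
      then show ?thesis using x by simp
    qed
    moreover have "I \<noteq> {}" using additive_subgroup.zero_closed[OF ideal.axioms(1)[OF assms(1)]] by blast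
    ultimately have "h ` (I +> x) = {h x}" by (auto simp: a_r_coset_def' image_UN)
    then show ?thesis by (simp add: h'_def)
  qed
  have "ring_hom_ring (R Quot I) S h'"
  proof (rule ring_hom_ringI)
    show "ring (R Quot I)" by (rule I.quotient_is_ring)
    show "ring S" by (rule S.ring_axioms)
    show "h' X \<in> carrier S" if "X \<in> carrier (R Quot I)" for X
      using that h' by (auto simp: FactRing_def A_RCOSETS_def')
    show "h' \<one>\<^bsub>R Quot I\<^esub> = \<one>\<^bsub>S\<^esub>" using h'[of \<one>] by (simp add: FactRing_def)
    fix X Y assume "X \<in> carrier (R Quot I)" "Y \<in> carrier (R Quot I)"
    then obtain x y where xy: "x \<in> carrier R" "y \<in> carrier R" "X = I +> x" "Y = I +> y"
      by (auto simp: FactRing_def A_RCOSETS_def')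
    show "h' (X \<otimes>\<^bsub>R Quot I\<^esub> Y) = h' X \<otimes>\<^bsub>S\<^esub> h' Y"
      using h' xy by (simp add: FactRing_def I.rcoset_mult_add)
    show "h' (X \<oplus>\<^bsub>R Quot I\<^esub> Y) = h' X \<oplus>\<^bsub>S\<^esub> h' Y"
      using h' xy by (simp add: FactRing_def I.a_rcos_sum)
  qed
  then show thesis using h' that by blast
qed


subsection \<open>The homomorphism to the odd center\<close>

text \<open>\<open>circle_of a\<close> suffices to name the circles of \<open>W(a)a\<close>, since
  the edge set of that diagram is \<open>a \<union> a = a\<close>.\<close>

definition circle_word :: "matching \<Rightarrow> nat list \<Rightarrow> nat ext" where
  "circle_word a w = wedge_list (map (circle_of a) w)"

definition eval_family :: "nat \<Rightarrow> ncpoly \<Rightarrow> arc_elt" where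
  "eval_family n f = (\<lambda>b a. if b = a \<and> a \<in> crossingless_matchings n
     then (\<lambda>U. word_lin f (\<lambda>w. circle_word a w U)) else (\<lambda>U. 0))"

lemma eval_family_apply:
  "a \<in> crossingless_matchings n \<Longrightarrow> eval_family n f a a = (\<lambda>U. word_lin f (\<lambda>w. circle_word a w U))"
  by (simp add: eval_family_def)

text \<open>Passing to a coarser diagram only renames circles, so the result depends on the coarser
  diagram alone; this is what makes \<open>eval_family\<close> compatible.\<close>

lemma circle_word_map:
  assumes "conn a \<subseteq> conn E"
  shows "ext_map (circle_of E) (circle_word a w) = wedge_list (map (circle_of E) w)"
  unfolding circle_word_def ext_map_wedge_list by (simp add: circle_of_circle_of[OF assms] comp_def)

lemma eval_family_families:
  assumes "f \<in> carrier (free_ring (2 * n))"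
  shows "eval_family n f \<in> families n"
  unfolding eval_family_def
proof (rule familiesI)
  have fin: "finite {w. f w \<noteq> 0}" using assms by (simp add: free_carrier)
  fix a assume a: "a \<in> crossingless_matchings n"
  have "U \<subseteq> circles a a" if nz: "word_lin f (\<lambda>w. circle_word a w U) \<noteq> 0" for U
  proof -
    obtain w where w: "f w \<noteq> 0" "circle_word a w U \<noteq> 0" using nz by (rule word_lin_nonzeroD)
    then have "U = circle_of a ` set w" using wedge_list_nonzeroD(2)[of "map (circle_of a) w" U]
      by (simp add: circle_word_def)
    moreover have "set w \<subseteq> {1..2 * n}" using w(1) assms by (simp add: free_carrier)
    ultimately show ?thesis using cm_circles[OF a a] by auto
  qed
  then show "(\<lambda>U. word_lin f (\<lambda>w. circle_word a w U)) \<in> ext_carrier (circles a a)"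
    by (simp add: ext_carrier_def)
  have map: "ext_map (circle_of E) (\<lambda>U. word_lin f (\<lambda>w. circle_word a w U)) =
      (\<lambda>U. word_lin f (\<lambda>w. wedge_list (map (circle_of E) w) U))" if "conn a \<subseteq> conn E" for a E
  proof -
    have "ext_map (circle_of E) (\<lambda>U. \<Sum>w | f w \<noteq> 0. f w * circle_word a w U) =
        (\<lambda>U. \<Sum>w | f w \<noteq> 0. f w * ext_map (circle_of E) (circle_word a w) U)"
      by (rule ext_map_sum[OF fin]) (simp add: circle_word_def ext_finite_wedge_list)
    then show ?thesis by (simp only: word_lin_def circle_word_map[OF that])
  qed
  fix b assume "b \<in> crossingless_matchings n"
  show "ext_map (circle_of (b \<union> a)) (\<lambda>U. word_lin f (\<lambda>w. circle_word b w U)) =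
      ext_map (circle_of (b \<union> a)) (\<lambda>U. word_lin f (\<lambda>w. circle_word a w U))"
    using conn_mono[of b "b \<union> a"] conn_mono[of a "b \<union> a"] by (simp add: map)
qed

lemma eval_family_hom:
  assumes C: "C \<in> mult_rules n"
  shows "ring_hom_ring (free_ring (2 * n)) (OZ n C) (eval_family n)"
proof (rule ring_hom_ringI)
  show "ring (free_ring (2 * n))" "ring (OZ n C)" by (rule free_ring_ring, rule OZ_ring[OF C])
  show "eval_family n f \<in> carrier (OZ n C)" if "f \<in> carrier (free_ring (2 * n))" for f
    using eval_family_families[OF that] OZ_carrier[OF C] by simp
  show "eval_family n \<one>\<^bsub>free_ring (2 * n)\<^esub> = \<one>\<^bsub>OZ n C\<^esub>"
    by (auto simp: eval_family_def circle_word_def fun_eq_iff)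
  fix f g assume fg: "f \<in> carrier (free_ring (2 * n))" "g \<in> carrier (free_ring (2 * n))"
  then have fin: "finite {w. f w \<noteq> 0}" "finite {w. g w \<noteq> 0}" by (simp_all add: free_carrier)
  show "eval_family n (f \<oplus>\<^bsub>free_ring (2 * n)\<^esub> g) = eval_family n f \<oplus>\<^bsub>OZ n C\<^esub> eval_family n g"
    by (simp add: eval_family_def word_lin_add[OF fin] fun_eq_iff)
  have "word_lin (f \<otimes>\<^bsub>free_ring (2 * n)\<^esub> g) (\<lambda>w. circle_word a w U) =
      ((\<lambda>U. word_lin f (\<lambda>w. circle_word a w U)) \<and>\<^sub>e (\<lambda>U. word_lin g (\<lambda>w. circle_word a w U))) U" for a U
  proof -
    have "word_lin (f \<otimes>\<^bsub>free_ring (2 * n)\<^esub> g) (\<lambda>w. circle_word a w U) =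
        word_lin f (\<lambda>u. word_lin g (\<lambda>v. (circle_word a u \<and>\<^sub>e circle_word a v) U))"
      by (simp add: word_lin_mult[OF fin] circle_word_def wedge_list_append)
    then show ?thesis unfolding word_lin_def by (simp only: wedge_sum_left wedge_sum_right)
  qed
  then have "eval_family n (f \<otimes>\<^bsub>free_ring (2 * n)\<^esub> g) =
    (\<lambda>b a. if b = a \<and> a \<in> crossingless_matchings n then eval_family n f a a \<and>\<^sub>e eval_family n g a a else (\<lambda>U. 0))"
    by (simp add: eval_family_def fun_eq_iff)
  then show "eval_family n (f \<otimes>\<^bsub>free_ring (2 * n)\<^esub> g) = eval_family n f \<otimes>\<^bsub>OZ n C\<^esub> eval_family n g"
    by (simp only: OZ_sel families_mult[OF C eval_family_families[OF fg(1)] eval_family_families[OF fg(2)]])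
qed

lemma skew_ideal_kernel:
  assumes C: "C \<in> mult_rules n"
  shows "skew_ideal (2 * n) \<subseteq> a_kernel (free_ring (2 * n)) (OZ n C) (eval_family n)"
  unfolding skew_ideal_def
proof -
  interpret ring_hom_ring "free_ring (2 * n)" "OZ n C" "eval_family n" by (rule eval_family_hom[OF C])
  show "Idl\<^bsub>free_ring (2 * n)\<^esub> {free_var i \<otimes>\<^bsub>free_ring (2 * n)\<^esub> free_var j \<oplus>\<^bsub>free_ring (2 * n)\<^esub>
      free_var j \<otimes>\<^bsub>free_ring (2 * n)\<^esub> free_var i |i j. i \<in> {1..2 * n} \<and> j \<in> {1..2 * n} \<and> i \<noteq> j}
    \<subseteq> a_kernel (free_ring (2 * n)) (OZ n C) (eval_family n)"
  proof (rule R.genideal_minimal[OF kernel_is_ideal], clarify)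
    fix i j assume ij: "i \<in> {1..2 * n}" "j \<in> {1..2 * n}" "i \<noteq> j"
    let ?r = "free_var i \<otimes>\<^bsub>free_ring (2 * n)\<^esub> free_var j \<oplus>\<^bsub>free_ring (2 * n)\<^esub>
      free_var j \<otimes>\<^bsub>free_ring (2 * n)\<^esub> free_var i"
    have r: "?r = (\<lambda>w. word_ind [i, j] w + word_ind [j, i] w)"
      using word_ind_mult[of "[i]" "2 * n" "[j]"] word_ind_mult[of "[j]" "2 * n" "[i]"] ij
      by (simp add: free_var_ind)
    have fin: "finite {w. word_ind u w \<noteq> 0}" for u by (simp add: word_ind_def)
    have "?r \<in> carrier (free_ring (2 * n))"
      unfolding r using ij by (intro free_add_closed word_ind_closed) auto
    moreover have "circle_word a [i, j] U + circle_word a [j, i] U = 0" for a U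
      using fun_cong[OF ext_gen_anticommute[of "circle_of a i" "circle_of a j" ext_one], of U]
      by (simp add: circle_word_def)
    then have "eval_family n ?r = \<zero>\<^bsub>OZ n C\<^esub>"
      unfolding r eval_family_def word_lin_add[OF fin fin] by (auto simp: fun_eq_iff)
    ultimately show "?r \<in> a_kernel (free_ring (2 * n)) (OZ n C) (eval_family n)"
      unfolding a_kernel_def' by (intro CollectI conjI)
  qed
qed


subsection \<open>Vanishing of the odd elementary polynomials\<close>

lemma nc_involD:
  assumes "nc_invol V \<mu>" "v \<in> V"
  shows "\<mu> v \<in> V" "\<mu> v \<noteq> v" "\<mu> (\<mu> v) = v"
    and "w \<in> V \<Longrightarrow> v < w \<Longrightarrow> w < \<mu> v \<Longrightarrow> v < \<mu> w \<and> \<mu> w < \<mu> v"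
  using assms by (simp_all add: nc_invol_def)

text \<open>Induction: remove a shortest arc, together with its end point in \<open>Q\<close> and a point of \<open>Q\<close> below it.\<close>

lemma nested_arcs_bound:
  assumes nc: "nc_invol V \<mu>" and "finite L" "finite Q" "L \<subseteq> V" "Q \<subseteq> V" "\<And>i. i \<in> L \<Longrightarrow> i < \<mu> i"
    and "\<And>i. i \<in> L \<Longrightarrow> i \<in> Q \<longleftrightarrow> \<mu> i \<notin> Q"
    and "\<And>i. i \<in> L \<Longrightarrow> odd (card (Q \<inter> {i<..<\<mu> i}))"
  shows "2 * card L \<le> card Q"
  using assms(2-)
proof (induction "card L" arbitrary: L Q)
  case 0
  then show ?case by simp
next
  case (Suc m)
  have "L \<noteq> {}" using Suc.hyps(2) by auto
  then obtain i where i: "i \<in> L" and min: "\<And>f. f \<in> L \<Longrightarrow> \<mu> i - i \<le> \<mu> f - f"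
    using ex_min_if_finite[of "(\<lambda>f. \<mu> f - f) ` L"] Suc.prems(1) by (auto simp: not_less)
  have iV: "i \<in> V" and ilt: "i < \<mu> i" using i Suc.prems by auto
  have "Q \<inter> {i<..<\<mu> i} \<noteq> {}" using Suc.prems(7)[OF i] by auto
  then obtain q where q: "q \<in> Q" "i < q" "q < \<mu> i" by auto
  obtain p where p: "p \<in> Q" "p = i \<or> p = \<mu> i" using Suc.prems(6)[OF i] by blast
  have pq: "p \<noteq> q" using p q by auto
  let ?L = "L - {i}" and ?Q = "Q - {p, q}"
  \<comment> \<open>Because \<open>i\<close> has minimal length in \<open>L\<close>, no other arc of
    \<open>L\<close> can have an end strictly under it.\<close>
  have f: "f \<in> V" "f < \<mu> f" "f \<noteq> i" "f \<noteq> \<mu> i" "\<mu> f \<noteq> i" "\<mu> f \<noteq> \<mu> i" "\<not> (i < f \<and> f < \<mu> i)"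
      "\<not> (i < \<mu> f \<and> \<mu> f < \<mu> i)" if "f \<in> ?L" for f
  proof -
    show fV: "f \<in> V" and flt: "f < \<mu> f" and "f \<noteq> i" using that Suc.prems by auto
    show "f \<noteq> \<mu> i" "\<mu> f \<noteq> i" "\<mu> f \<noteq> \<mu> i"
      using flt ilt \<open>f \<noteq> i\<close> nc_involD(3)[OF nc iV] nc_involD(3)[OF nc fV] by auto
    show 1: "\<not> (i < f \<and> f < \<mu> i)"
    proof
      assume "i < f \<and> f < \<mu> i"
      then have "\<mu> f < \<mu> i" using nc_involD(4)[OF nc iV fV] by simp
      then show False using min[of f] that flt \<open>i < f \<and> f < \<mu> i\<close> by auto
    qed
    show "\<not> (i < \<mu> f \<and> \<mu> f < \<mu> i)"
      using nc_involD(4)[OF nc iV nc_involD(1)[OF nc fV]] nc_involD(3)[OF nc fV] 1 by auto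
  qed
  have "2 * card ?L \<le> card ?Q"
  proof (rule Suc.hyps(1))
    show "m = card ?L" using Suc.hyps(2) i Suc.prems(1) by simp
    fix g assume g: "g \<in> ?L"
    have "g \<noteq> p" "\<mu> g \<noteq> p" "g \<noteq> q" "\<mu> g \<noteq> q" using f[OF g] p q by auto
    then show "g \<in> ?Q \<longleftrightarrow> \<mu> g \<notin> ?Q" using Suc.prems(6)[of g] g by auto
    have odd: "odd (card (Q \<inter> {g<..<\<mu> g}))" using Suc.prems(7) g by auto
    show "odd (card (?Q \<inter> {g<..<\<mu> g}))"
    \<comment> \<open>An arc around \<open>i\<close> has both \<open>p\<close> and \<open>q\<close>
      in its interior and loses two points of \<open>Q\<close>; any other arc loses none. Parity
      survives either way.\<close>
    proof (cases "g < i \<and> i < \<mu> g")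
      case True
      then have "g < \<mu> i" "\<mu> i < \<mu> g" using nc_involD(4)[OF nc f(1)[OF g] iV] by auto
      then have "p \<in> Q \<inter> {g<..<\<mu> g}" "q \<in> Q \<inter> {g<..<\<mu> g}" using True p q by auto
      moreover have "?Q \<inter> {g<..<\<mu> g} = Q \<inter> {g<..<\<mu> g} - {p, q}" by auto
      ultimately have "card (?Q \<inter> {g<..<\<mu> g}) = card (Q \<inter> {g<..<\<mu> g}) - 2"
        using pq Suc.prems(2) by (simp add: card_Diff_subset)
      moreover have "2 \<le> card (Q \<inter> {g<..<\<mu> g})"
        using card_mono[of "Q \<inter> {g<..<\<mu> g}" "{p, q}"] pq Suc.prems(2)
          \<open>p \<in> Q \<inter> {g<..<\<mu> g}\<close> \<open>q \<in> Q \<inter> {g<..<\<mu> g}\<close> by auto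
      ultimately show ?thesis using odd by simp
    next
      case False
      then have "i < g \<or> \<mu> g < i" using f[OF g] by auto
      then have "\<mu> i < g \<or> \<mu> g < i" using f[OF g] by auto
      then have "?Q \<inter> {g<..<\<mu> g} = Q \<inter> {g<..<\<mu> g}" using p q ilt by auto
      then show ?thesis using odd by simp
    qed
  qed (use Suc.prems in auto)
  moreover have "card ?Q = card Q - 2" using p(1) q(1) pq Suc.prems(2) by (simp add: card_Diff_subset)
  moreover have "2 \<le> card Q"
    using card_mono[of Q "{p, q}"] p(1) q(1) pq Suc.prems(2) by auto
  ultimately show ?case using i Suc.prems(1) by simp
qed

lemma even_card_involution:
  assumes "finite R" "\<And>x. x \<in> R \<Longrightarrow> \<mu> x \<in> R \<and> \<mu> x \<noteq> x \<and> \<mu> (\<mu> x) = x"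
  shows "even (card (R :: nat set))"
proof -
  let ?S = "{x \<in> R. x < \<mu> x}"
  have "R = ?S \<union> \<mu> ` ?S"
  proof
    show "R \<subseteq> ?S \<union> \<mu> ` ?S"
    proof
      fix x assume x: "x \<in> R"
      show "x \<in> ?S \<union> \<mu> ` ?S"
      proof (cases "x < \<mu> x")
        case False
        then have "\<mu> x \<in> ?S" "x = \<mu> (\<mu> x)" using assms(2)[OF x] by auto
        then show ?thesis by blast
      qed (use x in simp)
    qed
  qed (use assms(2) in auto)
  moreover have "?S \<inter> \<mu> ` ?S = {}"
  proof -
    have "\<not> \<mu> x < \<mu> (\<mu> x)" if "x \<in> ?S" for x using that assms(2)[of x] by auto
    then show ?thesis by auto
  qed
  moreover have "card (\<mu> ` ?S) = card ?S"
    by (rule card_image, rule inj_onI) (metis (no_types, lifting) assms(2) mem_Collect_eq)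
  ultimately have "card R = card ?S + card ?S"
    using assms(1) by (metis (no_types, lifting) card_Un_disjoint finite_Un)
  then show ?thesis by simp
qed

text \<open>Suppose every arc inside \<open>I\<close> with exactly one end in \<open>J\<close> has
  an odd count. Let \<open>L\<close> be the set of these arcs, and \<open>U\<close> and
  \<open>J2\<close> the points of \<open>I - J\<close> and of \<open>J\<close> whose partner is
  outside \<open>I\<close>. Then \<open>nested_arcs_bound\<close> gives
  \<open>2 * card L \<le> card Q = card L + card U\<close>, so \<open>card J = card L + card J2
  \<le> card U + card J2 \<le> 2 * n - card I = n - k\<close>, against the assumption
  \<open>r\<close>.\<close>

lemma exists_even_arc:
  assumes nc: "nc_invol {1..2 * n} \<mu>" and I: "I \<subseteq> {1..2 * n}" "card I = n + k" and J: "J \<subseteq> I"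
    and r: "n < card J + k" and hit: "\<And>i. i \<in> J \<Longrightarrow> \<mu> i \<notin> J"
  shows "\<exists>i\<in>I. i < \<mu> i \<and> \<mu> i \<in> I \<and> (i \<in> J \<longleftrightarrow> \<mu> i \<notin> J) \<and> even (card ((I - J) \<inter> {i<..<\<mu> i}))"
proof (rule ccontr)
  let ?V = "{1..2 * n}"
  assume neg: "\<not> ?thesis"
  have finI: "finite I" using I(1) finite_subset by blast
  then have finJ: "finite J" using J finite_subset by blast
  note inv = nc_involD[OF nc subsetD[OF I(1)]]
  define L where "L = {i \<in> I. i < \<mu> i \<and> \<mu> i \<in> I \<and> (i \<in> J \<or> \<mu> i \<in> J)}"
  define Q where "Q = {p \<in> I - J. \<mu> p \<notin> I - J}"
  define U where "U = {p \<in> I - J. \<mu> p \<notin> I}"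
  define J1 where "J1 = {p \<in> J. \<mu> p \<in> I}"
  define J2 where "J2 = {p \<in> J. \<mu> p \<notin> I}"
  have fin: "finite L" "finite Q" "finite U" "finite J1" "finite J2"
    using finI finJ by (auto simp: L_def Q_def U_def J1_def J2_def)
  have LJ1: "card L = card J1"
  proof (rule bij_betw_same_card, rule bij_betw_byWitness[where f = "\<lambda>i. if i \<in> J then i else \<mu> i" and f' = "\<lambda>p. min p (\<mu> p)"])
    show "\<forall>i\<in>L. min (if i \<in> J then i else \<mu> i) (\<mu> (if i \<in> J then i else \<mu> i)) = i"
      using inv(3) by (auto simp: L_def min_def)
    show "\<forall>p\<in>J1. (if min p (\<mu> p) \<in> J then min p (\<mu> p) else \<mu> (min p (\<mu> p))) = p"
      using hit inv(3) J by (auto simp: J1_def min_def)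
    show "(\<lambda>i. if i \<in> J then i else \<mu> i) ` L \<subseteq> J1" using inv(3) by (auto simp: L_def J1_def)
    show "(\<lambda>p. min p (\<mu> p)) ` J1 \<subseteq> L"
    proof clarify
      fix p assume "p \<in> J1"
      then have "p \<in> J" "p \<in> I" "\<mu> p \<in> I" using J by (auto simp: J1_def)
      then show "min p (\<mu> p) \<in> L" using inv(2,3)[of p] by (auto simp: L_def min_def)
    qed
  qed
  have "2 * card L \<le> card Q"
  proof (rule nested_arcs_bound[OF nc fin(1,2)])
    fix i assume i: "i \<in> L"
    then have iI: "i \<in> I" "\<mu> i \<in> I" "i < \<mu> i" "i \<in> J \<longleftrightarrow> \<mu> i \<notin> J"
      using hit[of i] hit[of "\<mu> i"] inv(3)[of i] by (auto simp: L_def)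
    then show "i \<in> Q \<longleftrightarrow> \<mu> i \<notin> Q" using inv(3)[of i] by (auto simp: Q_def)
    let ?O = "{i<..<\<mu> i}"
    let ?R = "{p \<in> I - J. \<mu> p \<in> I - J} \<inter> ?O"
    \<comment> \<open>\<open>nested_arcs_bound\<close> counts points of \<open>Q\<close> only. The
      remaining points of \<open>I - J\<close> under the arc are matched among themselves, within
      the same interval by non-crossing, and do not affect the parity.\<close>
    have "even (card ?R)"
    proof (rule even_card_involution[of _ \<mu>])
      fix p assume p: "p \<in> ?R"
      then show "\<mu> p \<in> ?R \<and> \<mu> p \<noteq> p \<and> \<mu> (\<mu> p) = p"
        using inv(2,3)[of p] inv(4)[OF iI(1), of p] I(1) by auto
    qed (use finI in auto)
    moreover have "(I - J) \<inter> ?O = (Q \<inter> ?O) \<union> ?R" "(Q \<inter> ?O) \<inter> ?R = {}" by (auto simp: Q_def)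
    then have "card ((I - J) \<inter> ?O) = card (Q \<inter> ?O) + card ?R"
      using fin(2) finI by (simp add: card_Un_disjoint)
    moreover have "odd (card ((I - J) \<inter> ?O))" using neg iI by blast
    ultimately show "odd (card (Q \<inter> ?O))" by simp
  qed (use I(1) in \<open>auto simp: L_def Q_def\<close>)
  moreover have "card Q = card L + card U"
  proof -
    have "card (\<mu> ` J1) = card J1"
      by (rule card_image, rule inj_onI) (metis (no_types, lifting) J J1_def inv(3) mem_Collect_eq subsetD)
    moreover have "Q = \<mu> ` J1 \<union> U"
    proof
      show "Q \<subseteq> \<mu> ` J1 \<union> U"
      proof
        fix p assume p: "p \<in> Q"
        show "p \<in> \<mu> ` J1 \<union> U"
        proof (cases "\<mu> p \<in> I")
          case True
          then have "\<mu> p \<in> J1" "p = \<mu> (\<mu> p)" using p inv(3)[of p] by (auto simp: Q_def J1_def)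
          then show ?thesis by blast
        qed (use p in \<open>auto simp: Q_def U_def\<close>)
      qed
      show "\<mu> ` J1 \<union> U \<subseteq> Q" using J hit inv(3) by (auto simp: Q_def J1_def U_def)
    qed
    moreover have "\<mu> ` J1 \<inter> U = {}" using J inv(3) by (auto simp: J1_def U_def)
    ultimately show ?thesis using fin LJ1 by (simp add: card_Un_disjoint)
  qed
  moreover have "card J = card L + card J2"
  proof -
    have "J = J1 \<union> J2" "J1 \<inter> J2 = {}" by (auto simp: J1_def J2_def)
    then show ?thesis using fin LJ1 by (metis card_Un_disjoint)
  qed
  moreover have "card U + card J2 \<le> 2 * n - card I"
  proof -
    have "card U + card J2 = card (U \<union> J2)"
      using fin by (subst card_Un_disjoint) (auto simp: U_def J2_def)
    also have "\<dots> = card (\<mu> ` (U \<union> J2))"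
      by (rule card_image[symmetric], rule inj_onI)
         (metis (no_types, lifting) DiffD1 J J2_def U_def Un_iff inv(3) mem_Collect_eq subsetD)
    also have "\<dots> \<le> card (?V - I)"
      using J inv(1) by (intro card_mono) (auto simp: U_def J2_def)
    also have "\<dots> = 2 * n - card I" using I(1) finI by (simp add: card_Diff_subset)
    finally show ?thesis .
  qed
  moreover have "card I \<le> 2 * n" using card_mono[OF _ I(1)] by simp
  ultimately show False using r I(2) by linarith
qed

text \<open>The sign with which the monomial of \<open>J\<close> occurs in the odd elementary
  polynomial of \<open>I\<close>.\<close>

definition position_sign :: "nat set \<Rightarrow> nat set \<Rightarrow> int" where
  "position_sign I J = (\<Prod>i\<in>J. (-1) ^ card {j \<in> I. j < i})"

lemma wedge_list_move:
  "wedge_list (l1 @ x # l2 @ l3) = (\<lambda>U. (-1) ^ length l2 * wedge_list (l1 @ l2 @ x # l3) U)"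
proof -
  have "wedge_list (x # l2 @ l3) = (\<lambda>U. (-1) ^ length l2 * wedge_list (l2 @ x # l3) U)"
  proof (induction l2)
    case (Cons y l2)
    have "wedge_list (x # (y # l2) @ l3) = (\<lambda>U. - (ext_gen y \<and>\<^sub>e wedge_list (x # l2 @ l3)) U)"
      using ext_gen_anticommute[of x y] by simp
    also have "\<dots> = (\<lambda>U. - ((-1) ^ length l2 * (ext_gen y \<and>\<^sub>e wedge_list (l2 @ x # l3)) U))"
      unfolding Cons.IH by (simp only: wedge_smult_right)
    finally show ?case by simp
  qed simp
  then show ?thesis
    by (simp only: wedge_list_append[of l1] wedge_smult_right)
qed

lemma sorted_list_of_set_eq:
  "sorted l \<Longrightarrow> distinct l \<Longrightarrow> set l = S \<Longrightarrow> sorted_list_of_set S = l"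
  using sorted_list_of_set.idem_if_sorted_distinct by blast

text \<open>Moving the factor from \<open>i\<close> to \<open>partner a i\<close> passes the
  elements of \<open>J\<close> in between, and the position of the moved variable in
  \<open>I\<close> grows by one plus the number of elements of \<open>I\<close> in between. Modulo 2
  the exponents add up to one plus the number of elements of \<open>I - J\<close> in between, which
  is odd by \<open>ev\<close>.\<close>

lemma flip_sign:
  assumes a: "a \<in> crossingless_matchings n" and I: "I \<subseteq> {1..2 * n}" and J: "J \<subseteq> I"
    and i: "i \<in> I" "i < partner a i" "partner a i \<in> I" "i \<in> J" "partner a i \<notin> J"
    and ev: "even (card ((I - J) \<inter> {i<..<partner a i}))"
  defines "J' \<equiv> insert (partner a i) (J - {i})"
  shows "position_sign I J' * circle_word a (sorted_list_of_set J') U =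
    - (position_sign I J * circle_word a (sorted_list_of_set J) U)"
proof -
  let ?j = "partner a i"
  have finI: "finite I" using I finite_subset by blast
  then have finJ: "finite J" using J finite_subset by blast
  let ?l1 = "sorted_list_of_set {x \<in> J. x < i}" and ?l2 = "sorted_list_of_set (J \<inter> {i<..<?j})"
    and ?l3 = "sorted_list_of_set {x \<in> J. ?j < x}"
  have sJ: "sorted_list_of_set J = ?l1 @ i # ?l2 @ ?l3"
  proof (rule sorted_list_of_set_eq)
    show "sorted (?l1 @ i # ?l2 @ ?l3)" using finJ i(2) by (auto simp: sorted_append)
    show "distinct (?l1 @ i # ?l2 @ ?l3)" using finJ i(2) by auto
    show "set (?l1 @ i # ?l2 @ ?l3) = J" using finJ i by (auto simp: not_less) (metis le_neq_implies_less)
  qed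
  have sJ': "sorted_list_of_set J' = ?l1 @ ?l2 @ ?j # ?l3"
  proof (rule sorted_list_of_set_eq)
    show "sorted (?l1 @ ?l2 @ ?j # ?l3)" using finJ i(2) by (auto simp: sorted_append)
    show "distinct (?l1 @ ?l2 @ ?j # ?l3)" using finJ i(2) by auto
    show "set (?l1 @ ?l2 @ ?j # ?l3) = J'" using finJ i by (auto simp: J'_def)
  qed
  have c: "circle_of a ?j = circle_of a i"
    using circle_of_cong[of i ?j a] cm_conn[OF a, of i] i(1) I by auto
  have w: "circle_word a (sorted_list_of_set J) U =
      (-1) ^ card (J \<inter> {i<..<?j}) * circle_word a (sorted_list_of_set J') U"
    unfolding sJ sJ' circle_word_def
    using fun_cong[OF wedge_list_move[of "map (circle_of a) ?l1" "circle_of a i" "map (circle_of a) ?l2"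
          "map (circle_of a) ?l3"], of U] by (simp add: c)
  let ?K = "J - {i}" and ?c = "\<lambda>p. card {q \<in> I. q < p}"
  have pJ: "position_sign I J = (-1) ^ ?c i * position_sign I ?K"
    unfolding position_sign_def using finJ i(4) by (subst prod.remove[of J i]) auto
  have pJ': "position_sign I J' = (-1) ^ ?c ?j * position_sign I ?K"
    unfolding position_sign_def J'_def using finJ i(5) by (subst prod.insert) auto
  have "{q \<in> I. q < ?j} = {q \<in> I. q < i} \<union> insert i (I \<inter> {i<..<?j})" using i(1,2) by auto
  then have "?c ?j = card ({q \<in> I. q < i} \<union> insert i (I \<inter> {i<..<?j}))" by (rule arg_cong)
  also have "\<dots> = ?c i + card (insert i (I \<inter> {i<..<?j}))"
    using finI by (intro card_Un_disjoint) auto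
  also have "card (insert i (I \<inter> {i<..<?j})) = Suc (card (I \<inter> {i<..<?j}))"
    using finI by (intro card_insert_disjoint) auto
  finally have "?c ?j = ?c i + Suc (card (I \<inter> {i<..<?j}))" .
  moreover have "I \<inter> {i<..<?j} = (J \<inter> {i<..<?j}) \<union> ((I - J) \<inter> {i<..<?j})" using J by auto
  then have "card (I \<inter> {i<..<?j}) = card ((J \<inter> {i<..<?j}) \<union> ((I - J) \<inter> {i<..<?j}))" by (rule arg_cong)
  then have "card (I \<inter> {i<..<?j}) = card (J \<inter> {i<..<?j}) + card ((I - J) \<inter> {i<..<?j})"
    using finI finJ by (subst (asm) card_Un_disjoint) auto
  ultimately have "(-1::int) ^ ?c ?j = - ((-1) ^ ?c i * (-1) ^ card (J \<inter> {i<..<?j}))"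
    using ev by (simp add: power_add)
  then show ?thesis unfolding w pJ pJ' by simp
qed

text \<open>Both ends of an arc lie on one circle, which then occurs twice in the wedge
  product.\<close>

lemma circle_word_arc_zero:
  assumes a: "a \<in> crossingless_matchings n" and J: "J \<subseteq> {1..2 * n}" and i: "i \<in> J" "partner a i \<in> J"
  shows "circle_word a (sorted_list_of_set J) = (\<lambda>U. 0)"
proof -
  have "i \<in> {1..2 * n}" "finite J" using J i finite_subset by auto
  then have "circle_of a (partner a i) = circle_of a i" "partner a i \<noteq> i"
    using circle_of_cong[of i "partner a i" a] cm_conn[OF a, of i] nc_involD(2)[OF cm_nc_invol[OF a]] by auto
  then have "\<not> inj_on (circle_of a) J" using i by (auto dest: inj_onD)
  then show ?thesis using \<open>finite J\<close>
    by (simp add: circle_word_def wedge_list_nondistinct distinct_map)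
qed

text \<open>Terms containing both ends of an arc are zero. The others cancel in pairs: moving an element of \<open>J\<close>
  to the other end of its arc \<open>{i, j}\<close> changes the sign by \<open>(-1)\<^sup>1\<^sup>+\<^sup>k\<close>, where \<open>k\<close> is the number of points of
  \<open>I - J\<close> strictly between \<open>i\<close> and \<open>j\<close>, and \<open>exists_even_arc\<close> provides an arc with \<open>k\<close> even.\<close>

lemma odd_elementary_vanishes:
  assumes a: "a \<in> crossingless_matchings n" and I: "I \<subseteq> {1..2 * n}" "card I = n + k" and r: "n < r + k"
  shows "(\<Sum>J | J \<subseteq> I \<and> card J = r. position_sign I J * circle_word a (sorted_list_of_set J) U) = 0"
proof -
  let ?\<mu> = "partner a" and ?t = "\<lambda>J. position_sign I J * circle_word a (sorted_list_of_set J) U"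
  note nc = cm_nc_invol[OF a]
  note inv = nc_involD[OF nc subsetD[OF I(1)]]
  have finI: "finite I" using I(1) finite_subset by blast
  define D where "D = {J. J \<subseteq> I \<and> card J = r \<and> (\<forall>i\<in>J. ?\<mu> i \<notin> J)}"
  define P where "P J i \<longleftrightarrow> i \<in> I \<and> i < ?\<mu> i \<and> ?\<mu> i \<in> I \<and> (i \<in> J \<longleftrightarrow> ?\<mu> i \<notin> J) \<and>
    even (card ((I - J) \<inter> {i<..<?\<mu> i}))" for J i
  define flip where "flip i J = (if i \<in> J then insert (?\<mu> i) (J - {i}) else insert i (J - {?\<mu> i}))" for i J
  \<comment> \<open>The arc chosen for \<open>J\<close> and for its flip must be the same, or
    \<open>\<phi>\<close> would not be an involution. \<open>P_flip\<close> shows that the whole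
    predicate \<open>P J\<close> is unchanged by a flip, hence so is the choice.\<close>
  define \<phi> where "\<phi> J = flip (SOME i. P J i) J" for J
  have P: "P J (SOME i. P J i)" if "J \<in> D" for J
    using exists_even_arc[OF nc I, of J] that r by (intro someI_ex[of "P J"]) (auto simp: D_def P_def)
  have flip_D: "flip i J \<in> D" if "J \<in> D" "P J i" for i J
  proof -
    have J: "J \<subseteq> I" "card J = r" "\<forall>v\<in>J. ?\<mu> v \<notin> J" using that(1) by (auto simp: D_def)
    have i: "i \<in> I" "?\<mu> i \<in> I" "?\<mu> i \<noteq> i" "?\<mu> (?\<mu> i) = i" "i \<in> J \<longleftrightarrow> ?\<mu> i \<notin> J"
      using that(2) inv(2,3)[of i] by (auto simp: P_def)
    have finJ: "finite J" using J(1) finI finite_subset by blast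
    have "card (flip i J) = card J"
      using i finJ card_gt_0_iff[of J] by (auto simp: flip_def card_insert_if card_Diff_singleton_if)
    moreover have "\<forall>v\<in>flip i J. ?\<mu> v \<notin> flip i J"
    proof
      fix v assume v: "v \<in> flip i J"
      then have "v \<in> I" using J i by (auto simp: flip_def split: if_splits)
      then have vv: "?\<mu> (?\<mu> v) = v" "?\<mu> v \<noteq> v" using inv(2,3) by auto
      show "?\<mu> v \<notin> flip i J"
      proof (cases "v = i \<or> v = ?\<mu> i")
        case True
        then show ?thesis using v i J vv by (auto simp: flip_def split: if_splits)
      next
        case False
        then have "v \<in> J" "?\<mu> v \<noteq> i" "?\<mu> v \<noteq> ?\<mu> i" using v vv i by (auto simp: flip_def split: if_splits)
        then show ?thesis using J(3) by (auto simp: flip_def)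
      qed
    qed
    ultimately show ?thesis using J i by (auto simp: D_def flip_def split: if_splits)
  qed
  have flip_flip: "flip i (flip i J) = J" if "P J i" for i J
    using that by (auto simp: flip_def P_def)
  have P_flip: "P (flip i J) f \<longleftrightarrow> P J f" if "P J i" for i J f
  proof (cases "f \<in> I \<and> f < ?\<mu> f \<and> ?\<mu> f \<in> I")
    case False
    then show ?thesis by (auto simp: P_def)
  next
    case f: True
    have i: "i \<in> I" "?\<mu> i \<in> I" "i < ?\<mu> i" "?\<mu> (?\<mu> i) = i" "i \<in> J \<longleftrightarrow> ?\<mu> i \<notin> J"
      using that inv(3)[of i] by (auto simp: P_def)
    have "?\<mu> (?\<mu> f) = f" using f inv(3) by auto
    show ?thesis
    proof (cases "f = i")
      case True
      have "(I - flip i J) \<inter> {i<..<?\<mu> i} = (I - J) \<inter> {i<..<?\<mu> i}" by (auto simp: flip_def)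
      then show ?thesis using True that i by (auto simp: P_def flip_def)
    next
      case False
      then have ne: "f \<noteq> ?\<mu> i" "?\<mu> f \<noteq> i" "?\<mu> f \<noteq> ?\<mu> i" using i f \<open>?\<mu> (?\<mu> f) = f\<close> by auto
      then have mem: "f \<in> flip i J \<longleftrightarrow> f \<in> J" "?\<mu> f \<in> flip i J \<longleftrightarrow> ?\<mu> f \<in> J"
        using False by (auto simp: flip_def)
      let ?O = "{f<..<?\<mu> f}"
      \<comment> \<open>Without crossings both ends of the flipped arc lie under \<open>f\<close> or
        neither does, so the flip at most exchanges one point of \<open>I - J\<close> there for
        another.\<close>
      have iff: "i \<in> ?O \<longleftrightarrow> ?\<mu> i \<in> ?O"
        using inv(4)[of f i] inv(4)[of f "?\<mu> i"] f i I(1) by auto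
      have "card ((I - flip i J) \<inter> ?O) = card ((I - J) \<inter> ?O)"
      proof (cases "i \<in> ?O")
        case True
        define M where "M = (I - J) \<inter> ?O - {i, ?\<mu> i}"
        have finM: "finite M" using finI by (simp add: M_def)
        have "(I - J) \<inter> ?O = insert (if i \<in> J then ?\<mu> i else i) M"
          "(I - flip i J) \<inter> ?O = insert (if i \<in> J then i else ?\<mu> i) M"
          using True iff i by (auto simp: M_def flip_def)
        moreover have "i \<notin> M" "?\<mu> i \<notin> M" by (auto simp: M_def)
        ultimately show ?thesis using finM by simp
      next
        case False
        then have "(I - flip i J) \<inter> ?O = (I - J) \<inter> ?O" using iff by (auto simp: flip_def)
        then show ?thesis by simp
      qed
      then show ?thesis using f mem by (simp add: P_def)
    qed
  qed
  have \<phi>: "\<phi> J \<in> D" "\<phi> (\<phi> J) = J" "?t (\<phi> J) = - ?t J" if J: "J \<in> D" for J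
  proof -
    define i where "i = (SOME i. P J i)"
    have Pi: "P J i" unfolding i_def by (rule P[OF J])
    have pJ: "\<phi> J = flip i J" by (simp add: \<phi>_def i_def)
    show "\<phi> J \<in> D" unfolding pJ by (rule flip_D[OF J Pi])
    have "P (flip i J) = P J" using P_flip[OF Pi] by (intro ext)
    then have "\<phi> (flip i J) = flip i (flip i J)" by (simp add: \<phi>_def i_def)
    then show "\<phi> (\<phi> J) = J" unfolding pJ using flip_flip[OF Pi] by simp
    have JI: "J \<subseteq> I" using J by (simp add: D_def)
    have i: "i \<in> I" "i < ?\<mu> i" "?\<mu> i \<in> I" "i \<in> J \<longleftrightarrow> ?\<mu> i \<notin> J" "even (card ((I - J) \<inter> {i<..<?\<mu> i}))"
      using Pi unfolding P_def by blast+
    show "?t (\<phi> J) = - ?t J"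
    proof (cases "i \<in> J")
      case True
      then show ?thesis
        using flip_sign[OF a I(1) JI i(1,2,3) True _ i(5), of U] i(4) by (simp add: pJ flip_def)
    next
      case False
      define J' where "J' = insert i (J - {?\<mu> i})"
      have pJ': "\<phi> J = J'" using False by (simp add: pJ flip_def J'_def)
      have sub: "J' \<subseteq> I" using JI i by (auto simp: J'_def)
      have mem: "i \<in> J'" "?\<mu> i \<notin> J'" using i by (auto simp: J'_def)
      have "(I - J') \<inter> {i<..<?\<mu> i} = (I - J) \<inter> {i<..<?\<mu> i}" by (auto simp: J'_def)
      then have ev: "even (card ((I - J') \<inter> {i<..<?\<mu> i}))" using i(5) by simp
      have "insert (?\<mu> i) (J' - {i}) = J" using i False by (auto simp: J'_def)
      then show ?thesis
        using flip_sign[OF a I(1) sub i(1,2,3) mem ev, of U] by (simp add: pJ')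
    qed
  qed
  have eq: "(\<Sum>J | J \<subseteq> I \<and> card J = r. ?t J) = (\<Sum>J\<in>D. ?t J)"
  proof (rule sum.mono_neutral_right)
    show "finite {J. J \<subseteq> I \<and> card J = r}" using finI by simp
    show "\<forall>J\<in>{J. J \<subseteq> I \<and> card J = r} - D. ?t J = 0"
    proof
      fix J assume "J \<in> {J. J \<subseteq> I \<and> card J = r} - D"
      then obtain i where "J \<subseteq> {1..2 * n}" "i \<in> J" "?\<mu> i \<in> J" using I(1) by (auto simp: D_def)
      then show "?t J = 0" using circle_word_arc_zero[OF a] by simp
    qed
  qed (auto simp: D_def)
  have "(\<Sum>J\<in>D. ?t J) = (\<Sum>J\<in>D. ?t (\<phi> J))"
    by (rule sum.reindex_bij_witness[of _ \<phi> \<phi>]) (use \<phi> in auto)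
  also have "\<dots> = - (\<Sum>J\<in>D. ?t J)" using \<phi>(3) by (simp add: sum_negf)
  finally show ?thesis using eq by simp
qed


subsection \<open>Closed markings\<close>

text \<open>A basis monomial of the exterior algebra of \<open>W(a)a\<close> is a set of marked arcs of \<open>a\<close>, given by
  their left ends. The marking is closed if no unmarked arc lies below a marked one.\<close>

definition closed_marking :: "matching \<Rightarrow> nat set \<Rightarrow> bool" where
  "closed_marking a A \<longleftrightarrow> A \<subseteq> circles a a \<and>
     (\<forall>i\<in>A. \<forall>v. i < v \<and> v < partner a i \<longrightarrow> v \<in> A \<or> partner a v \<in> A)"

text \<open>Only one monomial can contribute to the coefficient at \<open>U\<close>, so this
  coefficient is \<open>f A\<close> times a non-zero factor; coefficients of a family are compared
  through their images in this way.\<close>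

lemma ext_map_unique_preimage:
  assumes f: "f \<in> ext_carrier S" "finite S"
    and A: "A \<subseteq> S" "inj_on h A" "h ` A = U"
    and other: "\<And>B. B \<subseteq> S \<Longrightarrow> inj_on h B \<Longrightarrow> h ` B = U \<Longrightarrow> B \<noteq> A \<Longrightarrow> f B = 0"
  shows "ext_map h f U = f A * wedge_list (map h (sorted_list_of_set A)) U"
    and "wedge_list (map h (sorted_list_of_set A)) U \<noteq> 0"
proof -
  have zero: "f B * wedge_list (map h (sorted_list_of_set B)) U = 0" if "B \<subseteq> S" "B \<noteq> A" for B
  proof (rule ccontr)
    assume nz: "f B * wedge_list (map h (sorted_list_of_set B)) U \<noteq> 0"
    have "finite B" using that f(2) finite_subset by blast
    then have "inj_on h B" "h ` B = U"
      using nz wedge_list_nonzeroD[of "map h (sorted_list_of_set B)" U] by (auto simp: distinct_map)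
    then show False using other that nz by auto
  qed
  have "ext_map h f U = (\<Sum>B\<in>Pow S. f B * wedge_list (map h (sorted_list_of_set B)) U)"
    using f by (intro ext_map_eq_sum) (auto simp: ext_carrier_def)
  also have "\<dots> = (\<Sum>B\<in>{A}. f B * wedge_list (map h (sorted_list_of_set B)) U)"
    using zero A(1) f(2) by (intro sum.mono_neutral_right) auto
  finally show "ext_map h f U = f A * wedge_list (map h (sorted_list_of_set A)) U" by simp
  have "finite A" using A(1) f(2) finite_subset by blast
  then have "distinct (map h (sorted_list_of_set A))" "set (map h (sorted_list_of_set A)) = U"
    using A by (auto simp: distinct_map)
  then show "wedge_list (map h (sorted_list_of_set A)) U \<noteq> 0"
    using wedge_list_set by fastforce
qed

lemma circles_selfD:
  assumes "a \<in> crossingless_matchings n" "s \<in> circles a a"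
  shows "s \<in> {1..2 * n}" "s < partner a s"
  using circles_self[OF assms(1)] assms(2) by auto

text \<open>An arc common to both matchings meets no other edge, so it is a circle of
  \<open>W(b)a\<close> by itself.\<close>

lemma circle_of_common_arc:
  assumes cm: "b \<in> crossingless_matchings n" "a \<in> crossingless_matchings n"
    and v: "v \<in> {1..2 * n}" "partner b v = partner a v"
  shows "(v, w) \<in> conn (b \<union> a) \<longleftrightarrow> w = v \<or> w = partner a v"
proof
  assume "(v, w) \<in> conn (b \<union> a)"
  then have "w \<in> {v, partner a v}"
  proof (rule conn_closed)
    fix e x y assume e: "e \<in> b \<union> a" "x \<in> e" "y \<in> e" "x \<in> {v, partner a v}"
    have "{v, partner a v} \<in> a" "{v, partner a v} \<in> b"
      using cm_partner[OF cm(2) v(1)] cm_partner[OF cm(1) v(1)] v(2) by auto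
    then have "e = {v, partner a v}"
      using cm_disjoint[OF cm(1), of e "{v, partner a v}" x] cm_disjoint[OF cm(2), of e "{v, partner a v}" x] e by blast
    then show "y \<in> {v, partner a v}" using e by simp
  qed simp
  then show "w = v \<or> w = partner a v" by simp
next
  assume "w = v \<or> w = partner a v"
  then show "(v, w) \<in> conn (b \<union> a)"
    using conn_edge[of "{v, partner a v}" "b \<union> a" v w] cm_partner[OF cm(2) v(1)] by auto
qed

text \<open>The marked arcs are circles of \<open>W(b)a\<close> on their own, so \<open>A\<close> is
  the only preimage of \<open>A\<close> from either side, and both coefficients are multiplied by
  the same non-zero \<open>?w\<close>.\<close>

lemma families_common_marking:
  assumes z: "z \<in> families n" and cm: "b \<in> crossingless_matchings n" "a \<in> crossingless_matchings n"
    and A: "A \<subseteq> circles a a" and eq: "\<And>p. p \<in> A \<Longrightarrow> partner b p = partner a p"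
  shows "z b b A = z a a A"
proof -
  let ?h = "circle_of (b \<union> a)"
  have con: "(p, w) \<in> conn (b \<union> a) \<longleftrightarrow> w = p \<or> w = partner a p" if "p \<in> A" for p w
    using circle_of_common_arc[OF cm _ eq[OF that]] circles_selfD(1)[OF cm(2)] A that by blast
  have AB: "A \<subseteq> circles b b"
    using A eq by (auto simp: circles_self[OF cm(1)] circles_self[OF cm(2)])
  have hA: "?h p = p" if "p \<in> A" for p
    unfolding circle_of_alt con[OF that]
    by (rule Least_equality) (use circles_selfD(2)[OF cm(2) subsetD[OF A that]] in auto)
  have pre: "s = p" if "?h s = p" "p \<in> A" "s \<in> circles d d" "d = a \<or> d = b" for s p d
  proof -
    have "(p, s) \<in> conn (b \<union> a)" using circle_of_conn[of s "b \<union> a"] that(1) conn_sym by blast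
    then have "s = p \<or> s = partner a p" using con[OF that(2)] by simp
    moreover have "s \<noteq> partner a p"
    proof
      assume s: "s = partner a p"
      have p: "p \<in> {1..2 * n}" "p < partner a p" using circles_selfD[OF cm(2)] A that(2) by auto
      have "partner a s = p" "partner b s = p"
        using s p eq[OF that(2)] nc_involD(3)[OF cm_nc_invol[OF cm(2)] p(1)]
          nc_involD(3)[OF cm_nc_invol[OF cm(1)] p(1)] by auto
      then show False using that(3,4) p s circles_selfD(2) cm by fastforce
    qed
    ultimately show ?thesis by simp
  qed
  have imA: "?h ` A = A" and injA: "inj_on ?h A" using hA by (auto simp: inj_on_def)
  have uniq: "B = A" if B: "B \<subseteq> circles d d" "?h ` B = A" "d = a \<or> d = b" for B d
  proof
    show "B \<subseteq> A"
    proof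
      fix s assume "s \<in> B"
      then show "s \<in> A" using pre[OF refl, of s d] B by auto
    qed
    show "A \<subseteq> B"
    proof
      fix p assume "p \<in> A"
      then obtain s where s: "s \<in> B" "?h s = p" using B(2) by auto
      then have "s = p" using pre[of s p d] B \<open>p \<in> A\<close> by blast
      then show "p \<in> B" using s by simp
    qed
  qed
  let ?w = "wedge_list (map ?h (sorted_list_of_set A)) A"
  have "ext_map ?h (z a a) A = z a a A * ?w" and nz: "?w \<noteq> 0"
    using ext_map_unique_preimage[OF familiesD(2)[OF z cm(2)] finite_circles[OF cm(2,2)] A injA imA] uniq by blast+
  moreover have "ext_map ?h (z b b) A = z b b A * ?w"
    using ext_map_unique_preimage(1)[OF familiesD(2)[OF z cm(1)] finite_circles[OF cm(1,1)] AB injA imA] uniq by blast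
  ultimately have "z b b A * ?w = z a a A * ?w" using familiesD(3)[OF z cm] by simp
  then show ?thesis using nz by simp
qed

section \<open>Coefficients at closed markings determine a family\<close>

lemma nc_invol_surgery:
  assumes nc: "nc_invol V \<mu>" and V: "i \<in> V" "j \<in> V" and ij: "i < j" "j < \<mu> j" "\<mu> j < \<mu> i"
    and between: "\<And>u. u \<in> V \<Longrightarrow> i < u \<Longrightarrow> u < j \<Longrightarrow> \<mu> u < j"
  shows "nc_invol V (\<mu>(i := j, j := i, \<mu> j := \<mu> i, \<mu> i := \<mu> j))"
proof -
  define k l where "k = \<mu> j" and "l = \<mu> i"
  have kl: "k \<in> V" "l \<in> V" "\<mu> k = j" "\<mu> l = i" "\<mu> i = l" "\<mu> j = k"
    using nc_involD(1,3)[OF nc V(1)] nc_involD(1,3)[OF nc V(2)] by (auto simp: k_def l_def)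
  have lt: "i < j" "j < k" "k < l" using ij by (simp_all add: k_def l_def)
  define X where "X = {i, j, k, l}"
  define \<nu> where "\<nu> = \<mu>(i := j, j := i, k := l, l := k)"
  have nu: "\<nu> i = j" "\<nu> j = i" "\<nu> k = l" "\<nu> l = k" "\<And>x. x \<notin> X \<Longrightarrow> \<nu> x = \<mu> x"
    using lt by (auto simp: X_def \<nu>_def)
  have muX: "\<mu> x \<notin> X" if "x \<in> V" "x \<notin> X" for x
    using that nc_involD(3)[OF nc that(1)] kl by (auto simp: X_def)
  have mem: "\<mu> x \<in> V" "\<mu> x \<noteq> x" "\<mu> (\<mu> x) = x" if "x \<in> V" for x using nc_involD[OF nc that] by auto
  have N: "u < \<mu> v \<and> \<mu> v < \<mu> u" if "u \<in> V" "v \<in> V" "u < v" "v < \<mu> u" for u v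
    using nc_involD(4)[OF nc that(1,2)] that by simp
  have inner: "i < \<mu> x \<and> \<mu> x < l" if "x \<in> V" "i < x" "x < l" for x
    using N[OF V(1) that(1)] that kl by simp
  \<comment> \<open>The points \<open>i < j < k < l\<close> cut the line into regions, the part
    outside of \<open>[i, l]\<close> counting as one. By \<open>between\<close> and the old arcs,
    every other point has its partner in its own region, so the new arcs \<open>{i, j}\<close> and
    \<open>{k, l}\<close> cross nothing.\<close>
  have r1: "i < \<mu> x \<and> \<mu> x < j" if "x \<in> V" "i < x" "x < j" for x
    using inner[of x] between[of x] that lt by auto
  have r2: "j < \<mu> x \<and> \<mu> x < k" if "x \<in> V" "j < x" "x < k" for x
    using N[OF V(2) that(1)] that kl by simp
  have r3: "k < \<mu> x \<and> \<mu> x < l" if "x \<in> V" "k < x" "x < l" for x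
  proof -
    have "x \<notin> X" using that lt by (auto simp: X_def)
    then have "\<mu> x \<notin> X" using muX that by simp
    moreover have "\<not> (i < \<mu> x \<and> \<mu> x < j)" using r1[of "\<mu> x"] mem[OF that(1)] that lt by auto
    moreover have "\<not> (j < \<mu> x \<and> \<mu> x < k)" using r2[of "\<mu> x"] mem[OF that(1)] that lt by auto
    ultimately show ?thesis using inner[of x] that lt by (auto simp: X_def)
  qed
  have r4: "\<mu> x < i \<or> l < \<mu> x" if "x \<in> V" "x < i \<or> l < x" for x
  proof -
    have "x \<notin> X" using that lt by (auto simp: X_def)
    then have "\<mu> x \<notin> X" using muX that by simp
    moreover have "\<not> (i < \<mu> x \<and> \<mu> x < l)" using inner[of "\<mu> x"] mem[OF that(1)] that by auto
    ultimately show ?thesis by (auto simp: X_def)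
  qed
  have cases: "x \<in> X \<or> x < i \<or> l < x \<or> (i < x \<and> x < j) \<or> (j < x \<and> x < k) \<or> (k < x \<and> x < l)" for x
    by (auto simp: X_def)
  have "\<nu> v \<in> V \<and> \<nu> v \<noteq> v \<and> \<nu> (\<nu> v) = v" if v: "v \<in> V" for v
  proof (cases "v \<in> X")
    case True
    then consider "v = i" | "v = j" | "v = k" | "v = l" by (auto simp: X_def)
    then show ?thesis using nu(1-4) kl(1,2) V lt by cases simp_all
  next
    case False
    then show ?thesis using nu(5)[of v] nu(5)[of "\<mu> v"] muX[OF v] mem[OF v] by simp
  qed
  moreover have "u < \<nu> v \<and> \<nu> v < \<nu> u" if uv: "u \<in> V" "v \<in> V" "u < v" "v < \<nu> u" for u v
  proof (cases "u \<in> X")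
    case True
    then have "u = i \<or> u = j \<or> u = k \<or> u = l" by (auto simp: X_def)
    then consider "u = i" | "u = k" using uv nu(2,4) lt by fastforce
    then show ?thesis
    proof cases
      case 1
      then have "i < v" "v < j" using uv nu(1) by auto
      then have "v \<notin> X" using lt by (auto simp: X_def)
      then show ?thesis using 1 r1[OF uv(2)] nu(1) nu(5)[of v] \<open>i < v\<close> \<open>v < j\<close> by simp
    next
      case 2
      then have "k < v" "v < l" using uv nu(3) by auto
      then have "v \<notin> X" using lt by (auto simp: X_def)
      then show ?thesis using 2 r3[OF uv(2)] nu(3) nu(5)[of v] \<open>k < v\<close> \<open>v < l\<close> by simp
    qed
  next
    case False
    then have nu_u: "\<nu> u = \<mu> u" by (rule nu(5))
    then have v: "u < \<mu> v" "\<mu> v < \<mu> u" using N[OF uv(1,2,3)] uv(4) by auto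
    show ?thesis
    proof (cases "v \<in> X")
      case False
      then show ?thesis using v nu(5)[OF False] nu_u by simp
    next
      case True
      have "u < i \<and> l < \<mu> u"
      proof -
        have v4: "v = i \<or> v = j \<or> v = k \<or> v = l" using True by (auto simp: X_def)
        have uv': "u < v" "v < \<mu> u" using uv(3,4) nu_u by simp_all
        have "u < l" using v4 uv' lt by linarith
        moreover have "i < \<mu> u" using v4 uv' lt by linarith
        moreover have "\<not> (i < u \<and> u < j)" "\<not> (j < u \<and> u < k)" "\<not> (k < u \<and> u < l)"
          using r1[OF uv(1)] r2[OF uv(1)] r3[OF uv(1)] v4 uv' lt by linarith+
        ultimately have "u < i" using cases[of u] False by auto
        then show ?thesis using r4[OF uv(1)] \<open>i < \<mu> u\<close> by auto
      qed
      moreover have "v = i \<or> v = j \<or> v = k \<or> v = l" using True by (auto simp: X_def)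
      ultimately show ?thesis using nu(1-4) nu_u lt by (elim disjE) simp_all
    qed
  qed
  ultimately have "nc_invol V \<nu>" by (simp only: nc_invol_def) blast
  then show ?thesis by (simp only: \<nu>_def k_def l_def)
qed

text \<open>If the unmarked arc \<open>{j, k}\<close> lies directly below the marked arc \<open>{i, l}\<close>, comparison with the
  matching containing \<open>{i, j}\<close> and \<open>{k, l}\<close> instead expresses the coefficient at the marking by those where
  \<open>{i, l}\<close> is replaced by \<open>{j, k}\<close>, \<open>{i, j}\<close> or \<open>{k, l}\<close>; the total length of the marked arcs drops.\<close>

lemma marking_determined:
  assumes z: "z \<in> families n"
    and closed: "\<And>a A. a \<in> crossingless_matchings n \<Longrightarrow> closed_marking a A \<Longrightarrow> z a a A = 0"
    and a: "a \<in> crossingless_matchings n"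
  shows "z a a A = 0"
  using a
proof (induction "\<Sum>p\<in>A. partner a p - p" arbitrary: a A rule: less_induct)
  case less
  let ?\<mu> = "partner a" and ?V = "{1..2 * n}"
  note a = less.prems
  note nc = cm_nc_invol[OF a]
  note inv = nc_involD[OF nc]
  note cself = circles_self[OF a]
  show ?case
  proof (cases "A \<subseteq> circles a a \<and> \<not> closed_marking a A")
    case False
    then show ?thesis using closed[OF a] familiesD(2)[OF z a] by (auto simp: ext_carrier_def)
  next
    case True
    then have A: "A \<subseteq> circles a a" and ncl: "\<not> closed_marking a A" by auto
    have finA: "finite A" using A finite_circles[OF a a] finite_subset by blast
    define Bad where "Bad = {(i, j). i \<in> A \<and> j \<in> circles a a \<and> j \<notin> A \<and> i < j \<and> j < ?\<mu> i}"
    have "Bad \<noteq> {}"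
    proof -
      obtain i v where iv: "i \<in> A" "i < v" "v < ?\<mu> i" "v \<notin> A" "?\<mu> v \<notin> A"
        using ncl A by (auto simp: closed_marking_def)
      have iV: "i \<in> ?V" using A iv circles_selfD(1)[OF a] by auto
      have vV: "v \<in> ?V" using iv iV inv(1)[OF iV] by auto
      have "i < ?\<mu> v" "?\<mu> v < ?\<mu> i" using inv(4)[OF iV vV] iv by auto
      then have "(i, min v (?\<mu> v)) \<in> Bad"
        using iv inv(1-3)[OF vV] vV by (auto simp: Bad_def cself min_def)
      then show ?thesis by blast
    qed
    \<comment> \<open>The difference of the lengths of the marked and the unmarked arc. A pair
      minimizing it has no arc of \<open>a\<close> nested between the two, which yields the
      condition \<open>between\<close> of \<open>nc_invol_surgery\<close>.\<close>
    define g where "g p = (?\<mu> (fst p) - fst p) - (?\<mu> (snd p) - snd p)" for p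
    obtain p where pBad: "p \<in> Bad" and gmin: "\<And>q. q \<in> Bad \<Longrightarrow> g p \<le> g q"
      using \<open>Bad \<noteq> {}\<close> arg_min_natI[of "\<lambda>p. p \<in> Bad" _ g] arg_min_nat_le[of "\<lambda>p. p \<in> Bad" _ g]
      by (metis ex_in_conv)
    obtain i j where p: "p = (i, j)" by force
    define k l where "k = ?\<mu> j" and "l = ?\<mu> i"
    have i: "i \<in> A" "i \<in> circles a a" "i \<in> ?V" and j: "j \<in> circles a a" "j \<notin> A" "j \<in> ?V"
      and ij: "i < j" "j < l" "j < k"
      using pBad A circles_selfD[OF a] unfolding p Bad_def k_def l_def by auto
    have kl: "k \<in> ?V" "l \<in> ?V" "?\<mu> k = j" "?\<mu> l = i"
      using inv(1,3)[OF i(3)] inv(1,3)[OF j(3)] by (auto simp: k_def l_def)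
    have lt: "i < j" "j < k" "k < l" using inv(4)[OF i(3) j(3)] ij by (auto simp: k_def l_def)
    have between: "?\<mu> u < j" if u: "u \<in> ?V" "i < u" "u < j" for u
    proof (rule ccontr)
      assume "\<not> ?\<mu> u < j"
      moreover have "?\<mu> u \<noteq> j" using inv(3)[OF u(1)] u lt k_def by auto
      ultimately have ju: "j < ?\<mu> u" by simp
      then have ku: "k < ?\<mu> u" using inv(4)[OF u(1) j(3)] u by (simp add: k_def)
      have ul: "?\<mu> u < l" using inv(4)[OF i(3) u(1)] u lt by (simp add: l_def)
      have uc: "u \<in> circles a a" using u ju by (simp add: cself)
      show False
      \<comment> \<open>An arc nested between the two forms a bad pair with the inner arc if it is
        marked and with the outer arc if it is not, in either case with a smaller
        difference.\<close>
      proof (cases "u \<in> A")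
        case True
        then have "(u, j) \<in> Bad" using j ju u by (simp add: Bad_def)
        then have "g p \<le> g (u, j)" by (rule gmin)
        then show False using u lt ku ul by (simp add: g_def p flip: k_def l_def)
      next
        case False
        then have "(i, u) \<in> Bad" using i uc u lt by (simp add: Bad_def flip: l_def)
        then have "g p \<le> g (i, u)" by (rule gmin)
        then show False using u lt ku ul by (simp add: g_def p flip: k_def l_def)
      qed
    qed
    define \<nu> where "\<nu> = ?\<mu>(i := j, j := i, k := l, l := k)"
    have nuinv: "nc_invol ?V \<nu>"
      unfolding \<nu>_def k_def l_def
      by (rule nc_invol_surgery[OF nc i(3) j(3)]) (use lt between in \<open>auto simp: k_def l_def\<close>)
    define b where "b = matching_of ?V \<nu>"
    have b: "b \<in> crossingless_matchings n" unfolding b_def by (rule matching_of_cm[OF nuinv])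
    have pb: "partner b v = \<nu> v" if "v \<in> ?V" for v
      unfolding b_def by (rule partner_matching_of[OF nuinv that])
    define X where "X = {i, j, k, l}"
    have nu: "\<nu> i = j" "\<nu> j = i" "\<nu> k = l" "\<nu> l = k" "\<And>x. x \<notin> X \<Longrightarrow> \<nu> x = ?\<mu> x"
      using lt by (auto simp: X_def \<nu>_def)
    have muX: "?\<mu> x \<in> X" if "x \<in> X" for x using that kl by (auto simp: X_def k_def l_def)
    have nuX: "\<nu> x \<in> X" if "x \<in> X" for x
    proof -
      have "x = i \<or> x = j \<or> x = k \<or> x = l" using that by (auto simp: X_def)
      then show ?thesis using nu(1-4) by (auto simp: X_def)
    qed
    have XV: "X \<subseteq> ?V" using i j kl by (auto simp: X_def)
    let ?h = "circle_of (b \<union> a)"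
    \<comment> \<open>The four points lie on one circle of \<open>W(b)a\<close> with least vertex
      \<open>i\<close>; the other marked arcs are common to \<open>a\<close> and \<open>b\<close>
      and keep their names (\<open>hout\<close>).\<close>
    have hX: "?h x = i" if x: "x \<in> X" for x
    proof -
      have e: "{i, l} \<in> a" "{j, k} \<in> a" "{i, j} \<in> b"
        using cm_partner[OF a i(3)] cm_partner[OF a j(3)] cm_partner[OF b i(3)] pb[OF i(3)] nu
        by (simp_all add: k_def l_def)
      have "(l, i) \<in> conn (b \<union> a)" "(j, i) \<in> conn (b \<union> a)" "(k, j) \<in> conn (b \<union> a)"
        using e by (auto intro: conn_edge)
      then have "(y, i) \<in> conn (b \<union> a)" if "y \<in> X" for y
        using that conn_trans by (auto simp: X_def)
      moreover have XI: "w \<in> X" if "(i, w) \<in> conn (b \<union> a)" for w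
      proof (rule conn_closed[OF that])
        fix e y y' assume e: "e \<in> b \<union> a" "y \<in> e" "y' \<in> e" "y \<in> X"
        have "e = {y, partner b y} \<or> e = {y, ?\<mu> y}" using e cm_arc[OF b] cm_arc[OF a] by blast
        moreover have "partner b y \<in> X" using nuX[OF e(4)] pb[of y] XV e(4) by auto
        ultimately show "y' \<in> X" using e(3,4) muX[OF e(4)] by auto
      qed (simp add: X_def)
      moreover have "i \<le> w" if "w \<in> X" for w using that lt by (auto simp: X_def)
      then have "?h i = i"
        unfolding circle_of_alt using XI by (intro Least_equality) auto
      ultimately show ?thesis using circle_of_cong[of x i "b \<union> a"] x by simp
    qed
    have hout: "?h x = x" if x: "x \<in> ?V" "x \<notin> X" "x < ?\<mu> x" for x
    proof -
      have "partner b x = ?\<mu> x" using pb nu(5) x by simp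
      then show ?thesis unfolding circle_of_alt circle_of_common_arc[OF b a x(1) \<open>partner b x = ?\<mu> x\<close>]
        by (intro Least_equality) (use x in auto)
    qed
    define S where "S = A - {i}"
    have Sout: "x \<in> ?V \<and> x \<notin> X \<and> x < ?\<mu> x" if "x \<in> S" for x
    proof -
      have "x \<in> ?V" "x < ?\<mu> x" "x \<noteq> i" "x \<noteq> j" using that A circles_selfD[OF a] j by (auto simp: S_def)
      then show ?thesis using kl lt by (auto simp: X_def)
    qed
    have hS: "?h x = x" if "x \<in> S" for x using hout Sout[OF that] by simp
    have AS: "A = insert i S" and iS: "i \<notin> S" using i by (auto simp: S_def)
    have finS: "finite S" using finA by (simp add: S_def)
    have sumA: "(\<Sum>p\<in>A. ?\<mu> p - p) = (l - i) + (\<Sum>p\<in>S. ?\<mu> p - p)"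
      unfolding AS using finS iS by (simp add: l_def)
    have notS: "j \<notin> S" "k \<notin> S" using Sout by (auto simp: X_def)
    have zaj: "z a a (insert j S) = 0"
    proof (rule less.hyps[OF _ a])
      show "(\<Sum>p\<in>insert j S. ?\<mu> p - p) < (\<Sum>p\<in>A. ?\<mu> p - p)"
        using finS notS lt by (simp add: sumA flip: k_def)
    qed
    have sumb: "(\<Sum>p\<in>S. partner b p - p) = (\<Sum>p\<in>S. ?\<mu> p - p)"
      using Sout pb nu(5) by (intro sum.cong) auto
    have zb: "z b b (insert x S) = 0" if "x = i \<or> x = k" for x
    proof (rule less.hyps[OF _ b])
      have "partner b x - x < l - i" using that pb[OF i(3)] pb[OF kl(1)] nu(1,3) lt by (elim disjE) simp_all
      moreover have "x \<notin> S" using that iS notS by auto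
      ultimately show "(\<Sum>p\<in>insert x S. partner b p - p) < (\<Sum>p\<in>A. ?\<mu> p - p)"
        using finS by (simp add: sumA sumb)
    qed
    \<comment> \<open>Injectivity allows exactly one element of a preimage of \<open>A\<close> on
      the circle through \<open>X\<close>, and outside of \<open>X\<close> the preimage must agree
      with \<open>S\<close>. So only the left ends of arcs on \<open>X\<close> remain to be
      tried.\<close>
    have pre: "\<exists>x\<in>Y. B = insert x S" if B: "B \<subseteq> circles d d" "inj_on ?h B" "?h ` B = A"
      and Y: "circles d d \<inter> X \<subseteq> Y" and d: "d = a \<or> d = b" for B d Y
    proof -
      have dout: "?h x = x" if "x \<in> circles d d" "x \<notin> X" for x
      proof -
        have "x \<in> ?V" "x < partner d x" using that(1) d circles_selfD a b by blast+
        moreover have "partner d x = ?\<mu> x" using d pb[OF \<open>x \<in> ?V\<close>] nu(5)[OF that(2)] by auto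
        ultimately show ?thesis using hout that(2) by simp
      qed
      obtain x where x: "x \<in> B" "?h x = i" using B(3) i(1) by (metis imageE)
      have "i \<in> X" by (simp add: X_def)
      have xX: "x \<in> X" using x dout[of x] B(1) \<open>i \<in> X\<close> by (metis subsetD)
      have BX: "y = x" if "y \<in> B" "y \<in> X" for y
        using B(2) x hX[OF that(2)] that(1) by (metis inj_onD)
      have "B - {x} = S"
      proof
        show "B - {x} \<subseteq> S"
        proof
          fix y assume y: "y \<in> B - {x}"
          then have "y \<notin> X" using BX by auto
          then have "?h y = y" using dout y B(1) by auto
          then have "y \<in> A" "y \<noteq> i" using y B(3) \<open>y \<notin> X\<close> \<open>i \<in> X\<close> by (metis DiffD1 imageI, auto)
          then show "y \<in> S" by (simp add: S_def)
        qed
        show "S \<subseteq> B - {x}"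
        proof
          fix y assume y: "y \<in> S"
          then obtain y' where y': "y' \<in> B" "?h y' = y" using B(3) AS by (metis imageE insertI2)
          have "y' \<notin> X" using hX[of y'] y' y iS by auto
          then have "y' = y" using dout[of y'] y' B(1) by auto
          then show "y \<in> B - {x}" using y' xX \<open>y' \<notin> X\<close> by auto
        qed
      qed
      then have "B = insert x S" using x by auto
      moreover have "x \<in> Y" using x xX B(1) Y by auto
      ultimately show ?thesis by blast
    qed
    have ca: "circles a a \<inter> X \<subseteq> {i, j}" using kl lt by (auto simp: cself X_def)
    have cb: "circles b b \<inter> X \<subseteq> {i, k}"
      using pb XV nu lt by (auto simp: circles_self[OF b] X_def)
    have hA: "?h ` A = A" "inj_on ?h A"
      using hX[of i] hS by (auto simp: AS X_def inj_on_def)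
    have "ext_map ?h (z b b) A = 0"
    proof (rule ccontr)
      assume "ext_map ?h (z b b) A \<noteq> 0"
      then obtain B where B: "z b b B \<noteq> 0" "inj_on ?h B" "A = ?h ` B"
        using familiesD(4)[OF z] by (rule ext_map_nonzeroD)
      have "B \<subseteq> circles b b" using B(1) familiesD(2)[OF z b] by (auto simp: ext_carrier_def)
      then obtain x where "x \<in> {i, k}" "B = insert x S" using pre[OF _ B(2) B(3)[symmetric] cb] by auto
      then show False using zb B(1) by auto
    qed
    then have 0: "ext_map ?h (z a a) A = 0" using familiesD(3)[OF z b a] by simp
    have other: "z a a B = 0" if "B \<subseteq> circles a a" "inj_on ?h B" "?h ` B = A" "B \<noteq> A" for B
      using pre[OF that(1,2,3) ca] that(4) zaj AS by auto
    note uniq = ext_map_unique_preimage[OF familiesD(2)[OF z a] finite_circles[OF a a] A hA(2) hA(1) other]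
    have "z a a A * wedge_list (map ?h (sorted_list_of_set A)) A = 0"
      by (rule trans[OF uniq(1)[symmetric] 0])
    then show ?thesis using uniq(2) by (simp only: mult_eq_0_iff simp_thms)
  qed
qed

section \<open>Right ends of closed markings and triangularity\<close>

lemma closed_marking_unique:
  assumes cm: "a \<in> crossingless_matchings n" "b \<in> crossingless_matchings n"
    and cl: "closed_marking a A" "closed_marking b B" and eq: "partner a ` A = partner b ` B"
  shows "A = B" "\<And>p. p \<in> A \<Longrightarrow> partner b p = partner a p"
proof -
  let ?V = "{1..2 * n}"
  define J where "J = partner a ` A"
  have arcs: "v \<in> ?V" "partner d v \<in> D" "partner d v < v" "v \<notin> D"
    if h: "v \<in> J" "d \<in> crossingless_matchings n" "closed_marking d D" "J = partner d ` D" for v d D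
  proof -
    obtain p where p: "p \<in> D" "v = partner d p" using h by auto
    then have pV: "p \<in> ?V" "p < partner d p" using h circles_selfD unfolding closed_marking_def by blast+
    note inv = nc_involD[OF cm_nc_invol[OF h(2)] pV(1)]
    show "v \<in> ?V" "partner d v \<in> D" "partner d v < v" using p pV inv by auto
    show "v \<notin> D"
    proof
      assume "v \<in> D"
      then have "v < partner d v" using h circles_selfD unfolding closed_marking_def by blast
      then show False using p pV inv by simp
    qed
  qed
  have Jb: "J = partner b ` B" using eq by (simp add: J_def)
  \<comment> \<open>Suppose the arc of \<open>j\<close> reaches further left in \<open>d\<close>.
    The left end \<open>?i'\<close> of \<open>j\<close> in \<open>d'\<close> lies below it, so
    closedness puts \<open>?i'\<close> on a marked arc of \<open>d\<close>, as its left end because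
    \<open>?i'\<close> is not in \<open>J\<close>. The right end of that arc is in \<open>J\<close>
    and smaller than \<open>j\<close>, where both matchings agree; this gives \<open>?i'\<close> two
    partners in \<open>d'\<close>.\<close>
  have half: "\<not> partner d j < partner d' j"
    if d: "d \<in> crossingless_matchings n" "closed_marking d D" "J = partner d ` D"
      and d': "d' \<in> crossingless_matchings n" "closed_marking d' D'" "J = partner d' ` D'"
      and j: "j \<in> J" and IH: "\<And>v. v \<in> J \<Longrightarrow> v < j \<Longrightarrow> partner d v = partner d' v" for d D d' D' j
  proof
    assume lt: "partner d j < partner d' j"
    let ?i = "partner d j" and ?i' = "partner d' j"
    note aj = arcs[OF j d] and aj' = arcs[OF j d']
    note inv = nc_involD[OF cm_nc_invol[OF d(1)]] and inv' = nc_involD[OF cm_nc_invol[OF d'(1)]]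
    have iV: "?i \<in> ?V" "?i' \<in> ?V" using inv(1)[OF aj(1)] inv'(1)[OF aj(1)] by auto
    have di: "partner d ?i = j" "partner d' ?i' = j" using inv(3)[OF aj(1)] inv'(3)[OF aj(1)] by auto
    have "?i' \<notin> J" using arcs(4)[OF _ d', of ?i'] aj'(2) by auto
    moreover have "?i' \<in> D \<or> partner d ?i' \<in> D"
      using d(2) aj(2) lt aj'(3) di(1) unfolding closed_marking_def by metis
    ultimately have "?i' \<in> D" using inv(3)[OF iV(2)] d(3) by (metis imageI)
    then have 1: "partner d ?i' \<in> J" using d(3) by blast
    have 2: "partner d ?i' < j" using inv(4)[OF iV(1,2) lt] di aj'(3) by simp
    have "partner d' (partner d ?i') = ?i'" using IH[OF 1 2] inv(3)[OF iV(2)] by simp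
    then have "partner d ?i' = j" using di inv'(3)[of "partner d ?i'"] inv(1)[OF iV(2)] by metis
    then show False using 2 by simp
  qed
  have agree: "partner a j = partner b j" if "j \<in> J" for j
    using that
  proof (induction j rule: less_induct)
    case (less j)
    show ?case
      using half[OF cm(1) cl(1) J_def cm(2) cl(2) Jb less.prems] half[OF cm(2) cl(2) Jb cm(1) cl(1) J_def less.prems] less.IH
      by (metis less_linear)
  qed
  have recover: "D = partner d ` J"
    if d: "d \<in> crossingless_matchings n" "closed_marking d D" and JD: "J = partner d ` D" for d D
  proof -
    have "partner d (partner d p) = p" if "p \<in> D" for p
    proof -
      have "p \<in> circles d d" using d(2) that unfolding closed_marking_def by blast
      then show ?thesis using nc_involD(3)[OF cm_nc_invol[OF d(1)] circles_selfD(1)[OF d(1)]] by simp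
    qed
    then show ?thesis unfolding JD image_image by simp
  qed
  show "A = B" using recover[OF cm(1) cl(1) J_def] recover[OF cm(2) cl(2) Jb] agree by (metis image_cong)
  fix p assume p: "p \<in> A"
  then have pV: "p \<in> ?V" using cl(1) circles_selfD(1)[OF cm(1)] unfolding closed_marking_def by blast
  have "partner a p \<in> J" using p by (simp add: J_def)
  then have "partner b (partner a p) = p" using agree nc_involD(3)[OF cm_nc_invol[OF cm(1)] pV] by metis
  then show "partner b p = partner a p"
    using nc_involD(3)[OF cm_nc_invol[OF cm(2)]] nc_involD(1)[OF cm_nc_invol[OF cm(1)] pV] by metis
qed

text \<open>\<open>circle_of a\<close> sends each point of \<open>J\<close> to its arc, whose right
  end is not smaller. A non-zero coefficient needs distinct arcs, exactly those of \<open>A\<close>,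
  so the sum of \<open>J\<close> is smaller unless \<open>J\<close> consists of right ends. This is
  the triangularity of the coefficient matrix.\<close>

lemma circle_word_sum_less:
  assumes a: "a \<in> crossingless_matchings n" and J: "J \<subseteq> {1..2 * n}" and A: "A \<subseteq> circles a a"
    and nz: "circle_word a (sorted_list_of_set J) A \<noteq> 0"
  shows "J = partner a ` A \<or> \<Sum>J < \<Sum>(partner a ` A)"
proof -
  let ?h = "circle_of a" and ?\<mu> = "partner a"
  have finJ: "finite J" using J finite_subset by blast
  have inj: "inj_on ?h J" and im: "?h ` J = A"
    using nz finJ wedge_list_nonzeroD[of "map ?h (sorted_list_of_set J)" A]
    by (auto simp: circle_word_def distinct_map)
  note inv = nc_involD[OF cm_nc_invol[OF a]]
  have le: "x \<le> ?\<mu> (?h x)" if "x \<in> J" for x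
    using circle_of_cm[OF a, of x] inv(3)[of x] that J by (auto simp: min_def)
  have injA: "inj_on ?\<mu> A"
    by (rule inj_onI) (metis A inv(3) circles_selfD(1)[OF a] subsetD)
  have sum: "\<Sum>(?\<mu> ` A) = (\<Sum>x\<in>J. ?\<mu> (?h x))"
    using sum.reindex[OF injA, of "\<lambda>x. x"] sum.reindex[OF inj, of ?\<mu>] im by (simp add: comp_def)
  show ?thesis
  proof (cases "\<forall>x\<in>J. x = ?\<mu> (?h x)")
    case True
    then have "J = ?\<mu> ` (?h ` J)" by (force simp: image_image)
    then show ?thesis using im by simp
  next
    case False
    then have "\<exists>x\<in>J. x < ?\<mu> (?h x)" using le by force
    then have "\<Sum>J < (\<Sum>x\<in>J. ?\<mu> (?h x))" using finJ le by (intro sum_strict_mono_ex1) auto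
    then show ?thesis using sum by simp
  qed
qed

text \<open>Each right end is named by its own left end, so the word lists \<open>A\<close> without
  repetition: the diagonal entries of the triangular matrix are units.\<close>

lemma circle_word_right_ends:
  assumes a: "a \<in> crossingless_matchings n" and A: "A \<subseteq> circles a a"
  shows "circle_word a (sorted_list_of_set (partner a ` A)) A = 1 \<or>
    circle_word a (sorted_list_of_set (partner a ` A)) A = -1"
proof -
  let ?J = "partner a ` A"
  have "finite A" using A finite_circles[OF a a] finite_subset by blast
  have h: "circle_of a (partner a p) = p" if "p \<in> A" for p
  proof -
    have p: "p \<in> {1..2 * n}" "p < partner a p" using that A circles_selfD[OF a] by auto
    then show ?thesis
      using circle_of_cm[OF a, of "partner a p"] nc_involD(1,3)[OF cm_nc_invol[OF a] p(1)] by simp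
  qed
  then have "inj_on (circle_of a) ?J" "circle_of a ` ?J = A" by (auto simp: inj_on_def image_image)
  then have "distinct (map (circle_of a) (sorted_list_of_set ?J))"
    "set (map (circle_of a) (sorted_list_of_set ?J)) = A"
    using \<open>finite A\<close> by (auto simp: distinct_map)
  then show ?thesis unfolding circle_word_def using wedge_list_set by metis
qed

lemma right_ends_subset:
  assumes "a \<in> crossingless_matchings n" "A \<subseteq> circles a a"
  shows "partner a ` A \<subseteq> {1..2 * n}"
  using nc_involD(1)[OF cm_nc_invol[OF assms(1)]] circles_selfD(1)[OF assms(1)] assms(2) by blast

definition right_set :: "nat \<Rightarrow> nat set \<Rightarrow> bool" where
  "right_set n J \<longleftrightarrow> (\<exists>a\<in>crossingless_matchings n. \<exists>A. closed_marking a A \<and> partner a ` A = J)"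

text \<open>Take the monomial \<open>J\<close> of smallest sum in \<open>f\<close> and a closed
  marking with right ends \<open>J\<close>. By triangularity no other monomial of \<open>f\<close>
  contributes to the coefficient at this marking.\<close>

lemma right_set_independent:
  assumes f: "f \<in> carrier (free_ring (2 * n))"
    and supp: "\<And>w. f w \<noteq> 0 \<Longrightarrow> \<exists>J. right_set n J \<and> w = sorted_list_of_set J"
    and zero: "eval_family n f = (\<lambda>b a U. 0)"
  shows "f = (\<lambda>w. 0)"
proof (rule ccontr)
  assume "f \<noteq> (\<lambda>w. 0)"
  define P where "P J \<longleftrightarrow> right_set n J \<and> f (sorted_list_of_set J) \<noteq> 0" for J
  have sub: "J \<subseteq> {1..2 * n}" if "right_set n J" for J
    using that right_ends_subset unfolding right_set_def closed_marking_def by blast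
  have "\<exists>J. P J" using supp \<open>f \<noteq> (\<lambda>w. 0)\<close> unfolding P_def by blast
  then obtain J where J: "P J" and min: "\<And>J'. P J' \<Longrightarrow> \<Sum>J \<le> \<Sum>J'"
    using arg_min_natI[of P _ "\<lambda>J. \<Sum>J"] arg_min_nat_le[of P _ "\<lambda>J. \<Sum>J"] by blast
  obtain a A where a: "a \<in> crossingless_matchings n" and A: "closed_marking a A" "partner a ` A = J"
    using J unfolding P_def right_set_def by blast
  have Ac: "A \<subseteq> circles a a" using A by (simp add: closed_marking_def)
  have "word_lin f (\<lambda>w. circle_word a w A) = (\<Sum>w\<in>{sorted_list_of_set J}. f w * circle_word a w A)"
    unfolding word_lin_def
  proof (rule sum.mono_neutral_right)
    show "finite {w. f w \<noteq> 0}" using f by (simp add: free_carrier)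
    show "{sorted_list_of_set J} \<subseteq> {w. f w \<noteq> 0}" using J by (simp add: P_def)
    show "\<forall>w\<in>{w. f w \<noteq> 0} - {sorted_list_of_set J}. f w * circle_word a w A = 0"
    proof (rule ballI, rule ccontr)
      fix w assume w: "w \<in> {w. f w \<noteq> 0} - {sorted_list_of_set J}" "f w * circle_word a w A \<noteq> 0"
      then obtain J' where J': "right_set n J'" "w = sorted_list_of_set J'" using supp by blast
      then have "P J'" "J' \<noteq> J" using w by (auto simp: P_def)
      then show False
        using circle_word_sum_less[OF a sub[OF J'(1)] Ac] w(2) J'(2) A(2) min by fastforce
    qed
  qed
  moreover have "word_lin f (\<lambda>w. circle_word a w A) = 0"
    using fun_cong[OF eval_family_apply[OF a, of f], of A] zero by simp
  ultimately have "f (sorted_list_of_set J) * circle_word a (sorted_list_of_set J) A = 0" by simp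
  then show False using J circle_word_right_ends[OF a Ac] A(2) by (auto simp: P_def)
qed

text \<open>The coefficients at closed markings are matched in order of increasing sum of right
  ends. Unit diagonal entries make the system solvable over the integers, and by
  \<open>marking_determined\<close> agreement at closed markings is agreement everywhere.\<close>

lemma eval_family_surj:
  assumes z: "z \<in> families n"
  shows "\<exists>f\<in>carrier (free_ring (2 * n)). eval_family n f = z"
proof -
  let ?F = "carrier (free_ring (2 * n))"
  have diff: "(\<lambda>b a U. z b a U - eval_family n f b a U) \<in> families n" if "f \<in> ?F" for f
    using families_add[OF z families_smult[OF eval_family_families[OF that], of "-1"]] by simp
  have "\<exists>f\<in>?F. \<forall>a\<in>crossingless_matchings n. \<forall>A. closed_marking a A \<and> \<Sum>(partner a ` A) < s \<longrightarrow>
      z a a A - eval_family n f a a A = 0" for s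
  proof (induction s)
    case 0
    show ?case by (intro bexI[of _ "\<lambda>w. 0"]) (auto simp: free_carrier)
  next
    case (Suc s)
    then obtain f where f: "f \<in> ?F" and small: "\<And>a A. a \<in> crossingless_matchings n \<Longrightarrow> closed_marking a A \<Longrightarrow>
        \<Sum>(partner a ` A) < s \<Longrightarrow> z a a A - eval_family n f a a A = 0" by blast
    define y where "y = (\<lambda>b a U. z b a U - eval_family n f b a U)"
    have y: "y \<in> families n" unfolding y_def by (rule diff[OF f])
    define JJ where "JJ = {J. right_set n J \<and> \<Sum>J = s}"
    have sub: "J \<subseteq> {1..2 * n}" if "J \<in> JJ" for J
      using that right_ends_subset unfolding JJ_def right_set_def closed_marking_def by blast
    have finJJ: "finite JJ" by (rule finite_subset[of _ "Pow {1..2 * n}"]) (use sub in auto)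
    have "\<forall>J. \<exists>x. J \<in> JJ \<longrightarrow> fst x \<in> crossingless_matchings n \<and> closed_marking (fst x) (snd x) \<and>
        partner (fst x) ` (snd x) = J"
      unfolding JJ_def right_set_def by fastforce
    then obtain rep where rep: "\<And>J. J \<in> JJ \<Longrightarrow> fst (rep J) \<in> crossingless_matchings n"
      "\<And>J. J \<in> JJ \<Longrightarrow> closed_marking (fst (rep J)) (snd (rep J))"
      "\<And>J. J \<in> JJ \<Longrightarrow> partner (fst (rep J)) ` (snd (rep J)) = J" by metis
    define \<alpha> A0 where "\<alpha> J = fst (rep J)" and "A0 J = snd (rep J)" for J
    \<comment> \<open>Dividing by the diagonal entry is multiplying by it, as it is \<open>1\<close>
      or \<open>-1\<close>.\<close>
    define c where "c J = y (\<alpha> J) (\<alpha> J) (A0 J) * circle_word (\<alpha> J) (sorted_list_of_set J) (A0 J)" for J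
    define g where "g = (\<lambda>w. \<Sum>J\<in>JJ. c J * word_ind (sorted_list_of_set J) w)"
    have gsupp: "{w. g w \<noteq> 0} \<subseteq> sorted_list_of_set ` JJ"
    proof
      fix w assume "w \<in> {w. g w \<noteq> 0}"
      then have "(\<Sum>J\<in>JJ. c J * word_ind (sorted_list_of_set J) w) \<noteq> 0" by (simp add: g_def)
      then obtain J where "J \<in> JJ" "c J * word_ind (sorted_list_of_set J) w \<noteq> 0"
        by (rule sum.not_neutral_contains_not_neutral)
      then show "w \<in> sorted_list_of_set ` JJ" by (auto simp: word_ind_def split: if_splits)
    qed
    have ginj: "inj_on sorted_list_of_set JJ"
      by (rule inj_onI) (metis finite_atLeastAtMost finite_subset set_sorted_list_of_set sub)
    have gval: "g (sorted_list_of_set J) = c J" if "J \<in> JJ" for J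
    proof -
      have "g (sorted_list_of_set J) = (\<Sum>J'\<in>JJ. if J' = J then c J' else 0)"
        unfolding g_def using ginj that by (intro sum.cong) (auto simp: word_ind_def dest: inj_onD)
      then show ?thesis using finJJ that by simp
    qed
    have g: "g \<in> ?F"
      unfolding free_carrier
    proof (intro conjI allI impI)
      show "finite {w. g w \<noteq> 0}" using gsupp finJJ finite_surj by blast
      fix w assume "g w \<noteq> 0"
      then obtain J where "J \<in> JJ" "w = sorted_list_of_set J" using gsupp by blast
      then show "set w \<subseteq> {1..2 * n}" using sub[of J] finite_subset[OF sub[of J]] by simp
    qed
    have eval: "eval_family n g a a A = (\<Sum>J\<in>JJ. c J * circle_word a (sorted_list_of_set J) A)"
      if "a \<in> crossingless_matchings n" for a A
    proof -
      have "eval_family n g a a A = (\<Sum>w\<in>sorted_list_of_set ` JJ. g w * circle_word a w A)"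
        using word_lin_eq_sum[OF finite_imageI[OF finJJ] gsupp] that by (simp add: eval_family_apply)
      then show ?thesis using gval by (simp add: sum.reindex[OF ginj])
    qed
    \<comment> \<open>By triangularity, a monomial of sum \<open>s\<close> contributes to a marking
      of right-end sum at most \<open>s\<close> only if it is the monomial of its right ends. The
      coefficients matched at earlier stages are therefore untouched.\<close>
    have eval': "eval_family n g a a A = (if \<Sum>(partner a ` A) = s then
          c (partner a ` A) * circle_word a (sorted_list_of_set (partner a ` A)) A else 0)"
      if a: "a \<in> crossingless_matchings n" and A: "closed_marking a A" "\<Sum>(partner a ` A) \<le> s" for a A
    proof -
      let ?J = "partner a ` A"
      have Ac: "A \<subseteq> circles a a" using A by (simp add: closed_marking_def)
      have "circle_word a (sorted_list_of_set J') A = 0" if "J' \<in> JJ" "J' \<noteq> ?J" for J'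
      proof (rule ccontr)
        assume "circle_word a (sorted_list_of_set J') A \<noteq> 0"
        then have "\<Sum>J' < \<Sum>?J" using circle_word_sum_less[OF a sub[OF that(1)] Ac] that(2) by auto
        then show False using that(1) A(2) by (simp add: JJ_def)
      qed
      then have "eval_family n g a a A = (\<Sum>J\<in>JJ. if J = ?J then c J * circle_word a (sorted_list_of_set J) A else 0)"
        unfolding eval[OF a] by (intro sum.cong) auto
      also have "\<dots> = (if ?J \<in> JJ then c ?J * circle_word a (sorted_list_of_set ?J) A else 0)"
        by (rule sum.delta[OF finJJ])
      also have "?J \<in> JJ \<longleftrightarrow> \<Sum>?J = s" using a A by (auto simp: JJ_def right_set_def)
      finally show ?thesis .
    qed
    define h where "h = (\<lambda>w. f w + g w)"
    have h: "h \<in> ?F" unfolding h_def by (rule free_add_closed[OF f g])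
    have hfam: "(\<lambda>b a U. z b a U - eval_family n h b a U) \<in> families n" by (rule diff[OF h])
    have yh: "z a a A - eval_family n h a a A = y a a A - eval_family n g a a A"
      if "a \<in> crossingless_matchings n" for a A
      using word_lin_add[of f g] f g that by (simp add: y_def h_def eval_family_apply free_carrier)
    have "z a a A - eval_family n h a a A = 0"
      if a: "a \<in> crossingless_matchings n" and A: "closed_marking a A" "\<Sum>(partner a ` A) < Suc s" for a A
    proof (cases "\<Sum>(partner a ` A) < s")
      case True
      then have "y a a A = 0" "eval_family n g a a A = 0" using eval'[OF a A(1)] small[OF a A(1)] by (simp_all add: y_def)
      then show ?thesis using yh[OF a, of A] by simp
    next
      case False
      let ?J = "partner a ` A"
      have sJ: "\<Sum>?J = s" using False A(2) by simp
      then have J: "?J \<in> JJ" using a A by (auto simp: JJ_def right_set_def)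
      let ?a = "\<alpha> ?J" and ?A = "A0 ?J"
      have a0: "?a \<in> crossingless_matchings n" and A0: "closed_marking ?a ?A" "partner ?a ` ?A = ?J"
        using rep[OF J] by (auto simp: \<alpha>_def A0_def)
      have Ac: "?A \<subseteq> circles ?a ?a" using A0 by (simp add: closed_marking_def)
      have "eval_family n g ?a ?a ?A = y ?a ?a ?A"
        using eval'[OF a0 A0(1)] circle_word_right_ends[OF a0 Ac] A0(2) sJ by (auto simp: c_def)
      then have 0: "z ?a ?a ?A - eval_family n h ?a ?a ?A = 0" using yh[OF a0] by simp
      \<comment> \<open>Only one representative for \<open>?J\<close> was corrected. Any other
        closed marking with these right ends uses the same arcs, so
        \<open>families_common_marking\<close> transfers the vanishing.\<close>
      have u: "A = ?A" "\<And>p. p \<in> ?A \<Longrightarrow> partner a p = partner ?a p"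
        using closed_marking_unique[OF a0 a A0(1) A(1) A0(2)] by auto
      show ?thesis
        using families_common_marking[OF hfam a a0 Ac u(2)] 0 u(1) by simp
    qed
    then show ?case using h by blast
  qed
  \<comment> \<open>No set of right ends has a larger sum than the set of all points, so this stage
    covers every closed marking.\<close>
  then obtain f where f: "f \<in> ?F" and clo: "\<And>a A. a \<in> crossingless_matchings n \<Longrightarrow> closed_marking a A \<Longrightarrow>
      \<Sum>(partner a ` A) < Suc (\<Sum>{1..2 * n}) \<Longrightarrow> z a a A - eval_family n f a a A = 0" by blast
  have "z a a A - eval_family n f a a A = 0" if a: "a \<in> crossingless_matchings n" for a A
  proof (rule marking_determined[OF diff[OF f] _ a])
    fix a A assume a: "a \<in> crossingless_matchings n" and A: "closed_marking a A"
    have "\<Sum>(partner a ` A) \<le> \<Sum>{1..2 * n}"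
      using right_ends_subset[OF a] A by (intro sum_mono2) (auto simp: closed_marking_def)
    then show "z a a A - eval_family n f a a A = 0" using clo[OF a A] by simp
  qed
  then have "eval_family n f = z"
    by (intro families_eqI[OF eval_family_families[OF f] z] ext) simp
  then show ?thesis using f by blast
qed

section \<open>Ballot sets are sets of right ends\<close>

lemma nc_invol_exists:
  assumes "finite V" "even (card V)" "J \<subseteq> V" "\<And>m. 2 * card (J \<inter> {..m}) \<le> card (V \<inter> {..m})"
  shows "\<exists>\<mu>. nc_invol V \<mu> \<and> (\<forall>v\<in>J. \<mu> v < v \<and> (\<forall>w\<in>V. \<mu> v < w \<and> w < v \<longrightarrow> w \<in> J \<or> \<mu> w \<in> J))"
  using assms
proof (induction "card V" arbitrary: V J rule: less_induct)
  case less
  show ?case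
  proof (cases "V = {}")
    case True
    then show ?thesis using less.prems by (auto simp: nc_invol_def)
  next
    case False
    \<comment> \<open>Join the least point of \<open>J\<close> to its immediate predecessor in
      \<open>V\<close>, which exists by the ballot condition and is outside \<open>J\<close> by
      leastness; if \<open>J\<close> is empty, join the two least points of \<open>V\<close>. An arc
      between neighbours has nothing below it and crosses nothing.\<close>
    have "\<exists>p j. p \<in> V \<and> j \<in> V \<and> p < j \<and> p \<notin> J \<and> (J = {} \<or> j \<in> J \<and> (\<forall>v\<in>J. j \<le> v)) \<and>
        (\<forall>w\<in>V. \<not> (p < w \<and> w < j))"
    proof (cases "J = {}")
      case True
      let ?p = "Min V" and ?j = "Min (V - {Min V})"
      have "V - {?p} \<noteq> {}"
      proof
        assume "V - {?p} = {}"
        then have "V = {?p}" using False by auto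
        then show False using less.prems(2) by (metis card_1_singleton_iff odd_one One_nat_def)
      qed
      then have "?j \<in> V - {?p}" using less.prems(1) by (intro Min_in) auto
      moreover have "?p \<in> V" using less.prems(1) False by (intro Min_in) auto
      moreover have "?p \<le> ?j" using calculation less.prems(1) by (intro Min_le) auto
      then have "?p < ?j" using calculation(1) by auto
      moreover have "\<not> (?p < w \<and> w < ?j)" if "w \<in> V" for w
      proof
        assume w: "?p < w \<and> w < ?j"
        then have "?j \<le> w" using that less.prems(1) by (intro Min_le) auto
        then show False using w by simp
      qed
      ultimately show ?thesis using True by blast
    next
      case nonempty: False
      let ?j = "Min J"
      have finJ: "finite J" using less.prems(1,3) finite_subset by blast
      have j: "?j \<in> J" using finJ nonempty by (intro Min_in)
      have Jj: "J \<inter> {..?j} = {?j}" using j finJ Min_le by (auto intro: antisym)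
      let ?W = "V \<inter> {..<?j}"
      have "V \<inter> {..?j} = insert ?j ?W" using j less.prems(3) by auto
      then have "2 * 1 \<le> Suc (card ?W)" using less.prems(4)[of ?j] less.prems(1) Jj by simp
      then have "?W \<noteq> {}" by auto
      then have p: "Max ?W \<in> ?W" using less.prems(1) by (intro Max_in) auto
      have "Max ?W \<notin> J"
      proof
        assume "Max ?W \<in> J"
        then have "?j \<le> Max ?W" using finJ by (intro Min_le)
        then show False using p by simp
      qed
      moreover have "\<not> (Max ?W < w \<and> w < ?j)" if "w \<in> V" for w
      proof
        assume w: "Max ?W < w \<and> w < ?j"
        then have "w \<le> Max ?W" using that less.prems(1) by (intro Max_ge) auto
        then show False using w by simp
      qed
      moreover have "\<forall>v\<in>J. ?j \<le> v" using finJ by simp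
      ultimately show ?thesis using j p less.prems(3) by blast
    qed
    then obtain p j where pj: "p \<in> V" "j \<in> V" "p < j" "p \<notin> J" and jJ: "J = {} \<or> j \<in> J \<and> (\<forall>v\<in>J. j \<le> v)"
      and adj: "\<And>w. w \<in> V \<Longrightarrow> \<not> (p < w \<and> w < j)" by blast
    let ?V = "V - {p, j}" and ?J = "J - {j}"
    have c2: "card {p, j} = 2" using pj by simp
    have cV: "card ?V = card V - 2" using pj c2 less.prems(1) by (subst card_Diff_subset) auto
    have "2 \<le> card V" using card_mono[OF less.prems(1), of "{p, j}"] pj c2 by simp
    \<comment> \<open>From \<open>j\<close> on, both sides drop by 2; before \<open>j\<close>, or if
      \<open>J\<close> is empty, the left side is 0.\<close>
    have "2 * card (?J \<inter> {..m}) \<le> card (?V \<inter> {..m})" for m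
    proof (cases "j \<le> m \<and> J \<noteq> {}")
      case True
      have "?J \<inter> {..m} = J \<inter> {..m} - {j}" "?V \<inter> {..m} = V \<inter> {..m} - {p, j}" by auto
      moreover have "j \<in> J \<inter> {..m}" "{p, j} \<subseteq> V \<inter> {..m}" using True jJ pj by auto
      ultimately have "card (?J \<inter> {..m}) = card (J \<inter> {..m}) - 1" "card (?V \<inter> {..m}) = card (V \<inter> {..m}) - 2"
        using c2 less.prems(1) by (simp_all add: card_Diff_subset)
      then show ?thesis using less.prems(4)[of m] by simp
    next
      case False
      then have "?J \<inter> {..m} = {}" using jJ by auto
      then show ?thesis by simp
    qed
    then obtain \<mu> where \<mu>: "nc_invol ?V \<mu>"
      and cl: "\<forall>v\<in>?J. \<mu> v < v \<and> (\<forall>w\<in>?V. \<mu> v < w \<and> w < v \<longrightarrow> w \<in> ?J \<or> \<mu> w \<in> ?J)"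
      using less.hyps[of ?V ?J] cV \<open>2 \<le> card V\<close> less.prems pj by auto
    define \<nu> where "\<nu> = \<mu>(p := j, j := p)"
    have nu: "\<nu> p = j" "\<nu> j = p" "\<And>v. v \<notin> {p, j} \<Longrightarrow> \<nu> v = \<mu> v" using pj by (auto simp: \<nu>_def)
    note inv = nc_involD[OF \<mu>]
    have "nc_invol V \<nu>"
      unfolding nc_invol_def
    proof (intro conjI ballI impI)
      fix v assume v: "v \<in> V"
      show "\<nu> v \<in> V" "\<nu> v \<noteq> v" "\<nu> (\<nu> v) = v"
        using inv(1-3)[of v] nu(1,2) nu(3)[of v] nu(3)[of "\<mu> v"] pj v by (cases "v \<in> {p, j}"; auto)+
    next
      fix u v assume uv: "u \<in> V" "v \<in> V" "u < v \<and> v < \<nu> u"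
      have up: "u \<noteq> p" using uv adj nu by auto
      have uj: "u \<noteq> j" using uv nu pj by auto
      then have u: "u \<in> ?V" "\<nu> u = \<mu> u" using uv up nu(3) by auto
      have "\<mu> u \<notin> {p, j}" "\<mu> u \<in> V" using inv(1)[OF u(1)] by auto
      have "u < \<nu> v \<and> \<nu> v < \<nu> u"
      proof (cases "v \<in> {p, j}")
        case True
        have "u < p" using True uv(1,3) up uj adj[of u] by auto
        moreover have "j < \<mu> u" using True uv(3) u(2) \<open>\<mu> u \<notin> {p, j}\<close> adj[OF \<open>\<mu> u \<in> V\<close>] by auto
        ultimately show ?thesis using True nu u pj by auto
      next
        case False
        then show ?thesis using inv(4)[OF u(1), of v] uv u nu(3) by auto
      qed
      then show "u < \<nu> v" "\<nu> v < \<nu> u" by auto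
    qed
    moreover have "\<nu> v < v \<and> (\<forall>w\<in>V. \<nu> v < w \<and> w < v \<longrightarrow> w \<in> J \<or> \<nu> w \<in> J)" if v: "v \<in> J" for v
    proof (cases "v = j")
      case True
      then show ?thesis using nu pj adj by auto
    next
      case False
      then have v': "v \<in> ?J" "v \<noteq> p" "\<nu> v = \<mu> v" using v pj nu(3)[of v] by auto
      \<comment> \<open>If \<open>J\<close> is non-empty, the new arc is marked by its right end
        \<open>j\<close>, so placing it below another marked arc keeps the marking closed.\<close>
      have jJ': "j \<in> J" using jJ v by auto
      show ?thesis
      proof (intro conjI ballI impI)
        show "\<nu> v < v" using cl v' by auto
        fix w assume w: "w \<in> V" "\<nu> v < w \<and> w < v"
        show "w \<in> J \<or> \<nu> w \<in> J"
        proof (cases "w \<in> {p, j}")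
          case True
          then show ?thesis using nu jJ' by auto
        next
          case False
          then have "w \<in> ?V" using w by auto
          then show ?thesis using cl v' w nu(3)[OF False] by auto
        qed
      qed
    qed
    ultimately show ?thesis by blast
  qed
qed

lemma right_set_ballot:
  assumes J: "J \<subseteq> {1..2 * n}" and ballot: "\<And>m. 2 * card (J \<inter> {..m}) \<le> m"
  shows "right_set n J"
proof -
  let ?V = "{1..2 * n}"
  have "2 * card (J \<inter> {..m}) \<le> card (?V \<inter> {..m})" for m
  proof (cases "m \<le> 2 * n")
    case True
    then have "?V \<inter> {..m} = {1..m}" by auto
    then have "card (?V \<inter> {..m}) = m" by (simp only: card_atLeastAtMost diff_Suc_1)
    then show ?thesis using ballot[of m] by (simp only:)
  next
    case False
    then have "?V \<inter> {..m} = ?V" "J \<inter> {..m} = J \<inter> {..2 * n}" using J by auto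
    then show ?thesis using ballot[of "2 * n"] by (simp only: card_atLeastAtMost diff_Suc_1)
  qed
  then obtain \<mu> where \<mu>: "nc_invol ?V \<mu>"
    and cl: "\<forall>v\<in>J. \<mu> v < v \<and> (\<forall>w\<in>?V. \<mu> v < w \<and> w < v \<longrightarrow> w \<in> J \<or> \<mu> w \<in> J)"
    using nc_invol_exists[of ?V J] J by auto
  let ?a = "matching_of ?V \<mu>" and ?A = "\<mu> ` J"
  note a = matching_of_cm[OF \<mu>] and part = partner_matching_of[OF \<mu>]
  note inv = nc_involD[OF \<mu> subsetD[OF J]]
  have pA: "partner ?a (\<mu> v) = v" if "v \<in> J" for v using part inv(1,3)[OF that] by simp
  have "?A \<subseteq> circles ?a ?a"
    unfolding circles_self[OF a] using inv(1) cl pA by auto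
  moreover have "w \<in> ?A \<or> partner ?a w \<in> ?A" if v: "v \<in> J" and w: "\<mu> v < w" "w < v" for v w
  proof -
    have wV: "w \<in> ?V" using inv(1)[OF v] w v J by auto
    then have "w \<in> J \<or> \<mu> w \<in> J" using cl v w by blast
    then show ?thesis using part[OF wV] nc_involD(3)[OF \<mu> wV] by (metis imageI)
  qed
  ultimately have "closed_marking ?a ?A" using pA by (auto simp: closed_marking_def)
  moreover have "partner ?a ` ?A = J" using pA by (auto simp: image_image)
  ultimately show ?thesis using a by (auto simp: right_set_def)
qed


subsection \<open>Spanning modulo the left ideal\<close>

text \<open>An abstract ring with anticommuting elements keeps the computations free of cosets;
  squares are not assumed to vanish. The instance is \<open>OPol m\<close> with its
  variables.\<close>

locale skew_variables = ring R for R (structure) +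
  fixes m :: nat and X :: "nat \<Rightarrow> 'a"
  assumes X_closed: "i \<in> {1..m} \<Longrightarrow> X i \<in> carrier R"
    and X_anticommute: "i \<in> {1..m} \<Longrightarrow> j \<in> {1..m} \<Longrightarrow> i \<noteq> j \<Longrightarrow> X i \<otimes> X j = \<ominus> (X j \<otimes> X i)"
begin

definition word_prod :: "nat list \<Rightarrow> 'a" where
  "word_prod w = foldr (\<lambda>i p. X i \<otimes> p) w \<one>"

definition signed :: "nat set \<Rightarrow> nat \<Rightarrow> 'a" where
  "signed I i = (if even (card {j \<in> I. j < i}) then X i else \<ominus> X i)"

definition elementary :: "nat set \<Rightarrow> nat \<Rightarrow> 'a" where
  "elementary I r = (\<Oplus>J\<in>{J. J \<subseteq> I \<and> card J = r}.
     foldr (\<lambda>i p. signed I i \<otimes> p) (sorted_list_of_set J) \<one>)"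

text \<open>Signs do not affect membership in an additive subgroup, which is all that is asked of
  these products.\<close>

definition up_to_sign :: "'a \<Rightarrow> 'a \<Rightarrow> bool" (infix \<open>\<approx>\<close> 50) where
  "u \<approx> v \<longleftrightarrow> u = v \<or> u = \<ominus> v"

lemma up_to_sign_refl [simp]: "u \<approx> u"
  by (simp add: up_to_sign_def)

lemma up_to_sign_trans: "u \<approx> v \<Longrightarrow> v \<approx> w \<Longrightarrow> w \<in> carrier R \<Longrightarrow> u \<approx> w"
  by (auto simp: up_to_sign_def)

lemma up_to_sign_mult:
  assumes "u \<approx> v" "u' \<approx> v'" "v \<in> carrier R" "v' \<in> carrier R"
  shows "u \<otimes> u' \<approx> v \<otimes> v'"
  using assms by (auto simp: up_to_sign_def l_minus r_minus)

lemma up_to_sign_mem: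
  assumes "additive_subgroup M R" "u \<approx> v" "v \<in> M"
  shows "u \<in> M"
  using assms additive_subgroup.a_inv_closed by (auto simp: up_to_sign_def)

lemma word_prod_simps [simp]: "word_prod [] = \<one>" "word_prod (i # w) = X i \<otimes> word_prod w"
  by (simp_all add: word_prod_def)

lemma word_prod_closed [simp]: "set w \<subseteq> {1..m} \<Longrightarrow> word_prod w \<in> carrier R"
  by (induction w) (auto simp: X_closed)

lemma word_prod_append:
  "set u \<subseteq> {1..m} \<Longrightarrow> set v \<subseteq> {1..m} \<Longrightarrow> word_prod (u @ v) = word_prod u \<otimes> word_prod v"
  by (induction u) (auto simp: X_closed m_assoc)

lemma word_prod_commute:
  assumes "i \<in> {1..m}" "set w \<subseteq> {1..m}"
  shows "X i \<otimes> word_prod w \<approx> word_prod w \<otimes> X i"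
  using assms(2)
proof (induction w)
  case Nil
  then show ?case using X_closed[OF assms(1)] by simp
next
  case (Cons j w)
  then have c: "X i \<in> carrier R" "X j \<in> carrier R" "word_prod w \<in> carrier R" using assms(1) X_closed by auto
  have "X i \<otimes> X j \<approx> X j \<otimes> X i"
    using X_anticommute[OF assms(1), of j] Cons.prems by (cases "i = j") (auto simp: up_to_sign_def)
  then have 1: "X i \<otimes> X j \<otimes> word_prod w \<approx> X j \<otimes> X i \<otimes> word_prod w"
    by (rule up_to_sign_mult) (use c in auto)
  have 2: "X j \<otimes> X i \<otimes> word_prod w \<approx> X j \<otimes> (word_prod w \<otimes> X i)"
    unfolding m_assoc[OF c(2,1,3)] by (rule up_to_sign_mult) (use Cons c in auto)
  have "X i \<otimes> X j \<otimes> word_prod w \<approx> X j \<otimes> (word_prod w \<otimes> X i)"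
    using up_to_sign_trans[OF 1 2] c by simp
  then show ?case using c by (simp add: m_assoc)
qed

lemma word_prod_mset:
  assumes "mset w = mset w'" "set w \<subseteq> {1..m}"
  shows "word_prod w \<approx> word_prod w'"
  using assms
proof (induction w arbitrary: w')
  case Nil
  then show ?case by simp
next
  case (Cons i w)
  have "i \<in> set w'" using Cons.prems(1) by (metis list.set_intros(1) mset_eq_setD)
  then obtain u v where w': "w' = u @ i # v" by (meson split_list)
  then have ms: "mset w = mset (u @ v)" using Cons.prems(1) by simp
  then have sub: "set u \<subseteq> {1..m}" "set v \<subseteq> {1..m}" "i \<in> {1..m}" "set w \<subseteq> {1..m}"
    using Cons.prems(2) mset_eq_setD[OF ms] by auto
  have c: "X i \<in> carrier R" "word_prod u \<in> carrier R" "word_prod v \<in> carrier R" using sub X_closed by auto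
  have "X i \<otimes> word_prod w \<approx> X i \<otimes> word_prod (u @ v)"
    by (rule up_to_sign_mult) (use Cons.IH[OF ms sub(4)] c sub in auto)
  moreover have "X i \<otimes> word_prod u \<otimes> word_prod v \<approx> word_prod u \<otimes> X i \<otimes> word_prod v"
    by (rule up_to_sign_mult) (use word_prod_commute[OF sub(3,1)] c in auto)
  ultimately show ?case
    using c sub by (auto intro: up_to_sign_trans simp: w' word_prod_append m_assoc)
qed

text \<open>\<open>L\<close> absorbs multiplication from the left only, so the two equal variables
  are moved to the right end, at the cost of a sign.\<close>

lemma word_prod_square_mem:
  assumes L: "left_ideal L R" and sq: "\<And>i. i \<in> {1..m} \<Longrightarrow> X i \<otimes> X i \<in> L"
    and w: "set w \<subseteq> {1..m}" "\<not> distinct w"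
  shows "word_prod w \<in> L"
proof -
  have add: "additive_subgroup L R" and left: "\<And>r x. r \<in> carrier R \<Longrightarrow> x \<in> L \<Longrightarrow> r \<otimes> x \<in> L"
    using L by (auto simp: left_ideal_def)
  obtain u i v v' where w': "w = u @ [i] @ v @ [i] @ v'" using w(2) by (metis not_distinct_decomp)
  let ?w = "(u @ v @ v') @ [i, i]"
  have sub: "set (u @ v @ v') \<subseteq> {1..m}" "i \<in> {1..m}" using w(1) w' by auto
  have "word_prod w \<approx> word_prod ?w" using w(1) by (intro word_prod_mset) (simp_all add: w')
  moreover have "word_prod ?w = word_prod (u @ v @ v') \<otimes> (X i \<otimes> X i)"
    using sub X_closed[OF sub(2)] by (subst word_prod_append) auto
  then have "word_prod ?w \<in> L" using left[OF word_prod_closed[OF sub(1)] sq[OF sub(2)]] by simp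
  ultimately show ?thesis using up_to_sign_mem[OF add] by blast
qed

lemma signed_closed: "i \<in> {1..m} \<Longrightarrow> signed I i \<in> carrier R"
  using X_closed by (simp add: signed_def)

lemma signed_word:
  assumes "set w \<subseteq> {1..m}"
  shows "foldr (\<lambda>i p. signed I i \<otimes> p) w \<one> \<approx> word_prod w"
  using assms
proof (induction w)
  case (Cons i w)
  then have "signed I i \<approx> X i" by (simp add: signed_def up_to_sign_def)
  then show ?case using Cons X_closed by (auto intro: up_to_sign_mult)
qed simp

lemma signed_word_closed: "set w \<subseteq> {1..m} \<Longrightarrow> foldr (\<lambda>i p. signed I i \<otimes> p) w \<one> \<in> carrier R"
  by (induction w) (auto simp: signed_closed)

section \<open>Elementary polynomials of lists and squares of variables\<close>

fun esym :: "nat \<Rightarrow> 'a list \<Rightarrow> 'a" where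
  "esym 0 l = \<one>"
| "esym (Suc r) [] = \<zero>"
| "esym (Suc r) (y # l) = y \<otimes> esym r l \<oplus> esym (Suc r) l"

lemma esym_closed: "set l \<subseteq> carrier R \<Longrightarrow> esym r l \<in> carrier R"
  by (induction r l rule: esym.induct) auto

text \<open>Subsets containing the least element contribute its value times the polynomial of one
  degree less, the others the polynomial of the tail: this is the recursion of
  \<open>esym\<close>.\<close>

lemma finsum_subsets_esym:
  assumes "sorted l" "distinct l" "\<And>i. i \<in> set l \<Longrightarrow> f i \<in> carrier R"
  shows "(\<Oplus>J\<in>{J. J \<subseteq> set l \<and> card J = r}. foldr (\<lambda>i p. f i \<otimes> p) (sorted_list_of_set J) \<one>) = esym r (map f l)"
  using assms
proof (induction l arbitrary: r)
  case Nil
  show ?case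
  proof (cases r)
    case 0
    then have eq: "{J. J \<subseteq> set [] \<and> card J = r} = {{}}" by auto
    show ?thesis unfolding eq using 0 by simp
  next
    case (Suc s)
    then have eq: "{J. J \<subseteq> set [] \<and> card J = r} = {}" by auto
    show ?thesis unfolding eq using Suc by simp
  qed
next
  case (Cons i l)
  let ?F = "\<lambda>J. foldr (\<lambda>i p. f i \<otimes> p) (sorted_list_of_set J) \<one>"
  have fc: "foldr (\<lambda>i p. f i \<otimes> p) w \<one> \<in> carrier R" if "set w \<subseteq> set (i # l)" for w
    using that Cons.prems(3) by (induction w) auto
  have Fc: "?F J \<in> carrier R" if "J \<subseteq> set (i # l)" for J
    using fc[of "sorted_list_of_set J"] finite_subset[OF that] that by simp
  have FcS: "?F J \<in> carrier R" if "J \<subseteq> set l" for J by (rule Fc) (use that in auto)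
  have fi: "f i \<in> carrier R" using Cons.prems(3) by simp
  have IH: "(\<Oplus>J\<in>{J. J \<subseteq> set l \<and> card J = r}. ?F J) = esym r (map f l)" for r
    using Cons by simp
  show ?case
  proof (cases r)
    case 0
    then have eq: "{J. J \<subseteq> set (i # l) \<and> card J = r} = {{}}"
      using finite_subset[of _ "set (i # l)"] by (auto simp: card_eq_0_iff)
    show ?thesis unfolding eq using 0 by simp
  next
    case (Suc s)
    let ?S = "{J. J \<subseteq> set l \<and> card J = s}" and ?S' = "{J. J \<subseteq> set l \<and> card J = Suc s}"
    have il: "i \<notin> set l" "\<And>j. j \<in> set l \<Longrightarrow> i < j"
      using Cons.prems by (auto simp: order.order_iff_strict)
    have split: "{J. J \<subseteq> set (i # l) \<and> card J = r} = insert i ` ?S \<union> ?S'"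
    proof
      show "{J. J \<subseteq> set (i # l) \<and> card J = r} \<subseteq> insert i ` ?S \<union> ?S'"
      proof
        fix J assume J: "J \<in> {J. J \<subseteq> set (i # l) \<and> card J = r}"
        then have "finite J" using finite_subset by auto
        show "J \<in> insert i ` ?S \<union> ?S'"
        proof (cases "i \<in> J")
          case True
          then have "J = insert i (J - {i})" "J - {i} \<in> ?S" using J \<open>finite J\<close> Suc by auto
          then show ?thesis by blast
        qed (use J Suc in auto)
      qed
      show "insert i ` ?S \<union> ?S' \<subseteq> {J. J \<subseteq> set (i # l) \<and> card J = r}"
      proof
        fix J assume J: "J \<in> insert i ` ?S \<union> ?S'"
        show "J \<in> {J. J \<subseteq> set (i # l) \<and> card J = r}"
        proof (cases "J \<in> ?S'")
          case False
          then obtain K where K: "K \<in> ?S" "J = insert i K" using J by auto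
          then have "finite K" "i \<notin> K" using il finite_subset[of K "set l"] by auto
          then show ?thesis using K Suc by auto
        qed (use Suc in auto)
      qed
    qed
    have fin: "finite ?S" "finite ?S'" by simp_all
    have FcI: "?F J \<in> carrier R" if "J \<in> insert i ` ?S" for J by (rule Fc) (use that in auto)
    have "?F (insert i K) = f i \<otimes> ?F K" if "K \<in> ?S" for K
    proof -
      have K: "finite K" "\<And>j. j \<in> K \<Longrightarrow> i < j" using that il finite_subset[of K "set l"] by auto
      have "sorted_list_of_set (insert i K) = i # sorted_list_of_set K"
        by (rule sorted_list_of_set_eq) (use K in \<open>auto intro: less_imp_le\<close>)
      then show ?thesis by simp
    qed
    then have "(\<Oplus>J\<in>insert i ` ?S. ?F J) = (\<Oplus>K\<in>?S. f i \<otimes> ?F K)"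
    proof -
      assume eq: "\<And>K. K \<in> ?S \<Longrightarrow> ?F (insert i K) = f i \<otimes> ?F K"
      have inj: "inj_on (insert i) ?S" by (rule inj_onI) (metis (no_types, lifting) il(1) insert_ident mem_Collect_eq subsetD)
      have "(\<Oplus>J\<in>insert i ` ?S. ?F J) = (\<Oplus>K\<in>?S. ?F (insert i K))"
        by (rule finsum_reindex) (intro Pi_I FcI, assumption, rule inj)
      also have "\<dots> = (\<Oplus>K\<in>?S. f i \<otimes> ?F K)"
        using eq FcS fi by (intro finsum_cong') auto
      finally show ?thesis .
    qed
    also have "\<dots> = f i \<otimes> (\<Oplus>K\<in>?S. ?F K)"
      using FcS fi by (subst finsum_rdistr) auto
    finally have 1: "(\<Oplus>J\<in>insert i ` ?S. ?F J) = f i \<otimes> esym s (map f l)" using IH by simp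
    have "(\<Oplus>J\<in>insert i ` ?S \<union> ?S'. ?F J) = (\<Oplus>J\<in>insert i ` ?S. ?F J) \<oplus> (\<Oplus>J\<in>?S'. ?F J)"
    proof (rule finsum_Un_disjoint)
      show "?F \<in> insert i ` ?S \<rightarrow> carrier R" by (intro Pi_I FcI)
    qed (use fin FcS il(1) in auto)
    then show ?thesis unfolding split using 1 IH[of "Suc s"] Suc by simp
  qed
qed

lemma elementary_esym:
  assumes "I \<subseteq> {1..m}" "sorted l" "distinct l" "set l = I"
  shows "elementary I r = esym r (map (signed I) l)"
  unfolding elementary_def assms(4)[symmetric]
  by (rule finsum_subsets_esym) (use assms signed_closed in \<open>auto simp: subset_iff\<close>)

lemma esym_append:
  assumes "set u \<subseteq> carrier R" "set v \<subseteq> carrier R"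
  shows "esym (Suc 0) (u @ v) = esym (Suc 0) u \<oplus> esym (Suc 0) v"
    and "esym (Suc (Suc 0)) (u @ v) =
      (esym (Suc (Suc 0)) u \<oplus> esym (Suc (Suc 0)) v) \<oplus> esym (Suc 0) u \<otimes> esym (Suc 0) v"
proof -
  have 1: "esym (Suc 0) (u @ v) = esym (Suc 0) u \<oplus> esym (Suc 0) v" if "set u \<subseteq> carrier R" for u
    using that assms(2) by (induction u) (auto simp: esym_closed a_assoc)
  show "esym (Suc 0) (u @ v) = esym (Suc 0) u \<oplus> esym (Suc 0) v" by (rule 1) (rule assms)
  show "esym (Suc (Suc 0)) (u @ v) =
      (esym (Suc (Suc 0)) u \<oplus> esym (Suc (Suc 0)) v) \<oplus> esym (Suc 0) u \<otimes> esym (Suc 0) v"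
    using assms(1)
  proof (induction u)
    case (Cons y u)
    then have c: "y \<in> carrier R" "esym (Suc 0) u \<in> carrier R" "esym (Suc (Suc 0)) u \<in> carrier R"
      "esym (Suc 0) v \<in> carrier R" "esym (Suc (Suc 0)) v \<in> carrier R"
      using assms(2) by (auto simp: esym_closed)
    then show ?case using Cons 1 by (simp add: l_distr r_distr a_ac)
  qed (use assms in \<open>auto simp: esym_closed\<close>)
qed

lemma esym_neg:
  assumes "set v \<subseteq> carrier R"
  shows "esym (Suc 0) (map (\<lambda>x. \<ominus> x) v) = \<ominus> esym (Suc 0) v"
    and "esym (Suc (Suc 0)) (map (\<lambda>x. \<ominus> x) v) = esym (Suc (Suc 0)) v"
proof -
  have 1: "esym (Suc 0) (map (\<lambda>x. \<ominus> x) v) = \<ominus> esym (Suc 0) v" if "set v \<subseteq> carrier R" for v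
    using that by (induction v) (auto simp: esym_closed minus_add l_minus)
  show "esym (Suc 0) (map (\<lambda>x. \<ominus> x) v) = \<ominus> esym (Suc 0) v" by (rule 1) (rule assms)
  show "esym (Suc (Suc 0)) (map (\<lambda>x. \<ominus> x) v) = esym (Suc (Suc 0)) v"
    using assms by (induction v) (auto simp: esym_closed 1 l_minus r_minus)
qed

lemma left_ideal_cancel:
  assumes "left_ideal L R" "u \<oplus> v \<in> L" "u \<in> L" "v \<in> carrier R"
  shows "v \<in> L"
proof -
  have add: "additive_subgroup L R" using assms(1) by (simp add: left_ideal_def)
  have u: "u \<in> carrier R" using additive_subgroup.a_subset[OF add] assms(3) by blast
  have "\<ominus> u \<oplus> (u \<oplus> v) \<in> L"
    using additive_subgroup.a_closed[OF add] additive_subgroup.a_inv_closed[OF add] assms(2,3) by blast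
  then show ?thesis using u assms(4) by (simp add: r_neg1)
qed

text \<open>Comparing \<open>\<epsilon>\<^sub>2\<close> of all variables with \<open>\<epsilon>\<^sub>2\<close> of all variables but \<open>y\<close> yields \<open>y\<^sup>2\<close>.\<close>

lemma esym_square_mem:
  assumes L: "left_ideal L R" and c: "set u \<subseteq> carrier R" "y \<in> carrier R" "set v \<subseteq> carrier R"
    and e1: "esym (Suc 0) (u @ y # v) \<in> L" and e2: "esym (Suc (Suc 0)) (u @ y # v) \<in> L"
    and e2': "esym (Suc (Suc 0)) (u @ map (\<lambda>x. \<ominus> x) v) \<in> L"
    and PP: "esym (Suc 0) u \<otimes> esym (Suc 0) u \<in> L"
    and anti: "y \<otimes> esym (Suc 0) u = \<ominus> (esym (Suc 0) u \<otimes> y)"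
  shows "y \<otimes> y \<in> L"
proof -
  let ?P = "esym (Suc 0) u" and ?Q = "esym (Suc 0) v"
  let ?S = "esym (Suc (Suc 0)) u \<oplus> esym (Suc (Suc 0)) v"
  have add: "additive_subgroup L R" and left: "\<And>r x. r \<in> carrier R \<Longrightarrow> x \<in> L \<Longrightarrow> r \<otimes> x \<in> L"
    using L by (auto simp: left_ideal_def)
  note closed = additive_subgroup.a_closed[OF add] additive_subgroup.a_inv_closed[OF add]
  have cc: "?P \<in> carrier R" "?Q \<in> carrier R" "?S \<in> carrier R" "y \<in> carrier R"
      "esym (Suc (Suc 0)) u \<in> carrier R" "esym (Suc (Suc 0)) v \<in> carrier R"
    using c by (auto simp: esym_closed)
  \<comment> \<open>Leaving out \<open>y\<close> flips the later signs, so the two values of degree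
    2 are \<open>S + PQ + Py + yQ\<close> and \<open>S - PQ\<close>, with difference
    \<open>(Py + PQ) + (PQ + yQ)\<close>. Multiplying the degree 1 relation by \<open>P\<close> from
    the left puts \<open>Py + PQ\<close> into \<open>L\<close>, which leaves \<open>PQ + yQ\<close>.
    Subtracting the former gives \<open>yQ - Py = yP + yQ\<close>, and \<open>y\<close> times the
    degree 1 relation then leaves the square of \<open>y\<close>.\<close>
  have E1: "?P \<oplus> (y \<oplus> ?Q) \<in> L" using e1 c by (simp add: esym_append esym_closed)
  have E2: "?S \<oplus> (?P \<otimes> ?Q \<oplus> (?P \<otimes> y \<oplus> y \<otimes> ?Q)) \<in> L"
    using e2 c cc by (simp add: esym_append esym_closed r_distr a_ac)
  have E2': "?S \<oplus> \<ominus> (?P \<otimes> ?Q) \<in> L"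
  proof -
    have nc: "set (map (\<lambda>x. \<ominus> x) v) \<subseteq> carrier R" using c(3) by auto
    show ?thesis
      using e2' unfolding esym_append(2)[OF c(1) nc] esym_neg[OF c(3)] using cc by (simp add: r_minus)
  qed
  have "?P \<otimes> (?P \<oplus> (y \<oplus> ?Q)) \<in> L" using left cc E1 by simp
  then have "?P \<otimes> ?P \<oplus> (?P \<otimes> y \<oplus> ?P \<otimes> ?Q) \<in> L" using cc by (simp add: r_distr)
  then have w: "?P \<otimes> y \<oplus> ?P \<otimes> ?Q \<in> L" using left_ideal_cancel[OF L _ PP] cc by simp
  have "(?S \<oplus> (?P \<otimes> ?Q \<oplus> (?P \<otimes> y \<oplus> y \<otimes> ?Q))) \<oplus> \<ominus> (?S \<oplus> \<ominus> (?P \<otimes> ?Q)) \<in> L"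
    using closed E2 E2' by blast
  moreover have "(?S \<oplus> (?P \<otimes> ?Q \<oplus> (?P \<otimes> y \<oplus> y \<otimes> ?Q))) \<oplus> \<ominus> (?S \<oplus> \<ominus> (?P \<otimes> ?Q)) =
      (?P \<otimes> y \<oplus> ?P \<otimes> ?Q) \<oplus> (?P \<otimes> ?Q \<oplus> y \<otimes> ?Q)"
  proof -
    have gen: "(s \<oplus> x) \<oplus> \<ominus> (s \<oplus> \<ominus> q) = x \<oplus> q"
      if "s \<in> carrier R" "x \<in> carrier R" "q \<in> carrier R" for s x q
    proof -
      have "(s \<oplus> x) \<oplus> \<ominus> (s \<oplus> \<ominus> q) = \<ominus> s \<oplus> (s \<oplus> (x \<oplus> q))"
        using that by (simp add: minus_add a_ac)
      then show ?thesis using that by (simp add: r_neg1)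
    qed
    have x: "?P \<otimes> ?Q \<oplus> (?P \<otimes> y \<oplus> y \<otimes> ?Q) \<in> carrier R" and q: "?P \<otimes> ?Q \<in> carrier R" using cc by simp_all
    show ?thesis unfolding gen[OF cc(3) x q] using cc by (simp add: a_ac)
  qed
  ultimately have "?P \<otimes> ?Q \<oplus> y \<otimes> ?Q \<in> L" using left_ideal_cancel[OF L _ w] cc by simp
  then have "(?P \<otimes> ?Q \<oplus> y \<otimes> ?Q) \<oplus> \<ominus> (?P \<otimes> y \<oplus> ?P \<otimes> ?Q) \<in> L" using closed w by blast
  moreover have "(?P \<otimes> ?Q \<oplus> y \<otimes> ?Q) \<oplus> \<ominus> (?P \<otimes> y \<oplus> ?P \<otimes> ?Q) = y \<otimes> ?P \<oplus> y \<otimes> ?Q"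
  proof -
    have gen: "(q \<oplus> r) \<oplus> \<ominus> (p \<oplus> q) = \<ominus> p \<oplus> r"
      if "p \<in> carrier R" "q \<in> carrier R" "r \<in> carrier R" for p q r
    proof -
      have "(q \<oplus> r) \<oplus> \<ominus> (p \<oplus> q) = \<ominus> q \<oplus> (q \<oplus> (\<ominus> p \<oplus> r))"
        using that by (simp add: minus_add a_ac)
      then show ?thesis using that by (simp add: r_neg1)
    qed
    show ?thesis unfolding anti using cc by (intro gen) auto
  qed
  ultimately have z: "y \<otimes> ?P \<oplus> y \<otimes> ?Q \<in> L" by simp
  have "y \<otimes> (?P \<oplus> (y \<oplus> ?Q)) \<in> L" using left cc E1 by simp
  then have "(y \<otimes> ?P \<oplus> y \<otimes> ?Q) \<oplus> y \<otimes> y \<in> L" using cc by (simp add: r_distr a_ac)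
  then show ?thesis using left_ideal_cancel[OF L _ z] cc by simp
qed

lemma signed_anticommute:
  assumes "i \<in> {1..m}" "j \<in> {1..m}" "i \<noteq> j"
  shows "signed I i \<otimes> signed I j = \<ominus> (signed I j \<otimes> signed I i)"
  using X_anticommute[OF assms] X_closed assms by (auto simp: signed_def l_minus r_minus)

lemma signed_square: "i \<in> {1..m} \<Longrightarrow> signed I i \<otimes> signed I i = X i \<otimes> X i"
  using X_closed by (simp add: signed_def l_minus r_minus)

lemma signed_esym_anticommute:
  assumes "i \<in> {1..m}" "set l \<subseteq> {1..m}" "i \<notin> set l"
  shows "signed I i \<otimes> esym (Suc 0) (map (signed I) l) = \<ominus> (esym (Suc 0) (map (signed I) l) \<otimes> signed I i)"
  using assms(2,3)
proof (induction l)
  case (Cons j l)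
  have "set (map (signed I) l) \<subseteq> carrier R" using Cons.prems signed_closed by auto
  then show ?case using Cons signed_anticommute[OF assms(1), of j] signed_closed assms(1)
    by (simp add: esym_closed r_distr l_distr minus_add)
qed (use assms signed_closed in simp)

text \<open>Mixed terms cancel in pairs by anticommutation, so the square of the signed sum is the
  sum of the squares.\<close>

lemma esym_signed_square_mem:
  assumes L: "left_ideal L R" and l: "set l \<subseteq> {1..m}" "distinct l"
    and sq: "\<And>i. i \<in> set l \<Longrightarrow> X i \<otimes> X i \<in> L"
  shows "esym (Suc 0) (map (signed I) l) \<otimes> esym (Suc 0) (map (signed I) l) \<in> L"
  using l sq
proof (induction l)
  case Nil
  then show ?case using L additive_subgroup.zero_closed by (simp add: left_ideal_def) blast
next
  case (Cons i l)
  let ?P = "esym (Suc 0) (map (signed I) l)" and ?y = "signed I i"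
  have add: "additive_subgroup L R" using L by (simp add: left_ideal_def)
  have c: "?P \<in> carrier R" "?y \<in> carrier R"
  proof -
    have "\<And>j. j \<in> set (i # l) \<Longrightarrow> signed I j \<in> carrier R" using Cons.prems(1) signed_closed by blast
    then show "?P \<in> carrier R" "?y \<in> carrier R" by (auto intro!: esym_closed)
  qed
  have anti: "?y \<otimes> ?P = \<ominus> (?P \<otimes> ?y)" using Cons.prems by (intro signed_esym_anticommute) auto
  have "(?y \<oplus> ?P) \<otimes> (?y \<oplus> ?P) = ?y \<otimes> ?y \<oplus> ?P \<otimes> ?P"
  proof -
    have "(?y \<oplus> ?P) \<otimes> (?y \<oplus> ?P) = ?y \<otimes> ?y \<oplus> (?P \<otimes> ?y \<oplus> (?y \<otimes> ?P \<oplus> ?P \<otimes> ?P))"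
      using c by (simp add: l_distr r_distr a_ac)
    then show ?thesis using c by (simp add: anti r_neg2)
  qed
  moreover have "?y \<otimes> ?y \<in> L" using Cons.prems by (simp add: signed_square)
  moreover have "?P \<otimes> ?P \<in> L" using Cons by simp
  ultimately show ?case using additive_subgroup.a_closed[OF add] c by simp
qed

context
  fixes n :: nat and L
  assumes m: "m = 2 * n" and L: "left_ideal L R"
    and gens: "\<And>I r k. k \<in> {1..n} \<Longrightarrow> I \<subseteq> {1..m} \<Longrightarrow> card I = n + k \<Longrightarrow> r \<in> {n - k + 1..n + k} \<Longrightarrow>
      elementary I r \<in> L"
begin

text \<open>Induction supplies the squares of the variables before \<open>i\<close>, hence that of
  their signed sum. The polynomials of degrees 1 and 2 in all variables are generators with
  \<open>k = n\<close>, the one of degree 2 without \<open>i\<close> is a generator with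
  \<open>k = n - 1\<close>.\<close>

lemma square_mem: "i \<in> {1..m} \<Longrightarrow> X i \<otimes> X i \<in> L"
proof (induction i rule: less_induct)
  case (less i)
  let ?V = "{1..m}" and ?u = "[1..<i]" and ?v = "[Suc i..<Suc m]"
  let ?y = "signed ?V" and ?I = "{1..m} - {i}"
  have add: "additive_subgroup L R" using L by (simp add: left_ideal_def)
  have n: "n \<ge> 1" using less.prems m by auto
  have setV: "set (?u @ i # ?v) = ?V" using less.prems by (auto simp del: upt_Suc)
  have el: "elementary ?V r = esym r (map ?y ?u @ ?y i # map ?y ?v)" for r
  proof -
    have "sorted (?u @ i # ?v)" "distinct (?u @ i # ?v)" by (auto simp: sorted_append simp del: upt_Suc)
    from elementary_esym[OF order_refl this setV, of r] show ?thesis by (simp only: map_append list.map)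
  qed
  have "map (signed ?I) ?u = map ?y ?u"
  proof (rule map_cong)
    fix j assume "j \<in> set ?u"
    then have "{k \<in> ?I. k < j} = {k \<in> ?V. k < j}" by auto
    then show "signed ?I j = ?y j" by (simp only: signed_def)
  qed simp
  \<comment> \<open>Every later index loses one predecessor, so its sign flips.\<close>
  moreover have "map (signed ?I) ?v = map (\<lambda>x. \<ominus> x) (map ?y ?v)"
    unfolding map_map
  proof (rule map_cong)
    fix j assume j: "j \<in> set ?v"
    then have "i < j" "j \<in> ?V" by auto
    then have "{k \<in> ?V. k < j} = insert i {k \<in> ?I. k < j}" using less.prems by auto
    moreover have "card (insert i {k \<in> ?I. k < j}) = Suc (card {k \<in> ?I. k < j})"
      by (rule card_insert_disjoint) auto
    ultimately have "card {k \<in> ?V. k < j} = Suc (card {k \<in> ?I. k < j})" by (simp only:)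
    then show "signed ?I j = ((\<lambda>x. \<ominus> x) \<circ> ?y) j"
      using X_closed[OF \<open>j \<in> ?V\<close>] by (simp only: signed_def comp_def even_Suc) (simp split: if_split)
  qed simp
  moreover have "elementary ?I r = esym r (map (signed ?I) (?u @ ?v))" for r
  proof (rule elementary_esym)
    show "set (?u @ ?v) = ?I" using less.prems by (auto simp del: upt_Suc)
  qed (auto simp: sorted_append simp del: upt_Suc)
  ultimately have el': "elementary ?I r = esym r (map ?y ?u @ map (\<lambda>x. \<ominus> x) (map ?y ?v))" for r
    by (simp only: map_append)
  have e: "elementary ?V (Suc 0) \<in> L" "elementary ?V (Suc (Suc 0)) \<in> L"
    using gens[of n ?V] n m by auto
  have e': "elementary ?I (Suc (Suc 0)) \<in> L"
  \<comment> \<open>\<open>k = n - 1\<close> must be at least 1. For \<open>n = 1\<close> a single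
    variable is left, and the polynomial of degree 2 is an empty sum.\<close>
  proof (cases "n = 1")
    case True
    have eq: "{J. J \<subseteq> ?I \<and> card J = Suc (Suc 0)} = {}"
    proof (rule equals0I)
      fix J assume J: "J \<in> {J. J \<subseteq> ?I \<and> card J = Suc (Suc 0)}"
      then have "card J \<le> card ?I" by (intro card_mono) auto
      then show False using J less.prems True m by simp
    qed
    have "elementary ?I (Suc (Suc 0)) = \<zero>" unfolding elementary_def eq by simp
    then show ?thesis using additive_subgroup.zero_closed[OF add] by simp
  next
    case False
    have "card ?I = m - 1" using less.prems by (simp add: card_Diff_singleton)
    then have "card ?I = n + (n - 1)" using n m by simp
    then show ?thesis using False n by (intro gens[of "n - 1" ?I]) auto
  qed
  have c: "set (map ?y ?u) \<subseteq> carrier R" "?y i \<in> carrier R" "set (map ?y ?v) \<subseteq> carrier R"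
    using less.prems by (auto intro!: signed_closed simp del: upt_Suc)
  have PP: "esym (Suc 0) (map ?y ?u) \<otimes> esym (Suc 0) (map ?y ?u) \<in> L"
  proof (rule esym_signed_square_mem[OF L])
    show "X j \<otimes> X j \<in> L" if "j \<in> set ?u" for j using that less.prems by (intro less.IH) auto
  qed (use less.prems in auto)
  have anti: "?y i \<otimes> esym (Suc 0) (map ?y ?u) = \<ominus> (esym (Suc 0) (map ?y ?u) \<otimes> ?y i)"
    using less.prems by (intro signed_esym_anticommute) auto
  have "?y i \<otimes> ?y i \<in> L"
    by (rule esym_square_mem[OF L c e[unfolded el] e'[unfolded el'] PP anti])
  then show ?case using signed_square[OF less.prems] by simp
qed

text \<open>At the first \<open>q = 2t - 1\<close> violating the ballot condition, \<open>A = J \<inter> {..q}\<close> has \<open>t\<close> elements. For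
  \<open>I = A \<union> {q + 1..m}\<close>, the polynomial \<open>\<epsilon>\<^sub>t\<^sup>I\<close> lies in the left ideal, and its terms other than the one of \<open>A\<close>
  have a larger sum of indices.\<close>

lemma word_prod_sorted_mem:
  assumes M: "additive_subgroup M R" "L \<subseteq> M"
    and ballot: "\<And>J. J \<subseteq> {1..m} \<Longrightarrow> (\<And>q. 2 * card (J \<inter> {..q}) \<le> q) \<Longrightarrow>
      word_prod (sorted_list_of_set J) \<in> M"
    and J: "J \<subseteq> {1..m}"
  shows "word_prod (sorted_list_of_set J) \<in> M"
  using J
proof (induction "\<Sum>{1..m} - \<Sum>J" arbitrary: J rule: less_induct)
  case less
  show ?case
  proof (cases "\<forall>q. 2 * card (J \<inter> {..q}) \<le> q")
    case True
    then show ?thesis using ballot less.prems by blast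
  next
    case False
    define q where "q = (LEAST q. q < 2 * card (J \<inter> {..q}))"
    define t where "t = card (J \<inter> {..q})"
    have finJ: "finite J" using less.prems finite_subset by blast
    have ex: "\<exists>q. q < 2 * card (J \<inter> {..q})" using False not_le by blast
    have qt: "q < 2 * t" unfolding t_def q_def using LeastI_ex[OF ex] .
    have qmin: "2 * card (J \<inter> {..p}) \<le> p" if "p < q" for p
      using not_less_Least[of p "\<lambda>q. q < 2 * card (J \<inter> {..q})"] that unfolding q_def by simp
    have "q \<noteq> 0"
    proof
      assume "q = 0"
      then have "J \<inter> {..q} = {}" using less.prems by auto
      then show False using qt by (simp add: t_def)
    qed
    have "J \<inter> {..q} \<subseteq> insert q (J \<inter> {..q - 1})" by auto
    then have "t \<le> Suc (card (J \<inter> {..q - 1}))"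
    proof -
      assume sub: "J \<inter> {..q} \<subseteq> insert q (J \<inter> {..q - 1})"
      have "t \<le> card (insert q (J \<inter> {..q - 1}))"
        unfolding t_def by (rule card_mono) (use finJ sub in auto)
      also have "\<dots> \<le> Suc (card (J \<inter> {..q - 1}))" using finJ by (simp add: card_insert_if)
      finally show ?thesis .
    qed
    \<comment> \<open>Minimality gives \<open>2 * card (J \<inter> {..q - 1}) \<le> q - 1\<close>,
      and passing from \<open>q - 1\<close> to \<open>q\<close> adds at most one element; with
      \<open>q < 2 * t\<close> only one value is left.\<close>
    then have q: "q = 2 * t - 1" using qt qmin[of "q - 1"] \<open>q \<noteq> 0\<close> by simp
    have qm: "q \<le> m"
    proof (rule ccontr)
      assume "\<not> q \<le> m"
      then have "J \<inter> {..q} = J \<inter> {..m}" using less.prems by auto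
      then show False using qmin[of m] qt \<open>\<not> q \<le> m\<close> by (simp add: t_def)
    qed
    have t: "1 \<le> t" "t \<le> n" using q qm m \<open>q \<noteq> 0\<close> by auto
    define A B where "A = J \<inter> {..q}" and "B = J - A"
    \<comment> \<open>Deleting the \<open>q - t = t - 1\<close> points up to \<open>q\<close> that
      are not in \<open>A\<close> leaves \<open>2 * n - (t - 1) = n + k\<close> points for
      \<open>k = n + 1 - t\<close>, and \<open>t\<close> is the least degree allowed for this
      \<open>k\<close>.\<close>
    define I where "I = {1..m} - ({1..q} - A)"
    have AB: "A \<subseteq> {1..q}" "card A = t" "finite A" "finite B" "B \<subseteq> {1..m}" "A \<inter> B = {}" "A \<union> B = J" "A \<subseteq> {1..m}"
      using less.prems finJ by (auto simp: A_def B_def t_def)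
    have Bq: "\<And>x. x \<in> B \<Longrightarrow> q < x" by (auto simp: A_def B_def)
    have "card ({1..q} - A) = t - 1" using AB q by (simp add: card_Diff_subset)
    moreover have "card I = m - card ({1..q} - A)"
      unfolding I_def using qm by (subst card_Diff_subset) auto
    ultimately have cI: "card I = n + (n + 1 - t)" using t m by simp
    have IV: "I \<subseteq> {1..m}" by (auto simp: I_def)
    have AI: "A \<subseteq> I" using AB by (auto simp: I_def)
    have el: "elementary I t \<in> L"
    proof -
      define k where "k = n + 1 - t"
      have k: "n + 1 = t + k" "1 \<le> k" using t by (auto simp: k_def)
      then show ?thesis using gens[of k I t] IV cI t by (simp add: k_def[symmetric])
    qed
    let ?W = "word_prod (sorted_list_of_set B)"
    let ?F = "\<lambda>K. foldr (\<lambda>i p. signed I i \<otimes> p) (sorted_list_of_set K) \<one>"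
    let ?S = "{K. K \<subseteq> I \<and> card K = t}"
    have finI: "finite I" using IV finite_subset by blast
    have finS: "finite ?S" using finI by simp
    have Wc: "?W \<in> carrier R" using AB by simp
    have finK: "finite K" "set (sorted_list_of_set K) \<subseteq> {1..m}" if "K \<in> ?S" for K
      using that finI IV finite_subset[of K I] by auto
    have Fc: "?F K \<in> carrier R" if "K \<in> ?S" for K
      using signed_word_closed[OF finK(2)[OF that]] .
    have approx: "?W \<otimes> ?F K \<approx> word_prod (sorted_list_of_set B @ sorted_list_of_set K)" if "K \<in> ?S" for K
    proof -
      have "?W \<otimes> ?F K \<approx> ?W \<otimes> word_prod (sorted_list_of_set K)"
        by (rule up_to_sign_mult) (use signed_word[OF finK(2)[OF that]] Wc finK(2)[OF that] in auto)
      then show ?thesis using finK(2)[OF that] AB by (subst word_prod_append) auto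
    qed
    have merge: "word_prod (sorted_list_of_set B @ sorted_list_of_set K) \<approx> word_prod (sorted_list_of_set (B \<union> K))"
      if "K \<in> ?S" "B \<inter> K = {}" for K
    proof (rule word_prod_mset)
      have "set (sorted_list_of_set B @ sorted_list_of_set K) = set (sorted_list_of_set (B \<union> K))"
        "distinct (sorted_list_of_set B @ sorted_list_of_set K)"
        using finK[OF that(1)] AB that(2) by auto
      then show "mset (sorted_list_of_set B @ sorted_list_of_set K) = mset (sorted_list_of_set (B \<union> K))"
        using set_eq_iff_mset_eq_distinct[of "sorted_list_of_set B @ sorted_list_of_set K" "sorted_list_of_set (B \<union> K)"]
        by simp
      show "set (sorted_list_of_set B @ sorted_list_of_set K) \<subseteq> {1..m}"
        using finK(2)[OF that(1)] AB by auto
    qed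
    \<comment> \<open>The word of \<open>B\<close> is multiplied from the left, as \<open>L\<close>
      is a left ideal. A collision of \<open>K\<close> with \<open>B\<close> produces a square;
      otherwise \<open>K\<close> exchanges points of \<open>A\<close>, all at most \<open>q\<close>,
      for as many points beyond \<open>q\<close>, so the sum grows and the induction hypothesis
      applies.\<close>
    have other: "?W \<otimes> ?F K \<in> M" if K: "K \<in> ?S" "K \<noteq> A" for K
    proof (cases "B \<inter> K = {}")
      case False
      then have "\<not> distinct (sorted_list_of_set B @ sorted_list_of_set K)" using finK[OF K(1)] AB by auto
      then have "word_prod (sorted_list_of_set B @ sorted_list_of_set K) \<in> L"
        using finK(2)[OF K(1)] AB square_mem by (intro word_prod_square_mem[OF L]) auto
      then show ?thesis using up_to_sign_mem[OF M(1) approx[OF K(1)]] M(2) by blast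
    next
      case True
      have sub: "B \<union> K \<subseteq> {1..m}" using AB K(1) IV by auto
      have fK: "finite K" using finK[OF K(1)] by simp
      have "\<Sum>A < \<Sum>K"
      proof -
        have cards: "card (K - A) = card (A - K)"
          using AB(2,3) K(1) fK by (simp add: card_Diff_subset_Int Int_commute)
        have "A - K \<noteq> {}"
          using K AB(2,3) fK card_subset_eq[of K A] by auto
        then have c: "0 < card (A - K)" using AB(3) by (simp add: card_gt_0_iff)
        have "\<Sum>(A - K) \<le> card (A - K) * q"
        proof -
          have "x \<le> q" if "x \<in> A - K" for x using AB(1) that by auto
          then show ?thesis using sum_bounded_above[of "A - K" "\<lambda>x. x" q] by simp
        qed
        also have "\<dots> < card (K - A) * Suc q" using c cards by simp
        also have "\<dots> \<le> \<Sum>(K - A)"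
        proof -
          have "Suc q \<le> x" if "x \<in> K - A" for x
          proof -
            have "x \<in> I" "x \<notin> A" using that K(1) by auto
            then show ?thesis by (auto simp: I_def)
          qed
          then show ?thesis using sum_bounded_below[of "K - A" "Suc q" "\<lambda>x. x"] by simp
        qed
        finally have "\<Sum>(A - K) < \<Sum>(K - A)" .
        moreover have "\<Sum>A = \<Sum>(A - K) + \<Sum>(A \<inter> K)" "\<Sum>K = \<Sum>(K - A) + \<Sum>(A \<inter> K)"
          using sum.Int_Diff[OF AB(3), of "\<lambda>x. x" K] sum.Int_Diff[OF fK, of "\<lambda>x. x" A]
          by (simp_all add: Int_commute)
        ultimately show ?thesis by simp
      qed
      then have "\<Sum>J < \<Sum>(B \<union> K)"
        using AB(3,4,6,7) fK True by (simp add: sum.union_disjoint flip: AB(7))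
      moreover have "\<Sum>(B \<union> K) \<le> \<Sum>{1..m}" by (rule sum_mono2) (use sub in auto)
      ultimately have "word_prod (sorted_list_of_set (B \<union> K)) \<in> M"
        using sub by (intro less.hyps) auto
      moreover have "?W \<otimes> ?F K \<approx> word_prod (sorted_list_of_set (B \<union> K))"
        using up_to_sign_trans[OF approx[OF K(1)] merge[OF K(1) True]] sub finite_subset[OF sub] by simp
      ultimately show ?thesis using up_to_sign_mem[OF M(1)] by blast
    qed
    have AS: "A \<in> ?S" using AI AB by simp
    have "?W \<otimes> elementary I t \<in> M" using L el Wc M(2) by (auto simp: left_ideal_def)
    also have "?W \<otimes> elementary I t = (\<Oplus>K\<in>?S. ?W \<otimes> ?F K)"
      unfolding elementary_def using finS Wc Fc by (intro finsum_rdistr) auto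
    also have "\<dots> = (\<Oplus>K\<in>insert A (?S - {A}). ?W \<otimes> ?F K)"
      using AS by (simp add: insert_absorb)
    also have "\<dots> = ?W \<otimes> ?F A \<oplus> (\<Oplus>K\<in>?S - {A}. ?W \<otimes> ?F K)"
      using finS Wc Fc AS by (subst finsum_insert) auto
    finally have total: "?W \<otimes> ?F A \<oplus> (\<Oplus>K\<in>?S - {A}. ?W \<otimes> ?F K) \<in> M" .
    have restM: "(\<Oplus>K\<in>T. ?W \<otimes> ?F K) \<in> M" if "T \<subseteq> ?S - {A}" for T
    proof -
      have "finite T" using that finS finite_subset by blast
      then show ?thesis using that
      proof (induction T rule: finite_induct)
        case empty
        then show ?case using additive_subgroup.zero_closed[OF M(1)] by simp
      next
        case (insert K T)
        then show ?case using additive_subgroup.a_closed[OF M(1)] other Wc Fc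
          by (subst finsum_insert) auto
      qed
    qed
    have rc: "(\<Oplus>K\<in>?S - {A}. ?W \<otimes> ?F K) \<in> carrier R" using Wc Fc by (intro finsum_closed) auto
    have Ac: "?W \<otimes> ?F A \<in> carrier R" using Wc Fc[OF AS] by simp
    have "(?W \<otimes> ?F A \<oplus> (\<Oplus>K\<in>?S - {A}. ?W \<otimes> ?F K)) \<oplus> \<ominus> (\<Oplus>K\<in>?S - {A}. ?W \<otimes> ?F K) \<in> M"
      using total restM[OF order_refl] additive_subgroup.a_closed[OF M(1)] additive_subgroup.a_inv_closed[OF M(1)] by blast
    then have AM: "?W \<otimes> ?F A \<in> M" using rc Ac by (simp add: a_assoc r_neg)
    have "?W \<otimes> ?F A \<approx> word_prod (sorted_list_of_set (B \<union> A))"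
      using up_to_sign_trans[OF approx[OF AS] merge[OF AS]] AB less.prems finJ by (simp add: Un_commute Int_commute)
    then have "word_prod (sorted_list_of_set (B \<union> A)) \<approx> ?W \<otimes> ?F A"
      using up_to_sign_def Ac less.prems finJ AB(7) by (metis Un_commute minus_minus set_sorted_list_of_set word_prod_closed)
    then show ?thesis using up_to_sign_mem[OF M(1) _ AM] AB(7) by (simp add: Un_commute)
  qed
qed

lemma word_prod_mem:
  assumes M: "additive_subgroup M R" "L \<subseteq> M"
    and ballot: "\<And>J. J \<subseteq> {1..m} \<Longrightarrow> (\<And>q. 2 * card (J \<inter> {..q}) \<le> q) \<Longrightarrow>
      word_prod (sorted_list_of_set J) \<in> M"
    and w: "set w \<subseteq> {1..m}"
  shows "word_prod w \<in> M"
proof (cases "distinct w")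
  case False
  then show ?thesis using word_prod_square_mem[OF L square_mem w] M(2) by blast
next
  case True
  have "mset w = mset (sorted_list_of_set (set w))"
    using True by (metis distinct_sorted_list_of_set finite_set set_eq_iff_mset_eq_distinct set_sorted_list_of_set)
  then have "word_prod w \<approx> word_prod (sorted_list_of_set (set w))" using w by (intro word_prod_mset)
  moreover have "word_prod (sorted_list_of_set (set w)) \<in> M"
    using word_prod_sorted_mem[OF M ballot w] by blast
  ultimately show ?thesis using up_to_sign_mem[OF M(1)] by blast
qed

end

end


subsection \<open>The kernel of the evaluation homomorphism\<close>

lemma OPol_skew_variables: "skew_variables (OPol m) m (pol_var m)"
proof (intro skew_variables.intro skew_variables_axioms.intro OPol_ring)
  interpret ring_hom_ring "free_ring m" "OPol m" "opol_class m" by (rule opol_class_hom)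
  show "pol_var m i \<in> carrier (OPol m)" if "i \<in> {1..m}" for i
    using that by (simp add: pol_var_class word_ind_closed)
qed (rule pol_var_anticommute)

lemma OPol_signed: "skew_variables.signed (OPol m) (pol_var m) I i = signed_var m I i"
  by (simp add: skew_variables.signed_def[OF OPol_skew_variables] signed_var_def)

lemma OPol_elementary: "skew_variables.elementary (OPol m) (pol_var m) I r = odd_elementary m I r"
  by (simp add: skew_variables.elementary_def[OF OPol_skew_variables] odd_elementary_def OPol_signed)

lemma OPol_word_prod: "skew_variables.word_prod (OPol m) (pol_var m) w = opol_word m w"
  by (simp add: skew_variables.word_prod_def[OF OPol_skew_variables] opol_word_def)

lemma free_scaled_closed: "set w \<subseteq> {1..m} \<Longrightarrow> (\<lambda>u. c * word_ind w u) \<in> carrier (free_ring m)"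
  by (simp add: free_carrier word_ind_def)

lemma free_minus:
  assumes "f \<in> carrier (free_ring m)"
  shows "\<ominus>\<^bsub>free_ring m\<^esub> f = (\<lambda>w. - f w)"
proof -
  interpret ring "free_ring m" by (rule free_ring_ring)
  show ?thesis using assms by (intro minus_equality) (auto simp: free_carrier)
qed

lemma signed_var_class:
  assumes "i \<in> {1..m}"
  shows "signed_var m I i = opol_class m (\<lambda>u. (-1) ^ card {j \<in> I. j < i} * word_ind [i] u)"
proof -
  interpret ring_hom_ring "free_ring m" "OPol m" "opol_class m" by (rule opol_class_hom)
  have c: "word_ind [i] \<in> carrier (free_ring m)" using assms by (simp add: word_ind_closed)
  have "\<ominus>\<^bsub>OPol m\<^esub> opol_class m (word_ind [i]) = opol_class m (\<lambda>u. - word_ind [i] u)"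
    using hom_a_inv[OF c] free_minus[OF c] by simp
  then show ?thesis by (simp add: signed_var_def pol_var_class)
qed

lemma signed_word_class:
  assumes "distinct w" "set w \<subseteq> {1..m}"
  shows "foldr (\<lambda>i p. signed_var m I i \<otimes>\<^bsub>OPol m\<^esub> p) w \<one>\<^bsub>OPol m\<^esub> =
    opol_class m (\<lambda>u. position_sign I (set w) * word_ind w u)"
  using assms
proof (induction w)
  interpret ring_hom_ring "free_ring m" "OPol m" "opol_class m" by (rule opol_class_hom)
  {
    case Nil
    then show ?case using hom_one by (simp add: position_sign_def)
  next
    case (Cons i w)
    let ?s = "(-1) ^ card {j \<in> I. j < i} :: int" and ?p = "position_sign I (set w)"
    have c: "(\<lambda>u. ?s * word_ind [i] u) \<in> carrier (free_ring m)" "(\<lambda>u. ?p * word_ind w u) \<in> carrier (free_ring m)"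
      using Cons.prems by (auto intro!: free_scaled_closed)
    have "(\<lambda>u. ?s * word_ind [i] u) \<otimes>\<^bsub>free_ring m\<^esub> (\<lambda>u. ?p * word_ind w u) =
        (\<lambda>u. ?s * ?p * (word_ind [i] \<otimes>\<^bsub>free_ring m\<^esub> word_ind w) u)"
      by (rule ext) (simp only: free_mult sum_distrib_left mult_ac)
    also have "word_ind [i] \<otimes>\<^bsub>free_ring m\<^esub> word_ind w = word_ind (i # w)"
      using word_ind_mult[of "[i]" m w] Cons.prems by simp
    also have "?s * ?p = position_sign I (set (i # w))"
      using Cons.prems by (simp add: position_sign_def)
    finally have "opol_class m (\<lambda>u. ?s * word_ind [i] u) \<otimes>\<^bsub>OPol m\<^esub> opol_class m (\<lambda>u. ?p * word_ind w u) =
        opol_class m (\<lambda>u. position_sign I (set (i # w)) * word_ind (i # w) u)"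
      using hom_mult[OF c] by simp
    then show ?case using Cons signed_var_class[of i m I] by simp
  }
qed

lemma eval_family_scaled:
  "eval_family n (\<lambda>u. c * word_ind w u) a a U =
    (if a \<in> crossingless_matchings n then c * circle_word a w U else 0)"
proof (cases "a \<in> crossingless_matchings n")
  case True
  have "word_lin (\<lambda>u. c * word_ind w u) W = c * W w" for W
    by (subst word_lin_eq_sum[of "{w}"]) (auto simp: word_ind_def)
  then show ?thesis using True by (simp add: eval_family_apply)
qed (simp add: eval_family_def)

lemma odd_elementary_eval:
  assumes C: "C \<in> mult_rules n"
    and h: "ring_hom_ring (OPol (2 * n)) (OZ n C) h"
    and eval: "\<And>f. f \<in> carrier (free_ring (2 * n)) \<Longrightarrow> h (opol_class (2 * n) f) = eval_family n f"
    and I: "I \<subseteq> {1..2 * n}" "card I = n + k" and r: "n < r + k"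
  shows "odd_elementary (2 * n) I r \<in> carrier (OPol (2 * n))"
    and "h (odd_elementary (2 * n) I r) = \<zero>\<^bsub>OZ n C\<^esub>"
proof -
  let ?m = "2 * n"
  interpret ring_hom_ring "OPol ?m" "OZ n C" h by fact
  interpret cls: ring_hom_ring "free_ring ?m" "OPol ?m" "opol_class ?m" by (rule opol_class_hom)
  let ?S = "{J. J \<subseteq> I \<and> card J = r}"
  let ?f = "\<lambda>J u. position_sign I J * word_ind (sorted_list_of_set J) u"
  have finI: "finite I" using I(1) finite_subset by blast
  have finS: "finite ?S" using finI by simp
  have J: "distinct (sorted_list_of_set J)" "set (sorted_list_of_set J) = J" "J \<subseteq> {1..?m}" if "J \<in> ?S" for J
    using that I(1) finite_subset[of J I] finI by auto
  have fc: "?f J \<in> carrier (free_ring ?m)" if "J \<in> ?S" for J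
    using J[OF that] by (intro free_scaled_closed) simp
  have cc: "opol_class ?m (?f J) \<in> carrier (OPol ?m)" if "J \<in> ?S" for J
    by (rule cls.hom_closed) (rule fc[OF that])
  have "odd_elementary ?m I r = (\<Oplus>\<^bsub>OPol ?m\<^esub>J\<in>?S. opol_class ?m (?f J))"
    unfolding odd_elementary_def
    using J signed_word_class[of "sorted_list_of_set _" ?m I] cc by (intro R.finsum_cong') auto
  moreover show "odd_elementary ?m I r \<in> carrier (OPol ?m)"
    unfolding calculation using cc by (intro R.finsum_closed) auto
  ultimately have "h (odd_elementary ?m I r) = (\<Oplus>\<^bsub>OZ n C\<^esub>J\<in>?S. h (opol_class ?m (?f J)))"
    using hom_finsum[of "\<lambda>J. opol_class ?m (?f J)" ?S] cc by (simp add: comp_def Pi_def)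
  also have "\<dots> = (\<Oplus>\<^bsub>OZ n C\<^esub>J\<in>?S. eval_family n (?f J))"
    using eval[OF fc] eval_family_families[OF fc] OZ_carrier[OF C] by (intro S.finsum_cong') auto
  also have "\<dots> = (\<lambda>b a U. \<Sum>J\<in>?S. eval_family n (?f J) b a U)"
    by (rule OZ_finsum[OF C finS]) (rule eval_family_families[OF fc])
  also have "\<dots> = (\<lambda>b a U. 0)"
  proof (intro ext)
    fix b a U
    show "(\<Sum>J\<in>?S. eval_family n (?f J) b a U) = 0"
    proof (cases "b = a \<and> a \<in> crossingless_matchings n")
      case True
      then show ?thesis using odd_elementary_vanishes[OF _ I r, of a U] by (simp add: eval_family_scaled)
    next
      case False
      then show ?thesis by (intro sum.neutral) (auto simp: eval_family_def)
    qed
  qed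
  finally show "h (odd_elementary ?m I r) = \<zero>\<^bsub>OZ n C\<^esub>" by simp
qed

lemma gen_left_ideal_left_ideal:
  assumes R: "ring R" and S: "S \<subseteq> carrier R"
  shows "left_ideal (gen_left_ideal R S) R"
proof -
  interpret ring R by fact
  let ?A = "{L. left_ideal L R \<and> S \<subseteq> L}"
  have L: "additive_subgroup L R" "\<And>r x. r \<in> carrier R \<Longrightarrow> x \<in> L \<Longrightarrow> r \<otimes>\<^bsub>R\<^esub> x \<in> L" if "L \<in> ?A" for L
    using that by (auto simp: left_ideal_def)
  have "additive_subgroup (carrier R) R"
    by (simp add: additive_subgroup_def add.subgroup_self)
  then have top: "carrier R \<in> ?A" using S by (auto simp: left_ideal_def)
  have "additive_subgroup (\<Inter> ?A) R"
  proof (rule additive_subgroup.intro, rule subgroup.intro)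
    show "\<Inter> ?A \<subseteq> carrier (add_monoid R)" using top by auto
    show "\<one>\<^bsub>add_monoid R\<^esub> \<in> \<Inter> ?A" using additive_subgroup.zero_closed[OF L(1)] by simp
    show "x \<otimes>\<^bsub>add_monoid R\<^esub> y \<in> \<Inter> ?A" if "x \<in> \<Inter> ?A" "y \<in> \<Inter> ?A" for x y
      using that additive_subgroup.a_closed[OF L(1)] by auto
    show "inv\<^bsub>add_monoid R\<^esub> x \<in> \<Inter> ?A" if "x \<in> \<Inter> ?A" for x
      using that additive_subgroup.a_inv_closed[OF L(1)] by (auto simp: a_inv_def)
  qed
  then show ?thesis unfolding left_ideal_def gen_left_ideal_def using L(2) by auto
qed

text \<open>One inclusion is the vanishing of the generators. For the other, an element of the
  kernel is, modulo \<open>OI n\<close>, a combination of words of right sets with image 0, and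
  \<open>right_set_independent\<close> makes the combination trivial. Being a kernel,
  \<open>OI n\<close> is then two-sided.\<close>

lemma OI_kernel:
  assumes C: "C \<in> mult_rules n"
  obtains h where "ring_hom_ring (OPol (2 * n)) (OZ n C) h"
    "\<And>f. f \<in> carrier (free_ring (2 * n)) \<Longrightarrow> h (opol_class (2 * n) f) = eval_family n f"
    "OI n = a_kernel (OPol (2 * n)) (OZ n C) h"
proof -
  let ?m = "2 * n" and ?P = "OPol (2 * n)" and ?F = "free_ring (2 * n)"
  obtain h where h: "ring_hom_ring ?P (OZ n C) h"
    and eval: "\<And>f. f \<in> carrier ?F \<Longrightarrow> h (opol_class ?m f) = eval_family n f"
    using ring_hom_ring.induced_on_quotient[OF eval_family_hom[OF C] skew_ideal_ideal skew_ideal_kernel[OF C]]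
    unfolding OPol_def[symmetric] opol_class_def[symmetric] by blast
  interpret ring_hom_ring ?P "OZ n C" h by (rule h)
  interpret cls: ring_hom_ring ?F ?P "opol_class ?m" by (rule opol_class_hom)
  let ?K = "a_kernel ?P (OZ n C) h"
  let ?gens = "{odd_elementary ?m I r |I r k. k \<in> {1..n} \<and> I \<subseteq> {1..?m} \<and> card I = n + k \<and> r \<in> {n - k + 1..n + k}}"
  have gensK: "?gens \<subseteq> ?K"
  proof
    fix x assume "x \<in> ?gens"
    then obtain I r k where I: "x = odd_elementary ?m I r" "I \<subseteq> {1..?m}" "card I = n + k" "n < r + k" by auto
    then show "x \<in> ?K" using odd_elementary_eval[OF C h eval I(2-4)] unfolding a_kernel_def' by blast
  qed
  have K: "ideal ?K ?P" by (rule kernel_is_ideal)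
  have Ksub: "?K \<subseteq> carrier ?P" unfolding a_kernel_def' by blast
  have OI: "left_ideal (OI n) ?P"
    unfolding OI_def using gensK Ksub by (intro gen_left_ideal_left_ideal OPol_ring) blast
  have "left_ideal ?K ?P"
    unfolding left_ideal_def using K ideal.I_l_closed[OF K] by (auto intro: ideal.axioms)
  then have OIK: "OI n \<subseteq> ?K" using gensK unfolding OI_def gen_left_ideal_def by blast
  have gensOI: "?gens \<subseteq> OI n" unfolding OI_def gen_left_ideal_def by blast
  have add: "additive_subgroup (OI n) ?P" using OI by (simp add: left_ideal_def)
  note OIc = additive_subgroup.a_closed[OF add] additive_subgroup.a_inv_closed[OF add]
    additive_subgroup.zero_closed[OF add] subsetD[OF additive_subgroup.a_subset[OF add]]
  \<comment> \<open>Combinations of words of right sets; the words of ballot sets are among them by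
    \<open>right_set_ballot\<close>.\<close>
  define G where "G = {g \<in> carrier ?F. \<forall>w. g w \<noteq> 0 \<longrightarrow> (\<exists>J. right_set n J \<and> w = sorted_list_of_set J)}"
  have Gc: "g \<in> carrier ?F" if "g \<in> G" for g using that by (simp add: G_def)
  have G0: "(\<lambda>w. 0) \<in> G" by (simp add: G_def free_carrier)
  have G_add: "(\<lambda>w. f w + g w) \<in> G" if "f \<in> G" "g \<in> G" for f g
  proof -
    have "\<exists>J. right_set n J \<and> w = sorted_list_of_set J" if "f w + g w \<noteq> 0" for w
    proof -
      have "f w \<noteq> 0 \<or> g w \<noteq> 0" using that by auto
      then show ?thesis using \<open>f \<in> G\<close> \<open>g \<in> G\<close> unfolding G_def by blast
    qed
    then show ?thesis using free_add_closed that by (simp add: G_def)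
  qed
  have G_neg: "(\<lambda>w. - f w) \<in> G" if "f \<in> G" for f using that by (simp add: G_def free_carrier)
  \<comment> \<open>The additive subgroup spanned by \<open>OI n\<close> and these words. Once it
    contains every word, it is the whole ring.\<close>
  define M where "M = {l \<oplus>\<^bsub>?P\<^esub> opol_class ?m g |l g. l \<in> OI n \<and> g \<in> G}"
  have cG: "opol_class ?m g \<in> carrier ?P" if "g \<in> G" for g using Gc[OF that] by (rule cls.hom_closed)
  have class0: "opol_class ?m (\<lambda>w. 0) = \<zero>\<^bsub>?P\<^esub>" using cls.hom_zero by simp
  have M: "additive_subgroup M ?P"
  proof (rule additive_subgroup.intro, rule subgroup.intro)
    show "M \<subseteq> carrier (add_monoid ?P)" using OIc(4) cG by (auto simp: M_def)
    have "\<zero>\<^bsub>?P\<^esub> = \<zero>\<^bsub>?P\<^esub> \<oplus>\<^bsub>?P\<^esub> opol_class ?m (\<lambda>w. 0)" by (simp add: class0)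
    then show "\<one>\<^bsub>add_monoid ?P\<^esub> \<in> M" using OIc(3) G0 unfolding M_def by auto
  next
    fix x y assume "x \<in> M" "y \<in> M"
    then obtain l g l' g' where x: "x = l \<oplus>\<^bsub>?P\<^esub> opol_class ?m g" "l \<in> OI n" "g \<in> G"
      and y: "y = l' \<oplus>\<^bsub>?P\<^esub> opol_class ?m g'" "l' \<in> OI n" "g' \<in> G" unfolding M_def by blast
    have sum: "opol_class ?m (\<lambda>w. g w + g' w) = opol_class ?m g \<oplus>\<^bsub>?P\<^esub> opol_class ?m g'"
      using cls.hom_add[OF Gc[OF x(3)] Gc[OF y(3)]] by simp
    have "x \<oplus>\<^bsub>?P\<^esub> y = (l \<oplus>\<^bsub>?P\<^esub> l') \<oplus>\<^bsub>?P\<^esub> opol_class ?m (\<lambda>w. g w + g' w)"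
      unfolding x(1) y(1) sum using OIc(4)[OF x(2)] OIc(4)[OF y(2)] cG[OF x(3)] cG[OF y(3)]
      by (simp add: R.a_ac)
    then show "x \<otimes>\<^bsub>add_monoid ?P\<^esub> y \<in> M"
      using OIc(1)[OF x(2) y(2)] G_add[OF x(3) y(3)] unfolding M_def by auto
  next
    fix x assume "x \<in> M"
    then obtain l g where x: "x = l \<oplus>\<^bsub>?P\<^esub> opol_class ?m g" "l \<in> OI n" "g \<in> G" unfolding M_def by blast
    have neg: "opol_class ?m (\<lambda>w. - g w) = \<ominus>\<^bsub>?P\<^esub> opol_class ?m g"
      using cls.hom_a_inv[OF Gc[OF x(3)]] free_minus[OF Gc[OF x(3)]] by simp
    have "\<ominus>\<^bsub>?P\<^esub> x = \<ominus>\<^bsub>?P\<^esub> l \<oplus>\<^bsub>?P\<^esub> opol_class ?m (\<lambda>w. - g w)"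
      unfolding x(1) neg using OIc(4)[OF x(2)] cG[OF x(3)] by (simp add: R.minus_add)
    then show "inv\<^bsub>add_monoid ?P\<^esub> x \<in> M"
      using OIc(2)[OF x(2)] G_neg[OF x(3)] unfolding M_def a_inv_def[symmetric] by auto
  qed
  have OIM: "OI n \<subseteq> M"
  proof
    fix l assume l: "l \<in> OI n"
    then have "l = l \<oplus>\<^bsub>?P\<^esub> opol_class ?m (\<lambda>w. 0)" using OIc(4) by (simp add: class0)
    then show "l \<in> M" using l G0 unfolding M_def by blast
  qed
  have ballot: "opol_word ?m (sorted_list_of_set J) \<in> M"
    if J: "J \<subseteq> {1..?m}" "\<And>q. 2 * card (J \<inter> {..q}) \<le> q" for J
  proof -
    have set: "set (sorted_list_of_set J) \<subseteq> {1..?m}" using J(1) finite_subset[OF J(1)] by simp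
    have "right_set n J" by (rule right_set_ballot[OF J])
    then have "word_ind (sorted_list_of_set J) \<in> G"
      using word_ind_closed[OF set] by (auto simp: G_def word_ind_def)
    moreover have "opol_word ?m (sorted_list_of_set J) = \<zero>\<^bsub>?P\<^esub> \<oplus>\<^bsub>?P\<^esub> opol_class ?m (word_ind (sorted_list_of_set J))"
      using cG[OF calculation] opol_class_word[OF set] by simp
    ultimately show ?thesis using OIc(3) unfolding M_def by blast
  qed
  have words: "opol_word ?m w \<in> M" if "set w \<subseteq> {1..?m}" for w
    using skew_variables.word_prod_mem[OF OPol_skew_variables refl OI _ M OIM _ that,
        unfolded OPol_elementary OPol_word_prod] gensOI ballot by blast
  have all: "opol_class ?m f \<in> M" if f: "f \<in> carrier ?F" for f
    using f
  proof (rule free_induct[where P = "\<lambda>f. opol_class ?m f \<in> M"])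
    show "opol_class ?m (\<lambda>w. 0) \<in> M" using additive_subgroup.zero_closed[OF M] by (simp add: class0)
    show "opol_class ?m (word_ind w) \<in> M" if "set w \<subseteq> {1..?m}" for w
      using words[OF that] opol_class_word[OF that] by simp
    show "opol_class ?m (\<lambda>w. f w + g w) \<in> M"
      if "f \<in> carrier ?F" "g \<in> carrier ?F" "opol_class ?m f \<in> M" "opol_class ?m g \<in> M" for f g
      using additive_subgroup.a_closed[OF M that(3,4)] cls.hom_add[OF that(1,2)] by simp
    show "opol_class ?m (\<lambda>w. - f w) \<in> M" if "f \<in> carrier ?F" "opol_class ?m f \<in> M" for f
      using additive_subgroup.a_inv_closed[OF M that(2)] cls.hom_a_inv[OF that(1)] free_minus[OF that(1)] by simp
  qed
  have "?K \<subseteq> OI n"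
  proof
    fix p assume p: "p \<in> ?K"
    then have "p \<in> opol_class ?m ` carrier ?F" using Ksub opol_class_surj by blast
    then have "p \<in> M" using all by blast
    then obtain l g where lg: "p = l \<oplus>\<^bsub>?P\<^esub> opol_class ?m g" "l \<in> OI n" "g \<in> G" unfolding M_def by blast
    have hp: "h p = \<zero>\<^bsub>OZ n C\<^esub>" and hl: "h l = \<zero>\<^bsub>OZ n C\<^esub>"
      using p lg(2) OIK unfolding a_kernel_def' by blast+
    have "h p = h l \<oplus>\<^bsub>OZ n C\<^esub> h (opol_class ?m g)"
      unfolding lg(1) by (rule hom_add[OF OIc(4)[OF lg(2)] cG[OF lg(3)]])
    then have "h (opol_class ?m g) = \<zero>\<^bsub>OZ n C\<^esub>"
      using hp hl hom_closed[OF cG[OF lg(3)]] S.l_zero by metis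
    then have "eval_family n g = (\<lambda>b a U. 0)" using eval[OF Gc[OF lg(3)]] by simp
    then have "g = (\<lambda>w. 0)"
      using right_set_independent[OF Gc[OF lg(3)]] lg(3) by (simp add: G_def)
    then have "p = l" using lg OIc(4) by (simp add: class0)
    then show "p \<in> OI n" using lg(2) by simp
  qed
  then show thesis using that[OF h eval] OIK by blast
qed


subsection \<open>The isomorphism\<close>

text \<open>A word of length \<open>k\<close> is mapped to exterior degree \<open>k\<close>, so
  dropping the words of other lengths from a preimage does not change a homogeneous image.\<close>

lemma eval_family_degree:
  assumes C: "C \<in> mult_rules n"
  shows "eval_family n ` {f \<in> carrier (free_ring (2 * n)). \<forall>w. f w \<noteq> 0 \<longrightarrow> 2 * int (length w) = d} = OZ_degree n C d"
proof
  have card: "card U = length w" if "circle_word a w U \<noteq> 0" for a w U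
    using wedge_list_nonzeroD[of "map (circle_of a) w" U] that distinct_card[of "map (circle_of a) w"]
    by (simp add: circle_word_def)
  show "eval_family n ` {f \<in> carrier (free_ring (2 * n)). \<forall>w. f w \<noteq> 0 \<longrightarrow> 2 * int (length w) = d} \<subseteq> OZ_degree n C d"
  proof clarify
    fix f assume f: "f \<in> carrier (free_ring (2 * n))" "\<forall>w. f w \<noteq> 0 \<longrightarrow> 2 * int (length w) = d"
    show "eval_family n f \<in> OZ_degree n C d"
      unfolding OZ_degree_iff[OF C eval_family_families[OF f(1)]]
    proof (intro allI impI)
      fix a U assume nz: "eval_family n f a a U \<noteq> 0"
      then have "a \<in> crossingless_matchings n"
        using families_entry_zero[OF eval_family_families[OF f(1)], of a a]
        by (cases "a \<in> crossingless_matchings n") simp_all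
      then have "word_lin f (\<lambda>w. circle_word a w U) \<noteq> 0" using nz by (simp add: eval_family_apply)
      then obtain w where "f w \<noteq> 0" "circle_word a w U \<noteq> 0" by (rule word_lin_nonzeroD)
      then show "2 * int (card U) = d" using f(2) card by auto
    qed
  qed
  show "OZ_degree n C d \<subseteq> eval_family n ` {f \<in> carrier (free_ring (2 * n)). \<forall>w. f w \<noteq> 0 \<longrightarrow> 2 * int (length w) = d}"
  proof
    fix z assume z: "z \<in> OZ_degree n C d"
    then have zf: "z \<in> families n" using OZ_carrier[OF C] by (simp add: OZ_degree_def)
    obtain f where f: "f \<in> carrier (free_ring (2 * n))" "eval_family n f = z" using eval_family_surj[OF zf] by blast
    define g where "g w = (if 2 * int (length w) = d then f w else 0)" for w
    have fin: "finite {w. f w \<noteq> 0}" using f(1) by (simp add: free_carrier)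
    have supp: "{w. g w \<noteq> 0} \<subseteq> {w. f w \<noteq> 0}" by (auto simp: g_def)
    have g: "g \<in> carrier (free_ring (2 * n))"
      using f(1) finite_subset[OF supp fin] supp unfolding free_carrier by blast
    have "eval_family n g = z"
    proof (rule families_eqI[OF eval_family_families[OF g] zf], rule ext)
      fix a U assume a: "a \<in> crossingless_matchings n"
      have "eval_family n g a a U = (\<Sum>w | f w \<noteq> 0. g w * circle_word a w U)"
        using word_lin_eq_sum[OF fin supp] a by (simp add: eval_family_apply)
      also have "\<dots> = (\<Sum>w | f w \<noteq> 0. (if 2 * int (card U) = d then f w * circle_word a w U else 0))"
        by (intro sum.cong) (use card in \<open>force simp: g_def\<close>)+
      also have "\<dots> = (if 2 * int (card U) = d then eval_family n f a a U else 0)"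
        using a by (simp add: eval_family_apply word_lin_def)
      also have "\<dots> = z a a U"
        using z f(2) OZ_degree_iff[OF C zf] by auto
      finally show "eval_family n g a a U = z a a U" .
    qed
    then show "z \<in> eval_family n ` {f \<in> carrier (free_ring (2 * n)). \<forall>w. f w \<noteq> 0 \<longrightarrow> 2 * int (length w) = d}"
      using g by (force simp: g_def)
  qed
qed

text \<open>The quotient by the kernel maps isomorphically onto the center. This map is inverted,
  because the statement asks for one that starts at \<open>OZ n C\<close>, and the grading of
  \<open>OSpringer n\<close> is obtained by transport along the inverse.\<close>

lemma OZ_OSpringer_graded_isomorphic:
  assumes C: "C \<in> mult_rules n"
  shows "graded_isomorphic (OZ n C) (OZ_degree n C) (OSpringer n) (OSpringer_degree n)"
proof -
  let ?m = "2 * n"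
  obtain h where h: "ring_hom_ring (OPol ?m) (OZ n C) h"
    and eval: "\<And>f. f \<in> carrier (free_ring ?m) \<Longrightarrow> h (opol_class ?m f) = eval_family n f"
    and K: "OI n = a_kernel (OPol ?m) (OZ n C) h" using OI_kernel[OF C] by blast
  interpret ring_hom_ring "OPol ?m" "OZ n C" h by (rule h)
  interpret cls: ring_hom_ring "free_ring ?m" "OPol ?m" "opol_class ?m" by (rule opol_class_hom)
  have surj: "h ` carrier (OPol ?m) = carrier (OZ n C)"
  proof
    show "carrier (OZ n C) \<subseteq> h ` carrier (OPol ?m)"
    proof
      fix z assume "z \<in> carrier (OZ n C)"
      then obtain f where f: "f \<in> carrier (free_ring ?m)" "eval_family n f = z"
        using eval_family_surj OZ_carrier[OF C] by blast
      then show "z \<in> h ` carrier (OPol ?m)"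
        using eval[OF f(1)] cls.hom_closed[OF f(1)] by (intro image_eqI[of _ _ "opol_class ?m f"]) auto
    qed
  qed auto
  define \<theta> where "\<theta> = (\<lambda>X. the_elem (h ` X))"
  have iso: "\<theta> \<in> ring_iso (OSpringer n) (OZ n C)"
    unfolding OSpringer_def K \<theta>_def by (rule FactRing_iso_set[OF surj])
  \<comment> \<open>By definition \<open>OI n\<close> is only a left ideal; that the quotient is a
    ring comes from its description as a kernel.\<close>
  have ringS: "ring (OSpringer n)"
    unfolding OSpringer_def K by (rule ideal.quotient_is_ring[OF kernel_is_ideal])
  have \<theta>: "\<theta> (OI n +>\<^bsub>OPol ?m\<^esub> opol_class ?m f) = eval_family n f" if "f \<in> carrier (free_ring ?m)" for f
    unfolding \<theta>_def K using the_elem_simp[OF cls.hom_closed[OF that]] eval[OF that] by simp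
  have deg: "OSpringer_degree n d = (\<lambda>f. OI n +>\<^bsub>OPol ?m\<^esub> opol_class ?m f) `
      {f \<in> carrier (free_ring ?m). \<forall>w. f w \<noteq> 0 \<longrightarrow> 2 * int (length w) = d}" for d
    by (auto simp: OSpringer_degree_def opol_class_def)
  have image: "\<theta> ` OSpringer_degree n d = OZ_degree n C d" for d
    unfolding deg image_image eval_family_degree[OF C, symmetric]
    by (rule image_cong) (simp_all add: \<theta>)
  have sub: "OSpringer_degree n d \<subseteq> carrier (OSpringer n)" for d
    unfolding deg OSpringer_def FactRing_def A_RCOSETS_def' using cls.hom_closed by force
  let ?g = "inv_into (carrier (OSpringer n)) \<theta>"
  have g: "?g \<in> ring_iso (OZ n C) (OSpringer n)" by (rule ring_iso_set_sym[OF ringS iso])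
  have inj: "inj_on \<theta> (carrier (OSpringer n))" using ring_iso_memE(5)[OF iso] by (simp add: bij_betw_def)
  have img: "?g ` OZ_degree n C d = OSpringer_degree n d" for d
    unfolding image[symmetric] by (rule inv_into_image_cancel[OF inj sub])
  have "graded_ring (OSpringer n) (OSpringer_degree n)"
    by (rule graded_ring_transfer[OF OZ_graded[OF C] ringS g img])
  then show ?thesis using OZ_graded[OF C] g img unfolding graded_isomorphic_def by blast
qed

theorem theorem2:
  fixes n :: nat and C :: mult_rule
  assumes "C \<in> mult_rules n"
  shows "ring (OZ n C) \<and>
    (\<forall>C' \<in> mult_rules n.
       graded_isomorphic (OZ n C) (OZ_degree n C) (OZ n C') (OZ_degree n C')) \<and>
    graded_isomorphic (OZ n C) (OZ_degree n C) (OSpringer n) (OSpringer_degree n)"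
  using assms OZ_ring OZ_graded_isomorphic OZ_OSpringer_graded_isomorphic by blast

end
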